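(* Let $n$ be a positive integer and let $C=\mathbb{Z}/(2n)\mathbb{Z}$. Let $X(q)$ be the $q$-Catalan number $$X(q)=C_n(q)=\frac{1}{[n+1]_q}{2n \brack n}_q .$$ Let $X$ be either the set $H_n$ of handshake patterns of size $2n$ equipped with the $C$-action of rotation, or the set $NC(n)$ of noncrossing partitions of $[n]$ equipped with the $C$-action of Kreweras complementation. Then the triple $(X,C,X(q))$ exhibits the cyclic sieving phenomenon.
   Context: $[m]_q=1+q+\dots+q^{m-1}$, $[m]!_q=[m]_q\cdots[1]_q$, ${m\brack k}_q=\frac{[m]!_q}{[k]!_q[m-k]!_q}$. A handshake pattern of size $2n$ is a perfect matching on the points $1,2,\dots,2n$ written clockwise around a circle such that, when the matching is drawn inside the circle, no two of its arcs intersect. Rotation: the generator of $C$ rotates the matching clockwise by one position. A noncrossing partition of $[n]=\{1,\dots,n\}$ is a set partition such that whenever $1\le a<b<c<d\le n$ with $a,c$ in a block $P_i$ and $b,d$ in a block $P_j$, then $i=j$. Kreweras complementation: write $1,1',2,2',\dots,n,n'$ clockwise around a circle, draw the blocks of $\pi\in NC(n)$ on $1,\dots,n$, and let $\pi'$ be the unique maximal (in refinement order) noncrossing partition of $1',\dots,n'$ whose blocks do not intersect the blocks of $\pi$; the Kreweras complement of $\pi$ is $\pi'$ regarded as a partition of $[n]$ via $i'\mapsto i$. The generator of $C$ acts on $NC(n)$ by $\pi\mapsto\pi'$. Cyclic sieving: let $C$ be a finite cyclic group with generator $c$ acting on a finite set $X$, let $\zeta\in\mathbb{C}$ be a root of unity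 of the same multiplicative order as $c$, and let $X(q)\in\mathbb{Q}[q]$. The triple $(X,C,X(q))$ exhibits the cyclic sieving phenomenon if for every integer $d\ge 0$ the number $|X^{c^d}|$ of elements of $X$ fixed by $c^d$ equals $X(\zeta^d)$. *)

theory Defs
  imports
    Complex_Main
    "HOL-Computational_Algebra.Polynomial"
    "HOL-Library.Disjoint_Sets"
    "HOL-Algebra.Elementary_Groups"
    "HOL-Algebra.Multiplicative_Group"
    "HOL-Algebra.Group_Action"
begin

section \<open>q-analogues\<close>

definition q_int :: "nat \<Rightarrow> rat poly"
  where "q_int m = (\<Sum>i<m. Polynomial.monom 1 i)"

definition q_fact :: "nat \<Rightarrow> rat poly"
  where "q_fact m = (\<Prod>i=1..m. q_int i)"

text \<open>
  The quotients below are Euclidean quotients of polynomials. They are exact (for \<open>k \<le> m\<close> in the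
  case of the q-binomial coefficient), see \<open>q_binomial_exact\<close> and \<open>q_catalan_exact\<close>.
\<close>

definition q_binomial :: "nat \<Rightarrow> nat \<Rightarrow> rat poly"
  where "q_binomial m k = q_fact m div (q_fact k * q_fact (m - k))"

definition q_catalan :: "nat \<Rightarrow> rat poly"
  where "q_catalan n = q_binomial (2 * n) n div q_int (n + 1)"

lemma q_int_nonzero: "m > 0 \<Longrightarrow> q_int m \<noteq> 0"
proof -
  assume "m > 0"
  then have "Polynomial.coeff (q_int m) 0 = 1"
    by (simp add: q_int_def coeff_sum)
  then show ?thesis by auto
qed

lemma q_int_add: "q_int (k + l) = q_int k + Polynomial.monom 1 k * q_int l"
proof (induction l)
  case (Suc l)
  then show ?case
    by (simp add: q_int_def algebra_simps mult_monom)
qed (simp add: q_int_def)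

lemma q_fact_0: "q_fact 0 = 1"
  by (simp add: q_fact_def)

lemma q_fact_Suc: "q_fact (Suc m) = q_int (Suc m) * q_fact m"
  by (simp add: q_fact_def mult.commute)

lemma q_fact_nonzero: "q_fact m \<noteq> 0"
  by (simp add: q_fact_def q_int_nonzero)

lemma q_fact_mult_dvd: "q_fact k * q_fact l dvd q_fact (k + l)"
proof (induction "k + l" arbitrary: k l)
  case 0
  then show ?case by (simp add: q_fact_0)
next
  case (Suc m)
  show ?case
  proof (cases "k = 0 \<or> l = 0")
    case True
    then show ?thesis by (elim disjE) (simp_all add: q_fact_0)
  next
    case False
    then obtain k' l' where kl: "k = Suc k'" "l = Suc l'"
      by (meson not0_implies_Suc)
    have m: "m = k' + l" "m = k + l'" using Suc.hyps(2) kl by auto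
    have "q_fact k * q_fact l dvd q_int k * q_fact m"
      using mult_dvd_mono[OF dvd_refl Suc.hyps(1)[OF m(1)], of "q_int k"] kl m(1)
      by (simp add: q_fact_Suc mult.assoc)
    moreover have "q_fact k * q_fact l dvd q_int l * q_fact m"
      using mult_dvd_mono[OF dvd_refl Suc.hyps(1)[OF m(2)], of "q_int l"] kl m(2)
      by (simp add: q_fact_Suc ac_simps)
    ultimately have "q_fact k * q_fact l dvd
        q_int k * q_fact m + Polynomial.monom 1 k * (q_int l * q_fact m)"
      by (meson dvd_add dvd_mult)
    also have "\<dots> = q_int (k + l) * q_fact m"
      by (simp add: q_int_add algebra_simps)
    also have "\<dots> = q_fact (k + l)"
      by (simp add: q_fact_Suc flip: Suc.hyps(2))
    finally show ?thesis .
  qed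
qed

lemma q_binomial_exact:
  assumes "k \<le> m"
  shows "q_binomial m k * (q_fact k * q_fact (m - k)) = q_fact m"
  using q_fact_mult_dvd[of k "m - k"] assms by (simp add: q_binomial_def)

lemma q_catalan_exact: "q_catalan n * q_int (n + 1) = q_binomial (2 * n) n"
proof -
  define B where "B = q_binomial (2 * n) n"
  have B: "B * (q_fact n * q_fact n) = q_fact (2 * n)"
    using q_binomial_exact[of n "2 * n"] by (simp add: B_def mult_2)
  have "q_int (n + 1) dvd q_int n * B"
  proof (cases n)
    case 0
    then show ?thesis by (simp add: q_int_def)
  next
    case (Suc k)
    have "q_fact k * q_fact (Suc n) dvd q_fact (2 * n)"
      using q_fact_mult_dvd[of k "Suc n"] Suc by (simp add: mult_2)
    then obtain D where D: "q_fact (2 * n) = q_fact k * q_fact (Suc n) * D"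
      by (elim dvdE)
    have "(q_int n * B) * (q_fact n * q_fact n) = q_int n * q_fact (2 * n)"
      using B by (simp add: mult.assoc)
    also have "\<dots> = (q_int (Suc n) * D) * ((q_int n * q_fact k) * q_fact n)"
      unfolding D q_fact_Suc by (simp only: ac_simps)
    also have "q_int n * q_fact k = q_fact n"
      using Suc by (simp add: q_fact_Suc)
    finally have "q_int n * B = q_int (Suc n) * D"
      by (simp add: q_fact_nonzero)
    then show ?thesis by simp
  qed
  moreover have "B = q_int (n + 1) * B - Polynomial.monom 1 1 * (q_int n * B)"
  proof -
    have "q_int (1 + n) = 1 + Polynomial.monom 1 1 * q_int n"
      by (simp only: q_int_add) (simp add: q_int_def)
    then show ?thesis by (simp add: algebra_simps)
  qed
  ultimately have "q_int (n + 1) dvd B"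
    by (metis dvd_diff dvd_mult dvd_triv_left)
  then show ?thesis by (simp add: q_catalan_def B_def)
qed

section \<open>Cyclic sieving\<close>

definition has_mult_order :: "complex \<Rightarrow> nat \<Rightarrow> bool"
  where "has_mult_order z m \<longleftrightarrow> m > 0 \<and> z ^ m = 1 \<and> (\<forall>k. 0 < k \<and> k < m \<longrightarrow> z ^ k \<noteq> 1)"

text \<open>
  The group \<open>G\<close> is cyclic with distinguished generator \<open>c\<close>, and acts on the set \<open>X\<close> through \<open>\<phi>\<close>.
  Being an action is part of the property.
\<close>

definition cyclic_sieving ::
    "('g, 'm) monoid_scheme \<Rightarrow> 'g \<Rightarrow> 'x set \<Rightarrow> ('g \<Rightarrow> 'x \<Rightarrow> 'x) \<Rightarrow> rat poly \<Rightarrow> bool"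
  where "cyclic_sieving G c X \<phi> P \<longleftrightarrow>
    group G \<and> finite (carrier G) \<and> c \<in> carrier G \<and> subgroup_generated G {c} = G \<and>
    finite X \<and> group_action G X \<phi> \<and>
    (\<forall>\<zeta>. has_mult_order \<zeta> (group.ord G c) \<longrightarrow>
      (\<forall>d::nat. of_nat (card (invariants X \<phi> (c [^]\<^bsub>G\<^esub> d))) = poly (map_poly of_rat P) (\<zeta> ^ d)))"

text \<open>
  The action on \<open>X\<close> of a cyclic group of residues in which the generator 1 acts as \<open>f\<close>. The
  restriction makes the maps extensional, as \<^const>\<open>BijGroup\<close> requires.
\<close>

definition residue_action :: "'x set \<Rightarrow> ('x \<Rightarrow> 'x) \<Rightarrow> int \<Rightarrow> 'x \<Rightarrow> 'x"
  where "residue_action X f k = restrict (f ^^ nat k) X"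

section \<open>Handshake patterns\<close>

text \<open>
  Two disjoint sets of points of a circle, labelled clockwise by increasing natural numbers,
  intersect when drawn inside the circle iff they contain two pairs of points alternating along
  the circle.
\<close>

definition crosses :: "nat set \<Rightarrow> nat set \<Rightarrow> bool"
  where "crosses A B \<longleftrightarrow>
    (\<exists>a\<in>A. \<exists>c\<in>A. \<exists>b\<in>B. \<exists>d\<in>B. (a < b \<and> b < c \<and> c < d) \<or> (b < a \<and> a < d \<and> d < c))"

definition perfect_matching_on :: "nat set \<Rightarrow> nat set set \<Rightarrow> bool"
  where "perfect_matching_on V M \<longleftrightarrow> partition_on V M \<and> (\<forall>A\<in>M. card A = 2)"

definition handshake_patterns :: "nat \<Rightarrow> nat set set set"
  where "handshake_patterns n =
    {M. perfect_matching_on {1..2 * n} M \<and> (\<forall>A\<in>M. \<forall>B\<in>M. A \<noteq> B \<longrightarrow> \<not> crosses A B)}"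

text \<open>The point \<open>i\<close> moves to \<open>i + 1\<close>, and \<open>2 * n\<close> moves to 1.\<close>

definition rotate_matching :: "nat \<Rightarrow> nat set set \<Rightarrow> nat set set"
  where "rotate_matching n M = (\<lambda>A. (\<lambda>i. i mod (2 * n) + 1) ` A) ` M"

section \<open>Noncrossing partitions and the Kreweras complement\<close>

definition noncrossing_partitions :: "nat \<Rightarrow> nat set set set"
  where "noncrossing_partitions n =
    {P. partition_on {1..n} P \<and>
        (\<forall>A\<in>P. \<forall>B\<in>P. \<forall>a b c d.
           a < b \<and> b < c \<and> c < d \<and> a \<in> A \<and> c \<in> A \<and> b \<in> B \<and> d \<in> B \<longrightarrow> A = B)}"

text \<open>
  On the circle \<open>1, 1', 2, 2', \<dots>, n, n'\<close> the point \<open>i\<close> is at position \<open>2 * i - 1\<close> and the point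
  \<open>i'\<close> at position \<open>2 * i\<close>. The partition \<open>Q\<close> of the primed points is represented by the
  partition of \<open>{1..n}\<close> obtained by removing the primes.
\<close>

definition kreweras_compatible :: "nat \<Rightarrow> nat set set \<Rightarrow> nat set set set"
  where "kreweras_compatible n P =
    {Q \<in> noncrossing_partitions n.
       \<forall>A\<in>P. \<forall>B\<in>Q. \<not> crosses ((\<lambda>i. 2 * i - 1) ` A) ((\<lambda>i. 2 * i) ` B)}"

definition kreweras_complement :: "nat \<Rightarrow> nat set set \<Rightarrow> nat set set"
  where "kreweras_complement n P =
    (THE Q. Q \<in> kreweras_compatible n P \<and>
       (\<forall>R\<in>kreweras_compatible n P. refines {1..n} Q R \<longrightarrow> R = Q))"

end

theory Submission
  imports Defs
begin

text \<open>
  Both actions are reduced to rotation of noncrossing matchings. Thickening the blocks of a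
  noncrossing partition turns it into a matching: the arcs of the matching \<open>M\<close> cut the disc into
  regions, the regions at the odd vertices form the partition, and those at the even vertices its
  Kreweras complement. Rotating \<open>M\<close> by one position exchanges the two kinds of vertices, so that
  complementation is conjugate to the inverse rotation.

  Let \<open>e = gcd(d, 2n) < 2n\<close>. A matching fixed by rotation by \<open>d\<close> is fixed by rotation by \<open>e\<close>, and
  is recovered, by matching parentheses on the unrolled circle, from the \<open>e\<close>-periodic set of
  points at which an arc starts in its short clockwise direction. This set has \<open>e div 2\<close> points per
  period, any such set occurs if \<open>e\<close> is even or \<open>e = n\<close> (for odd \<open>e = n\<close> exactly one arc is a
  diameter), and none occurs otherwise. Hence there are \<open>e choose (e div 2)\<close> or no fixed points. All
  matchings are counted by ballot sequences. On the other side, at a root of unity of order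
  \<open>m = 2n div e\<close> the factors \<open>q_int m\<close> of the q-factorials are split off and compared.
\<close>

text \<open>The short orientation describes a matching completely only if every arc closes within
  half a turn. A proper divisor \<open>e\<close> of \<open>2 * n\<close> is at most
  \<open>n\<close>, and a walk that gains no height over a period brings each opener back within
  \<open>e\<close> steps, so arcs found by matching parentheses are automatically short. For the
  trivial rotation this fails; hence the separate count with arcs oriented by labels. The circle has
  no preferred starting point, so no ballot condition is available when \<open>e < 2 * n\<close>;
  its replacement is the drift of the walk over one period. Returning arcs force drift \<le> 0, the
  same argument read backwards forces drift \<ge> 0 when there is no diameter, and a diameter makes
  the drift -1. Conversely, at drift -1 the steps without a partner are record lows lying in one
  residue class modulo \<open>n\<close>, and joining antipodal ones gives the diameter. At a root of
  unity of order \<open>m\<close> the same distinction is the exponent of the vanishing factor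
  \<open>q_int m\<close>: it is 1 if \<open>e\<close> is odd and \<open>m \<noteq> 2\<close>, and 0
  otherwise. An inverse rotation is as good as a rotation here, since a power of a bijection and its
  inverse have the same fixed points.\<close>

section \<open>Actions of residue groups\<close>

lemma ord_integer_mod_group_1:
  assumes "N > 1"
  shows "group.ord (integer_mod_group N) 1 = N"
proof -
  interpret group "integer_mod_group N" by simp
  have "1 \<in> carrier (integer_mod_group N)" using assms by simp
  then have "ord 1 dvd k \<longleftrightarrow> int k mod int N = 0" for k
    by (simp add: pow_eq_id[symmetric])
  then have "ord 1 dvd k \<longleftrightarrow> N dvd k" for k
    by (simp flip: int_dvd_int_iff dvd_eq_mod_eq_0)
  then show ?thesis by (meson dvd_antisym dvd_refl)
qed

lemma subgroup_generated_integer_mod_group_1: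
  assumes "N > 1"
  shows "subgroup_generated (integer_mod_group N) {1} = integer_mod_group N"
proof -
  interpret group "integer_mod_group N" by simp
  have 1: "1 \<in> carrier (integer_mod_group N)" using assms by simp
  have "x \<in> generate (integer_mod_group N) {1}" if "x \<in> carrier (integer_mod_group N)" for x
  proof -
    have "x = 1 [^]\<^bsub>integer_mod_group N\<^esub> x"
      using that assms by (simp add: carrier_integer_mod_group int_pow_integer_mod_group)
    then show ?thesis using generate_pow[OF 1] by blast
  qed
  moreover have "generate (integer_mod_group N) {1} \<subseteq> carrier (integer_mod_group N)"
    using 1 by (intro generate_incl) simp
  ultimately have "generate (integer_mod_group N) {1} = carrier (integer_mod_group N)" by blast
  then show ?thesis using 1 by (simp add: subgroup_generated_def)
qed

lemma funpow_mod_on: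
  assumes "\<And>x. x \<in> X \<Longrightarrow> f x \<in> X" and "\<And>x. x \<in> X \<Longrightarrow> (f ^^ N) x = x" and "x \<in> X"
  shows "(f ^^ (k mod N)) x = (f ^^ k) x"
proof -
  have X: "(f ^^ k) x \<in> X" for k by (induction k) (use assms in auto)
  have "(f ^^ (N * q)) y = y" if "y \<in> X" for q y
    by (induction q) (use assms that in \<open>auto simp: funpow_add\<close>)
  then have "(f ^^ (N * (k div N) + k mod N)) x = (f ^^ (k mod N)) x"
    by (simp only: funpow_add o_apply X)
  then show ?thesis by simp
qed

lemma group_action_residue_action:
  assumes "N > 0" and f: "\<And>x. x \<in> X \<Longrightarrow> f x \<in> X" and period: "\<And>x. x \<in> X \<Longrightarrow> (f ^^ N) x = x"
  shows "group_action (integer_mod_group N) X (residue_action X f)"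
proof -
  have X: "(f ^^ k) x \<in> X" if "x \<in> X" for k x by (induction k) (use f that in auto)
  note modN = funpow_mod_on[OF f period]
  have bij: "residue_action X f k \<in> Bij X" if "0 \<le> k" "k < int N" for k
  proof -
    have inv: "(f ^^ nat k) ((f ^^ (N - nat k)) x) = x" "(f ^^ (N - nat k)) ((f ^^ nat k) x) = x"
      if "x \<in> X" for x
      using period[OF that] \<open>0 \<le> k\<close> \<open>k < int N\<close>
      by (simp_all add: funpow_add[symmetric, THEN fun_cong, unfolded o_apply])
    have "bij_betw (f ^^ nat k) X X"
      by (rule bij_betw_byWitness[where f' = "f ^^ (N - nat k)"]) (use inv X in auto)
    then show ?thesis by (simp add: Bij_def residue_action_def bij_betw_restrict_eq)
  qed
  have "residue_action X f ((k + l) mod int N) = compose X (residue_action X f k) (residue_action X f l)"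
    if "0 \<le> k" "0 \<le> l" for k l
  proof
    fix x
    have "nat ((k + l) mod int N) = (nat k + nat l) mod N"
      using that by (simp add: nat_mod_distrib nat_add_distrib)
    then show "residue_action X f ((k + l) mod int N) x =
        compose X (residue_action X f k) (residue_action X f l) x"
      using modN[of x "nat k + nat l"] X[of x]
      by (simp add: residue_action_def compose_def restrict_def funpow_add)
  qed
  then have "residue_action X f \<in> hom (integer_mod_group N) (BijGroup X)"
    using assms(1) bij by (auto simp: hom_def BijGroup_def carrier_integer_mod_group)
  then show ?thesis
    by (simp add: group_action_def group_hom_def group_hom_axioms_def group_BijGroup)
qed

text \<open>Common interface of both actions: the \<open>d\<close>-th power of the generator is the
  residue \<open>d mod N\<close>, which acts like \<open>f ^^ d\<close> because
  \<open>f ^^ N\<close> is the identity on \<open>X\<close>. Only fixed points of iterates remain to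
  be counted.\<close>

lemma cyclic_sieving_residue_action:
  assumes "N > 1" and "finite X" and f: "\<And>x. x \<in> X \<Longrightarrow> f x \<in> X"
    and period: "\<And>x. x \<in> X \<Longrightarrow> (f ^^ N) x = x"
    and fixed: "\<And>\<zeta> d. has_mult_order \<zeta> N \<Longrightarrow>
      of_nat (card {x \<in> X. (f ^^ d) x = x}) = poly (map_poly of_rat P) (\<zeta> ^ d)"
  shows "cyclic_sieving (integer_mod_group N) 1 X (residue_action X f) P"
proof -
  have "invariants X (residue_action X f) (1 [^]\<^bsub>integer_mod_group N\<^esub> d) = {x \<in> X. (f ^^ d) x = x}" for d :: nat
    using funpow_mod_on[OF f period]
    by (auto simp: invariants_def residue_action_def nat_mod_distrib)
  moreover have "group_action (integer_mod_group N) X (residue_action X f)"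
    using assms by (intro group_action_residue_action) auto
  ultimately show ?thesis
    using assms unfolding cyclic_sieving_def
    by (simp add: ord_integer_mod_group_1 subgroup_generated_integer_mod_group_1 carrier_integer_mod_group)
qed

section \<open>Walks with unit steps\<close>

text \<open>Point \<open>i\<close> is the step from height \<open>h i\<close> to height
  \<open>h (i + 1)\<close>, upwards for an opening parenthesis. The starting height is left free,
  since only differences of heights matter.\<close>

definition walk :: "(int \<Rightarrow> int) \<Rightarrow> int set \<Rightarrow> bool"
  where "walk h S \<longleftrightarrow> (\<forall>i. h (i + 1) = h i + (if i \<in> S then 1 else -1))"

text \<open>Matching of parentheses: \<open>j\<close> is the step by which the walk first returns to
  the level from which step \<open>i\<close> rose.\<close>

definition excursion :: "(int \<Rightarrow> int) \<Rightarrow> int \<Rightarrow> int \<Rightarrow> bool"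
  where "excursion h i j \<longleftrightarrow> i < j \<and> h (j + 1) = h i \<and> (\<forall>k. i < k \<and> k \<le> j \<longrightarrow> h i < h k)"

lemma walk_exists: "\<exists>h. walk h S"
proof
  define s :: "int \<Rightarrow> int" where "s i = (if i \<in> S then 1 else -1)" for i
  define h where "h i = (if i \<ge> 0 then sum s {0..<i} else - sum s {i..<0})" for i
  have "h (i + 1) = h i + s i" for i
  proof (cases "i \<ge> 0")
    case True
    then have "{0..<i + 1} = insert i {0..<i}" by auto
    then show ?thesis using True by (simp add: h_def)
  next
    case False
    then have "{i..<0} = insert i {i + 1..<0}" by auto
    then show ?thesis using False by (cases "i = -1") (simp_all add: h_def)
  qed
  then show "walk h S" by (simp add: walk_def s_def)
qed

lemma walk_count:
  assumes "walk h S" and "i \<le> j"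
  shows "h j = h i + 2 * int (card (S \<inter> {i..<j})) - (j - i)"
  using assms(2)
proof (induction j rule: int_ge_induct)
  case base
  then show ?case by simp
next
  case (step j)
  have eq: "{i..<j + 1} = insert j {i..<j}" using step.hyps by auto
  have "card (S \<inter> {i..<j + 1}) = card (S \<inter> {i..<j}) + (if j \<in> S then 1 else 0)"
    unfolding eq by simp
  then show ?case using step assms(1) by (simp add: walk_def)
qed

lemma excursionD:
  assumes "excursion h i j"
  shows "i < j" "h (j + 1) = h i" "i < k \<Longrightarrow> k \<le> j \<Longrightarrow> h i < h k"
  using assms by (simp_all add: excursion_def)

lemma excursion_right_unique:
  assumes "excursion h i j" "excursion h i j'"
  shows "j = j'"
  using excursionD(1,2)[OF assms(1)] excursionD(1,2)[OF assms(2)]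
    excursionD(3)[OF assms(1), of "j' + 1"] excursionD(3)[OF assms(2), of "j + 1"]
  by linarith

lemma excursion_left_unique:
  assumes "excursion h i j" "excursion h i' j"
  shows "i = i'"
  using excursionD(1,2)[OF assms(1)] excursionD(1,2)[OF assms(2)]
    excursionD(3)[OF assms(1), of i'] excursionD(3)[OF assms(2), of i]
  by linarith

text \<open>The height \<open>h (c + 1) = h a\<close> lies below \<open>h b\<close> by the first
  excursion, while \<open>c + 1\<close> is a time inside the second one, which stays above
  \<open>h b\<close>.\<close>

lemma excursion_noncrossing:
  assumes "excursion h a c" "excursion h b d" "a < b" "b < c" "c < d"
  shows False
  using excursionD(2)[OF assms(1)] excursionD(3)[OF assms(1), of b] excursionD(3)[OF assms(2), of "c + 1"] assms(3-5)
  by linarith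

lemma walk_step: "walk h S \<Longrightarrow> h (i + 1) = h i + (if i \<in> S then 1 else -1)"
  by (simp add: walk_def)

lemma excursion_ends:
  assumes "walk h S" "excursion h i j"
  shows "i \<in> S" "j \<notin> S"
  using excursionD(1,2)[OF assms(2)] excursionD(3)[OF assms(2), of "i + 1"] excursionD(3)[OF assms(2), of j]
    walk_step[OF assms(1), of i] walk_step[OF assms(1), of j]
  by (auto split: if_splits)

text \<open>Discrete intermediate values: the first later time at height at most \<open>h i\<close>
  has height exactly \<open>h i\<close>, because the walk descends by single steps. The bound
  \<open>t\<close> localises the partner.\<close>

lemma excursion_right:
  assumes "walk h S" "i \<in> S" "i < t" "h t \<le> h i"
  shows "\<exists>j<t. excursion h i j"
proof -
  \<comment> \<open>The search starts at time \<open>i + 1\<close>, so the least \<open>m\<close>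
    makes \<open>i + m\<close> the last step of the excursion.\<close>
  define P where "P k \<longleftrightarrow> h (i + 1 + int k) \<le> h i" for k :: nat
  define m where "m = (LEAST k. P k)"
  have ex: "P (nat (t - i - 1))" using assms by (simp add: P_def)
  have Pm: "P m" unfolding m_def by (rule LeastI[of P, OF ex])
  have min: "\<not> P k" if "k < m" for k using that unfolding m_def by (rule not_less_Least)
  have "m \<le> nat (t - i - 1)" unfolding m_def by (rule Least_le[of P, OF ex])
  have "h (i + 1) = h i + 1" using assms by (simp add: walk_def)
  then obtain l where l: "m = Suc l" using Pm by (cases m) (auto simp: P_def)
  have gt: "h i < h k" if "i < k" "k < i + 1 + int m" for k
    proof -
    have "nat (k - i - 1) < m" using that by linarith
    then show ?thesis using min[of "nat (k - i - 1)"] that by (simp add: P_def)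
  qed
  have "h (i + int m + 1) \<ge> h (i + int m) - 1"
    using walk_step[OF assms(1), of "i + int m"] by simp
  then have "h (i + int m + 1) = h i"
    using gt[of "i + int m"] Pm l by (simp add: P_def algebra_simps)
  then have "excursion h i (i + int m)" using gt l by (simp add: excursion_def)
  moreover have "i + int m < t" using \<open>m \<le> nat (t - i - 1)\<close> assms(3) by linarith
  ultimately show ?thesis by blast
qed

text \<open>Mirror image of \<open>excursion_right\<close>: the search runs backwards for the latest
  time up to \<open>j\<close> whose height is at most \<open>h (j + 1)\<close>.\<close>

lemma excursion_left:
  assumes "walk h S" "j \<notin> S" "t \<le> j" "h t \<le> h (j + 1)"
  shows "\<exists>i\<ge>t. excursion h i j"
proof -
  define P where "P k \<longleftrightarrow> h (j - int k) \<le> h (j + 1)" for k :: nat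
  define m where "m = (LEAST k. P k)"
  have ex: "P (nat (j - t))" using assms by (simp add: P_def)
  have Pm: "P m" unfolding m_def by (rule LeastI[of P, OF ex])
  have min: "\<not> P k" if "k < m" for k using that unfolding m_def by (rule not_less_Least)
  have "m \<le> nat (j - t)" unfolding m_def by (rule Least_le[of P, OF ex])
  have down: "h (j + 1) = h j - 1" using assms by (simp add: walk_def)
  then obtain l where l: "m = Suc l" using Pm by (cases m) (auto simp: P_def)
  have gt: "h (j + 1) < h k" if "j - int m < k" "k \<le> j" for k
    proof -
    have "nat (j - k) < m" using that by linarith
    then show ?thesis using min[of "nat (j - k)"] that by (simp add: P_def)
  qed
  have "h (j - int m) \<ge> h (j - int m + 1) - 1"
    using walk_step[OF assms(1), of "j - int m"] by simp
  then have eq: "h (j - int m) = h (j + 1)"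
    using gt[of "j - int m + 1"] Pm l by (simp add: P_def algebra_simps)
  then have "excursion h (j - int m) j" using gt l by (simp add: excursion_def)
  moreover have "j - int m \<ge> t" using \<open>m \<le> nat (j - t)\<close> assms(3) by linarith
  ultimately show ?thesis by blast
qed

text \<open>Abstracts what two systems of arcs share: short arcs on the unrolled circle and arcs
  read along the labels 1 to \<open>2 * n\<close>. The assumption \<open>nested\<close> also says
  that every point under an arc has a partner, so no diameter ends under an arc.\<close>

locale nested_arcs =
  fixes S :: "int set" and h :: "int \<Rightarrow> int" and T :: "int \<Rightarrow> int \<Rightarrow> bool"
  assumes walk: "walk h S"
    and arc: "T a c \<Longrightarrow> a < c \<and> a \<in> S \<and> c \<notin> S"
    and unique: "T i j \<or> T j i \<Longrightarrow> T i k \<or> T k i \<Longrightarrow> j = k"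
    and nested: "T a c \<Longrightarrow> a < i \<Longrightarrow> i < c \<Longrightarrow> \<exists>j. a < j \<and> j < c \<and> (T i j \<or> T j i)"
begin

text \<open>Induction on the length: split off the arc from \<open>x\<close> to its partner
  \<open>j\<close>. What lies under it is closed by \<open>nested\<close>; what lies beyond it is
  closed because, partners being unique, none of its partners is \<open>x\<close>, \<open>j\<close>
  or a point under the arc.\<close>

lemma closed_interval:
  assumes "x \<le> y" and "\<And>i. x \<le> i \<Longrightarrow> i < y \<Longrightarrow> \<exists>j. x \<le> j \<and> j < y \<and> (T i j \<or> T j i)"
  shows "h y = h x \<and> (\<forall>k. x \<le> k \<and> k \<le> y \<longrightarrow> h x \<le> h k)"
  using assms
proof (induction "nat (y - x)" arbitrary: x y rule: less_induct)
  case less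
  show ?case
  proof (cases "x = y")
    case False
    then have "x < y" using less.prems by simp
    then obtain j where j: "x \<le> j" "j < y" "T x j \<or> T j x" using less.prems(2)[of x] by auto
    then have T: "T x j" "x < j" using arc[of j x] arc[of x j] by auto
    have inner: "h j = h (x + 1) \<and> (\<forall>k. x + 1 \<le> k \<and> k \<le> j \<longrightarrow> h (x + 1) \<le> h k)"
    proof (rule less.hyps)
      show "nat (j - (x + 1)) < nat (y - x)" using j T by simp
      show "\<exists>k. x + 1 \<le> k \<and> k < j \<and> (T i k \<or> T k i)" if "x + 1 \<le> i" "i < j" for i
        using nested[OF T(1), of i] that by (meson add1_zle_eq)
    qed (use T in simp)
    have outer: "h y = h (j + 1) \<and> (\<forall>k. j + 1 \<le> k \<and> k \<le> y \<longrightarrow> h (j + 1) \<le> h k)"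
    proof (rule less.hyps)
      show "nat (y - (j + 1)) < nat (y - x)" using j T by simp
      show "\<exists>k. j + 1 \<le> k \<and> k < y \<and> (T i k \<or> T k i)" if i: "j + 1 \<le> i" "i < y" for i
      proof -
        obtain k where k: "x \<le> k" "k < y" "T i k \<or> T k i"
          using less.prems(2)[of i] i T by auto
        moreover have "k \<noteq> x" using unique[of x i j] k T i by auto
        moreover have "k \<noteq> j" using unique[of j i x] k T i by auto
        moreover have "\<not> (x < k \<and> k < j)"
        proof
          assume "x < k \<and> k < j"
          then obtain l where "x < l" "l < j" "T k l \<or> T l k" using nested[OF T(1), of k] by blast
          then show False using unique[of k i l] k i by auto
        qed
        ultimately show ?thesis using T by (intro exI[of _ k]) auto
      qed
    qed (use j in simp)
    have "h (x + 1) = h x + 1" "h (j + 1) = h j - 1"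
      using walk arc[OF T(1)] by (auto simp: walk_def)
    then have "h y = h x" using inner outer by simp
    moreover have "h x \<le> h k" if "x \<le> k" "k \<le> y" for k
    proof -
      have "x + 1 \<le> k \<and> k \<le> j \<longrightarrow> h (x + 1) \<le> h k" "j + 1 \<le> k \<and> k \<le> y \<longrightarrow> h (j + 1) \<le> h k"
        using inner outer by blast+
      then show ?thesis using that inner[THEN conjunct1] \<open>h (x + 1) = h x + 1\<close> \<open>h (j + 1) = h j - 1\<close>
        by (cases "k = x"; cases "k \<le> j") simp_all
    qed
    ultimately show ?thesis by blast
  qed auto
qed

text \<open>The points strictly under the arc form a closed interval, where the walk stays weakly
  above \<open>h (a + 1)\<close>; the opening step makes this strict relative to \<open>h a\<close>.
  Arcs are thus determined by the set of their openers.\<close>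

lemma excursion:
  assumes "T a c"
  shows "excursion h a c"
proof -
  have "h c = h (a + 1) \<and> (\<forall>k. a + 1 \<le> k \<and> k \<le> c \<longrightarrow> h (a + 1) \<le> h k)"
  proof (rule closed_interval)
    show "\<exists>j. a + 1 \<le> j \<and> j < c \<and> (T i j \<or> T j i)" if "a + 1 \<le> i" "i < c" for i
      using nested[OF assms, of i] that by (meson add1_zle_eq)
  qed (use arc[OF assms] in simp)
  moreover have "h (a + 1) = h a + 1" "h (c + 1) = h c - 1"
    using walk arc[OF assms] by (auto simp: walk_def)
  ultimately show ?thesis using arc[OF assms] by (smt (verit) excursion_def)
qed

end

section \<open>Noncrossing matchings on the circle\<close>

lemma perfect_matching_on_pair:
  assumes "perfect_matching_on V M" "{x, y} \<in> M"
  shows "x \<noteq> y" "x \<in> V" "y \<in> V"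
proof -
  have "card {x, y} = 2" using assms by (auto simp: perfect_matching_on_def)
  then show "x \<noteq> y" by auto
  show "x \<in> V" "y \<in> V"
    using assms by (auto simp: perfect_matching_on_def partition_on_def)
qed

lemma perfect_matching_on_unique:
  assumes "perfect_matching_on V M" "{x, y} \<in> M" "{x, z} \<in> M"
  shows "y = z"
proof -
  have "{x, y} = {x, z}"
    using assms disjointD[of M "{x, y}" "{x, z}"] by (auto simp: perfect_matching_on_def partition_on_def)
  then show ?thesis by (metis doubleton_eq_iff)
qed

lemma perfect_matching_on_block:
  assumes "perfect_matching_on V M" "A \<in> M"
  obtains x y where "A = {x, y}"
  using assms unfolding perfect_matching_on_def by (metis card_2_iff)

lemma perfect_matching_on_ex:
  assumes "perfect_matching_on V M" "x \<in> V"
  obtains y where "{x, y} \<in> M"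
proof -
  obtain A where A: "A \<in> M" "x \<in> A"
    using assms by (auto simp: perfect_matching_on_def partition_on_def)
  obtain u v where "A = {u, v}" using perfect_matching_on_block[OF assms(1) A(1)] .
  with A that show ?thesis by (metis insert_commute insert_iff singletonD)
qed

lemma perfect_matching_on_eqI:
  assumes "perfect_matching_on V M" "perfect_matching_on V M'"
    and "\<And>x y. {x, y} \<in> M \<Longrightarrow> {x, y} \<in> M'"
  shows "M = M'"
proof
  show "M \<subseteq> M'" using assms perfect_matching_on_block by (metis subsetI)
  show "M' \<subseteq> M"
  proof
    fix A assume "A \<in> M'"
    then obtain x y where A: "A = {x, y}" using perfect_matching_on_block[OF assms(2)] by metis
    then have "x \<in> V" using \<open>A \<in> M'\<close> assms(2) perfect_matching_on_pair by metis
    then obtain z where z: "{x, z} \<in> M" using perfect_matching_on_ex[OF assms(1)] by metis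
    then have "y = z"
      using perfect_matching_on_unique[OF assms(2)] assms(3) A \<open>A \<in> M'\<close> by metis
    then show "A \<in> M" using z A by simp
  qed
qed

lemma perfect_matching_on_involution:
  assumes f: "\<And>x. x \<in> V \<Longrightarrow> f x \<in> V \<and> f x \<noteq> x \<and> f (f x) = x"
  shows "perfect_matching_on V ((\<lambda>x. {x, f x}) ` V)"
    and "\<And>x y. x \<in> V \<Longrightarrow> {x, y} \<in> (\<lambda>x. {x, f x}) ` V \<longleftrightarrow> y = f x"
proof -
  have "disjnt {x, f x} {y, f y}" if "x \<in> V" "y \<in> V" "{x, f x} \<noteq> {y, f y}" for x y
  proof (rule ccontr)
    assume "\<not> disjnt {x, f x} {y, f y}"
    then have "x = y \<or> x = f y \<or> f x = y \<or> f x = f y" by (auto simp: disjnt_def)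
    then have "{x, f x} = {y, f y}" using f[OF that(1)] f[OF that(2)] by (metis insert_commute)
    then show False using that(3) by contradiction
  qed
  moreover have "\<Union> ((\<lambda>x. {x, f x}) ` V) = V" using f by blast
  ultimately have "partition_on V ((\<lambda>x. {x, f x}) ` V)"
    by (intro partition_onI) blast+
  moreover have "card {x, f x} = 2" if "x \<in> V" for x using f[OF that] by auto
  ultimately show "perfect_matching_on V ((\<lambda>x. {x, f x}) ` V)"
    unfolding perfect_matching_on_def by blast
  show "{x, y} \<in> (\<lambda>x. {x, f x}) ` V \<longleftrightarrow> y = f x" if x: "x \<in> V" for x y
  proof
    assume "{x, y} \<in> (\<lambda>x. {x, f x}) ` V"
    then obtain z where "z \<in> V" "{x, y} = {z, f z}" by blast
    then show "y = f x" using f by (metis doubleton_eq_iff)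
  qed (use x in blast)
qed

lemma handshake_patterns_iff:
  "M \<in> handshake_patterns n \<longleftrightarrow> perfect_matching_on {1..2 * n} M \<and>
    (\<forall>a b c d. {a, c} \<in> M \<and> {b, d} \<in> M \<longrightarrow> \<not> (a < b \<and> b < c \<and> c < d))"
  (is "_ \<longleftrightarrow> ?pm \<and> ?nc")
proof
  assume "M \<in> handshake_patterns n"
  then have M: ?pm and nc: "\<And>A B. A \<in> M \<Longrightarrow> B \<in> M \<Longrightarrow> A \<noteq> B \<Longrightarrow> \<not> crosses A B"
    by (auto simp: handshake_patterns_def)
  have False if "{a, c} \<in> M" "{b, d} \<in> M" "a < b" "b < c" "c < d" for a b c d
  proof -
    have "{a, c} \<noteq> {b, d}" using that by (auto simp: doubleton_eq_iff)
    then show False using nc[OF that(1,2)] that by (auto simp: crosses_def)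
  qed
  with M show "?pm \<and> ?nc" by blast
next
  assume *: "?pm \<and> ?nc"
  have "\<not> crosses A B" if AB: "A \<in> M" "B \<in> M" for A B
  proof
    assume "crosses A B"
    then obtain a b c d where abcd: "a \<in> A" "c \<in> A" "b \<in> B" "d \<in> B"
        "(a < b \<and> b < c \<and> c < d) \<or> (b < a \<and> a < d \<and> d < c)"
      unfolding crosses_def by blast
    have ne: "a \<noteq> c" "b \<noteq> d" using abcd(5) by auto
    obtain x y where "A = {x, y}" by (rule perfect_matching_on_block[OF conjunct1[OF *] AB(1)])
    then have A: "{a, c} \<in> M" using abcd(1,2) ne(1) AB(1) by (metis doubleton_eq_iff insertE singletonD)
    obtain u v where "B = {u, v}" by (rule perfect_matching_on_block[OF conjunct1[OF *] AB(2)])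
    then have B: "{b, d} \<in> M" using abcd(3,4) ne(2) AB(2) by (metis doubleton_eq_iff insertE singletonD)
    from A B * abcd(5) show False by metis
  qed
  then show "M \<in> handshake_patterns n" using * by (simp add: handshake_patterns_def)
qed

lemma finite_handshake_patterns: "finite (handshake_patterns n)"
proof -
  have "handshake_patterns n \<subseteq> Pow (Pow {1..2 * n})"
    by (auto simp: handshake_patterns_def perfect_matching_on_def partition_on_def)
  then show ?thesis by (rule finite_subset) simp
qed

text \<open>The circle is unrolled: \<open>circ n\<close> maps the integers onto the labels \<open>1, \<dots>, 2n\<close>.\<close>

definition circ :: "nat \<Rightarrow> int \<Rightarrow> nat"
  where "circ n i = nat ((i - 1) mod (2 * int n)) + 1"

lemma int_circ: "n > 0 \<Longrightarrow> int (circ n i) = (i - 1) mod (2 * int n) + 1"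
  by (simp add: circ_def)

lemma circ_range: "n > 0 \<Longrightarrow> circ n i \<in> {1..2 * n}"
proof -
  assume "n > 0"
  then have "0 \<le> (i - 1) mod (2 * int n)" "(i - 1) mod (2 * int n) < 2 * int n" by simp_all
  then show ?thesis unfolding circ_def by auto
qed

lemma circ_of_nat: "x \<in> {1..2 * n} \<Longrightarrow> circ n (int x) = x"
  by (auto simp: circ_def)

lemma circ_eq_iff: "n > 0 \<Longrightarrow> circ n i = circ n j \<longleftrightarrow> 2 * int n dvd i - j"
proof -
  assume "n > 0"
  then have "circ n i = circ n j \<longleftrightarrow> (i - 1) mod (2 * int n) = (j - 1) mod (2 * int n)"
    by (metis add_right_cancel int_circ of_nat_eq_iff)
  then show ?thesis by (simp add: mod_eq_dvd_iff)
qed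

lemma circ_inj:
  assumes "n > 0" "circ n i = circ n j" "\<bar>i - j\<bar> < 2 * int n"
  shows "i = j"
  using assms zdvd_imp_le[of "2 * int n" "\<bar>i - j\<bar>"] by (auto simp: circ_eq_iff)

lemma circ_shift [simp]: "n > 0 \<Longrightarrow> circ n (i + 2 * int n) = circ n i"
  "n > 0 \<Longrightarrow> circ n (i - 2 * int n) = circ n i"
  by (simp_all add: circ_eq_iff)

lemma circ_lift:
  assumes "n > 0" "x \<in> {1..2 * n}"
  obtains i where "a \<le> i" "i < a + 2 * int n" "circ n i = x"
proof
  let ?i = "a + (int x - a) mod (2 * int n)"
  show "a \<le> ?i" "?i < a + 2 * int n" using assms by simp_all
  have "circ n ?i = circ n (int x)"
    using assms by (simp add: circ_eq_iff) (metis add_diff_eq diff_diff_eq dvd_minus_mod dvd_diff_commute)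
  then show "circ n ?i = x" using assms by (simp add: circ_of_nat)
qed

lemma circ_Suc: "n > 0 \<Longrightarrow> circ n i mod (2 * n) + 1 = circ n (i + 1)"
proof -
  assume n: "n > 0"
  have "int (circ n i mod (2 * n) + 1) = ((i - 1) mod (2 * int n) + 1) mod (2 * int n) + 1"
    using n by (simp add: zmod_int int_circ)
  also have "\<dots> = int (circ n (i + 1))" using n by (simp add: int_circ mod_simps)
  finally show ?thesis by (simp only: of_nat_eq_iff)
qed

text \<open>Makes noncrossing independent of where the circle is cut: a window of one turn meets the
  seam between \<open>2 * n\<close> and 1 at most once, so the labels of \<open>a\<close>,
  \<open>b\<close>, \<open>c\<close>, \<open>d\<close> increase up to a cyclic shift.\<close>

lemma handshake_noncrossing:
  assumes M: "M \<in> handshake_patterns n" and n: "n > 0"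
    and "{circ n a, circ n c} \<in> M" "{circ n b, circ n d} \<in> M"
    and "a < b" "b < c" "c < d" "d < a + 2 * int n"
  shows False
proof -
  let ?N = "2 * int n"
  have wrap: "(u + t) mod ?N = (if u mod ?N + t < ?N then u mod ?N + t else u mod ?N + t - ?N)"
    if "0 \<le> t" "t < ?N" for u t
  proof -
    have r: "0 \<le> u mod ?N" "u mod ?N < ?N" using n by simp_all
    have "(u + t) mod ?N = (u mod ?N + t) mod ?N" by (simp add: mod_simps)
    also have "\<dots> = (if u mod ?N + t < ?N then u mod ?N + t else u mod ?N + t - ?N)"
    proof (cases "u mod ?N + t < ?N")
      case True
      then show ?thesis using r that by simp
    next
      case False
      have "(u mod ?N + t) mod ?N = (u mod ?N + t - ?N) mod ?N" by simp
      also have "\<dots> = u mod ?N + t - ?N" by (rule mod_pos_pos_trivial) (use False r that in linarith)+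
      finally show ?thesis using False by simp
    qed
    finally show ?thesis .
  qed
  have c: "int (circ n (a + t)) = (if int (circ n a) + t \<le> ?N then int (circ n a) + t else int (circ n a) + t - ?N)"
    if "0 \<le> t" "t < ?N" for t
    using wrap[OF that, of "a - 1"] n by (simp add: int_circ algebra_simps)
  note cs = c[of "b - a"] c[of "c - a"] c[of "d - a"]
  have nc: "\<not> (x < y \<and> y < z \<and> z < w)" if "{x, z} \<in> M" "{y, w} \<in> M" for x y z w
    using M that unfolding handshake_patterns_iff by blast
  have 4: "{circ n c, circ n a} \<in> M" "{circ n d, circ n b} \<in> M"
    using assms by (simp_all add: insert_commute)
  have "int (circ n a) \<le> ?N" using circ_range[OF n, of a] by simp
  \<comment> \<open>One instance of \<open>nc\<close> for each of the four cyclic shifts of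
    \<open>a\<close>, \<open>b\<close>, \<open>c\<close>, \<open>d\<close>.\<close>
  then show False
    using nc[OF assms(3,4)] nc[OF 4(2) assms(3)] nc[OF 4] nc[OF assms(4) 4(1)] cs assms(5-8)
    by (auto split: if_splits)
qed

text \<open>On lifts rotation is a translation by one. Noncrossing survives because
  \<open>handshake_noncrossing\<close> does not see the seam.\<close>

lemma
  assumes "M \<in> handshake_patterns n" "n > 0"
  shows rotate_handshake_closed: "rotate_matching n M \<in> handshake_patterns n"
    and rotate_handshake_iff: "{circ n i, circ n j} \<in> rotate_matching n M \<longleftrightarrow> {circ n (i - 1), circ n (j - 1)} \<in> M"
proof -
  define r where "r x = x mod (2 * n) + 1" for x
  have M: "perfect_matching_on {1..2 * n} M" using assms by (simp add: handshake_patterns_iff)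
  have rc: "r (circ n i) = circ n (i + 1)" for i using circ_Suc[OF assms(2), of i] by (simp add: r_def)
  have inj: "inj_on r {1..2 * n}"
  proof
    fix x y assume xy: "x \<in> {1..2 * n}" "y \<in> {1..2 * n}" "r x = r y"
    then have "circ n (int x + 1) = circ n (int y + 1)"
      using rc[of "int x"] rc[of "int y"] by (simp add: circ_of_nat)
    then have "circ n (int x) = circ n (int y)" using assms by (simp add: circ_eq_iff)
    then show "x = y" using xy by (simp add: circ_of_nat)
  qed
  have "r ` {1..2 * n} \<subseteq> {1..2 * n}"
    using assms by (auto simp: r_def Suc_le_eq)
  then have im: "r ` {1..2 * n} = {1..2 * n}"
    using inj by (simp add: endo_inj_surj)
  have rot: "rotate_matching n M = (`) r ` M" by (simp add: rotate_matching_def r_def[abs_def])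
  have sub: "A \<subseteq> {1..2 * n}" if "A \<in> M" for A
    using M that by (auto simp: perfect_matching_on_def partition_on_def)
  have "partition_on (r ` {1..2 * n}) ((`) r ` M)"
  proof -
    have "{} \<notin> (`) r ` M" using M by (auto simp: perfect_matching_on_def partition_on_def)
    then show ?thesis
      using partition_on_inj_image[OF _ inj, of M] M by (simp add: perfect_matching_on_def)
  qed
  moreover have "card (r ` A) = 2" if "A \<in> M" for A
    using M that sub[OF that] card_image[OF inj_on_subset[OF inj]] by (simp add: perfect_matching_on_def)
  ultimately have pm: "perfect_matching_on {1..2 * n} (rotate_matching n M)"
    unfolding perfect_matching_on_def rot im by auto
  show iff: "{circ n i, circ n j} \<in> rotate_matching n M \<longleftrightarrow> {circ n (i - 1), circ n (j - 1)} \<in> M" for i j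
  proof -
    have "{circ n i, circ n j} = r ` {circ n (i - 1), circ n (j - 1)}" by (simp add: rc)
    moreover have "{circ n (i - 1), circ n (j - 1)} \<subseteq> {1..2 * n}"
      using circ_range[OF assms(2)] by blast
    ultimately show ?thesis
      using inj_on_image_eq_iff[OF inj] sub unfolding rot by (smt (verit) image_iff)
  qed
  have False if "{a, c} \<in> rotate_matching n M" "{b, d} \<in> rotate_matching n M" "a < b" "b < c" "c < d" for a b c d
  proof -
    have V: "a \<in> {1..2 * n}" "b \<in> {1..2 * n}" "c \<in> {1..2 * n}" "d \<in> {1..2 * n}"
      using perfect_matching_on_pair[OF pm] that(1,2) by blast+
    then have "{circ n (int a - 1), circ n (int c - 1)} \<in> M" "{circ n (int b - 1), circ n (int d - 1)} \<in> M"
      using iff[of "int a" "int c"] iff[of "int b" "int d"] that(1,2) circ_of_nat by metis+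
    then show False
      by (rule handshake_noncrossing[OF assms]) (use that V in auto)
  qed
  then show "rotate_matching n M \<in> handshake_patterns n"
    using pm by (auto simp: handshake_patterns_iff)
qed

lemma rotate_handshake_funpow:
  assumes "M \<in> handshake_patterns n" "n > 0"
  shows "(rotate_matching n ^^ d) M \<in> handshake_patterns n"
    and "{circ n i, circ n j} \<in> (rotate_matching n ^^ d) M \<longleftrightarrow> {circ n (i - int d), circ n (j - int d)} \<in> M"
proof (induction d arbitrary: i j)
  case (Suc d)
  { case 1 show ?case using Suc(1) assms by (simp add: rotate_handshake_closed) }
  { case 2 show ?case using Suc(2)[of "i - 1" "j - 1"] rotate_handshake_iff[OF Suc(1) assms(2)]
      by (simp add: algebra_simps) }
qed (use assms in simp_all)

lemma handshake_eqI:
  assumes "M \<in> handshake_patterns n" "M' \<in> handshake_patterns n"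
    and "\<And>i j. {circ n i, circ n j} \<in> M \<Longrightarrow> {circ n i, circ n j} \<in> M'"
  shows "M = M'"
proof (rule perfect_matching_on_eqI)
  show pm: "perfect_matching_on {1..2 * n} M" "perfect_matching_on {1..2 * n} M'"
    using assms by (auto simp: handshake_patterns_iff)
  show "{x, y} \<in> M'" if "{x, y} \<in> M" for x y
    using assms(3)[of "int x" "int y"] that perfect_matching_on_pair[OF pm(1) that] by (simp add: circ_of_nat)
qed

lemma rotate_handshake_period:
  assumes "M \<in> handshake_patterns n" "n > 0"
  shows "(rotate_matching n ^^ (2 * n)) M = M"
proof (rule handshake_eqI)
  show "{circ n i, circ n j} \<in> M" if "{circ n i, circ n j} \<in> (rotate_matching n ^^ (2 * n)) M" for i j
    using that rotate_handshake_funpow(2)[OF assms, of i j "2 * n"] assms(2) by simp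
qed (use assms rotate_handshake_funpow(1)[OF assms] in auto)

section \<open>Rotation-invariant matchings\<close>

text \<open>Orienting arcs in their short direction, unlike orienting them from the smaller to the larger
  label, commutes with rotation; diameters remain unoriented.\<close>

definition short_arc :: "nat \<Rightarrow> nat set set \<Rightarrow> int \<Rightarrow> int \<Rightarrow> bool"
  where "short_arc n M i j \<longleftrightarrow> i < j \<and> j < i + int n \<and> {circ n i, circ n j} \<in> M"

definition short_openers :: "nat \<Rightarrow> nat set set \<Rightarrow> int set"
  where "short_openers n M = {i. \<exists>j. short_arc n M i j}"

definition diameter :: "nat \<Rightarrow> nat set set \<Rightarrow> int \<Rightarrow> bool"
  where "diameter n M p \<longleftrightarrow> {circ n p, circ n (p + int n)} \<in> M"

locale handshake =
  fixes n :: nat and M :: "nat set set"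
  assumes n: "n > 0" and M: "M \<in> handshake_patterns n"
begin

lemma pm: "perfect_matching_on {1..2 * n} M"
  using M by (simp add: handshake_patterns_iff)

lemma lift_unique:
  assumes "{circ n i, circ n j} \<in> M" "{circ n i, circ n k} \<in> M" "\<bar>j - k\<bar> < 2 * int n"
  shows "j = k"
  using perfect_matching_on_unique[OF pm assms(1,2)] circ_inj[OF n _ assms(3)] by simp

text \<open>The partner has one lift in the window of length \<open>2 * n\<close> that starts at
  \<open>i\<close>; if it lies beyond \<open>i + n\<close>, moving it back by a full turn shows that
  \<open>i\<close> closes a short arc.\<close>

lemma arc_cases:
  obtains (opener) j where "short_arc n M i j" | (closer) j where "short_arc n M j i" | (diameter) "diameter n M i"
proof -
  obtain y where y: "{circ n i, y} \<in> M" using perfect_matching_on_ex[OF pm circ_range[OF n]] .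
  obtain j where j: "i \<le> j" "j < i + 2 * int n" "circ n j = y"
    using circ_lift[OF n, of y i] perfect_matching_on_pair(3)[OF pm y] by blast
  have "j \<noteq> i" using perfect_matching_on_pair(1)[OF pm y] j by auto
  then consider "j < i + int n" | "j = i + int n" | "j > i + int n" by linarith
  then show thesis
  proof cases
    case 1
    then show thesis using j y opener[of j] \<open>j \<noteq> i\<close> by (simp add: short_arc_def)
  next
    case 2
    then show thesis using j y that(3) by (simp add: diameter_def)
  next
    case 3
    then show thesis using j y closer[of "j - 2 * int n"] n by (simp add: short_arc_def insert_commute)
  qed
qed

lemma short_arc_pair:
  assumes "short_arc n M i j \<or> short_arc n M j i"
  shows "{circ n i, circ n j} \<in> M" "\<bar>i - j\<bar> < int n"
  using assms by (auto simp: short_arc_def insert_commute)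

lemma short_arc_unique:
  assumes "short_arc n M i j \<or> short_arc n M j i" "short_arc n M i k \<or> short_arc n M k i"
  shows "j = k"
  using lift_unique[OF short_arc_pair(1)[OF assms(1)] short_arc_pair(1)[OF assms(2)]]
    short_arc_pair(2)[OF assms(1)] short_arc_pair(2)[OF assms(2)] by linarith

lemma diameter_not_short_arc:
  assumes "diameter n M i"
  shows "\<not> short_arc n M i j" "\<not> short_arc n M j i"
proof -
  have "False" if j: "short_arc n M i j \<or> short_arc n M j i"
  proof -
    have "{circ n i, circ n (i + int n)} \<in> M" using assms by (simp add: diameter_def)
    then show False
      using lift_unique[OF short_arc_pair(1)[OF j], of "i + int n"] lift_unique[OF short_arc_pair(1)[OF j], of "i - int n"]
        short_arc_pair(2)[OF j] circ_shift(1)[OF n, of "i - int n"]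
      by (cases "j < i") (auto simp: algebra_simps)
  qed
  then show "\<not> short_arc n M i j" "\<not> short_arc n M j i" by blast+
qed

lemma diameter_shift: "diameter n M i \<Longrightarrow> diameter n M (i + int n)"
  using circ_shift(1)[OF n, of i] by (simp add: diameter_def insert_commute algebra_simps)

lemma noncrossing:
  assumes "{circ n a, circ n c} \<in> M" "{circ n b, circ n d} \<in> M" "a < b" "b < c" "c < d" "d < a + 2 * int n"
  shows False
  using handshake_noncrossing[OF M n assms] .

text \<open>A partner outside would give a crossing, and both arcs being shorter than half a turn,
  the four points fit into one window. A diameter starting under the arc is longer than the arc,
  hence would cross it as well.\<close>

lemma short_arc_nested:
  assumes T: "short_arc n M a c" and i: "a < i" "i < c"
  shows "\<exists>j. a < j \<and> j < c \<and> (short_arc n M i j \<or> short_arc n M j i)"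
proof -
  have ac: "{circ n a, circ n c} \<in> M" "c < a + int n" using T by (auto simp: short_arc_def)
  show ?thesis
  proof (cases rule: arc_cases[of i])
    case (opener j)
    then have ij: "{circ n i, circ n j} \<in> M" "i < j" "j < i + int n" by (auto simp: short_arc_def)
    have "j \<noteq> c" using short_arc_unique[of c i a] opener T i by auto
    moreover have "\<not> c < j"
    proof
      assume "c < j"
      show False by (rule noncrossing[OF ac(1) ij(1) i \<open>c < j\<close>]) (use ij ac(2) i in linarith)
    qed
    ultimately show ?thesis using opener i ij by (intro exI[of _ j]) auto
  next
    case (closer j)
    then have ij: "{circ n j, circ n i} \<in> M" "j < i" "i < j + int n" by (auto simp: short_arc_def)
    have "j \<noteq> a" using short_arc_unique[of a i c] closer T i by auto
    moreover have "\<not> j < a"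
    proof
      assume "j < a"
      show False by (rule noncrossing[OF ij(1) ac(1) \<open>j < a\<close> i]) (use ij ac(2) i in linarith)
    qed
    ultimately show ?thesis using closer i ij by (intro exI[of _ j]) auto
  next
    case diameter
    then have "{circ n i, circ n (i + int n)} \<in> M" by (simp add: diameter_def)
    then show ?thesis using noncrossing[OF ac(1) _ i, of "i + int n"] ac(2) i by auto
  qed
qed

lemma nested_arcs:
  assumes "walk h (short_openers n M)"
  shows "nested_arcs (short_openers n M) h (short_arc n M)"
proof
  show "a < c \<and> a \<in> short_openers n M \<and> c \<notin> short_openers n M" if "short_arc n M a c" for a c
  proof -
    have "c \<notin> short_openers n M"
    proof
      assume "c \<in> short_openers n M"
      then obtain j where "short_arc n M c j" by (auto simp: short_openers_def)
      then show False using short_arc_unique[of c j a] that by (auto simp: short_arc_def)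
    qed
    then show ?thesis using that by (auto simp: short_openers_def short_arc_def)
  qed
qed (use assms short_arc_unique short_arc_nested in blast)+

lemma not_opener:
  assumes "i \<notin> short_openers n M" "\<not> diameter n M i"
  obtains j where "short_arc n M j i"
  using assms by (cases rule: arc_cases[of i]) (auto simp: short_openers_def)

end

text \<open>The short arcs of both matchings are excursions of the same walk, and an excursion is
  determined by its left end. A point on no short arc can only lie on a diameter, so diameters agree
  too.\<close>

lemma short_openers_inject:
  assumes "n > 0" "M \<in> handshake_patterns n" "M' \<in> handshake_patterns n"
    and eq: "short_openers n M = short_openers n M'"
  shows "M = M'"
proof -
  interpret A: handshake n M by unfold_locales (use assms in auto)
  interpret B: handshake n M' by unfold_locales (use assms in auto)
  obtain h where h: "walk h (short_openers n M)" using walk_exists by blast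
  interpret A': nested_arcs "short_openers n M" h "short_arc n M" by (rule A.nested_arcs[OF h])
  interpret B': nested_arcs "short_openers n M'" h "short_arc n M'" using B.nested_arcs h eq by simp
  have arcs: "short_arc n M i j \<longleftrightarrow> short_arc n M' i j" for i j
  proof
    assume ij: "short_arc n M i j"
    then obtain k where k: "short_arc n M' i k" using eq by (auto simp: short_openers_def)
    then show "short_arc n M' i j"
      using excursion_right_unique[OF A'.excursion[OF ij] B'.excursion[OF k]] by simp
  next
    assume ij: "short_arc n M' i j"
    then obtain k where k: "short_arc n M i k" using eq by (auto simp: short_openers_def)
    then show "short_arc n M i j"
      using excursion_right_unique[OF B'.excursion[OF ij] A'.excursion[OF k]] by simp
  qed
  have diams: "diameter n M' i" if "diameter n M i" for i
    using B.arc_cases[of i] arcs A.diameter_not_short_arc[OF that] by metis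
  show ?thesis
  proof (rule handshake_eqI[OF assms(2,3)])
    fix i j assume ij: "{circ n i, circ n j} \<in> M"
    have "circ n j = circ n k \<Longrightarrow> {circ n i, circ n k} \<in> M' \<Longrightarrow> {circ n i, circ n j} \<in> M'" for k by simp
    moreover have "circ n j = circ n k" if "{circ n i, circ n k} \<in> M" for k
      using perfect_matching_on_unique[OF A.pm ij that] .
    moreover have "\<exists>k. {circ n i, circ n k} \<in> M \<and> {circ n i, circ n k} \<in> M'"
    proof (cases rule: A.arc_cases[of i])
      case (opener k)
      then show ?thesis using arcs[of i k] by (auto simp: short_arc_def)
    next
      case (closer k)
      then show ?thesis using arcs[of k i] by (auto simp: short_arc_def insert_commute)
    next
      case diameter
      then show ?thesis using diams[of i] by (auto simp: diameter_def)
    qed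
    ultimately show "{circ n i, circ n j} \<in> M'" by metis
  qed
qed

lemma short_openers_rotate:
  assumes "n > 0" "M \<in> handshake_patterns n"
  shows "short_openers n ((rotate_matching n ^^ d) M) = {i. i - int d \<in> short_openers n M}"
proof -
  have iff: "short_arc n ((rotate_matching n ^^ d) M) i j \<longleftrightarrow> short_arc n M (i - int d) (j - int d)" for i j
    using rotate_handshake_funpow(2)[OF assms(2,1)] by (auto simp: short_arc_def)
  have "(\<exists>j. short_arc n M (i - int d) (j - int d)) \<longleftrightarrow> (\<exists>j. short_arc n M (i - int d) j)" for i
    by (metis add_diff_cancel_right')
  then show ?thesis by (auto simp: short_openers_def iff)
qed

text \<open>Injectivity of \<open>short_openers\<close> turns invariance of a matching into
  periodicity of a set of integers.\<close>

lemma rotate_fixed_iff: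
  assumes "n > 0" "M \<in> handshake_patterns n"
  shows "(rotate_matching n ^^ d) M = M \<longleftrightarrow> (\<forall>i. i + int d \<in> short_openers n M \<longleftrightarrow> i \<in> short_openers n M)"
proof -
  have "(rotate_matching n ^^ d) M = M \<longleftrightarrow> short_openers n ((rotate_matching n ^^ d) M) = short_openers n M"
    using short_openers_inject[OF assms(1) rotate_handshake_funpow(1)[OF assms(2,1)] assms(2)] by auto
  also have "\<dots> \<longleftrightarrow> (\<forall>i. i - int d \<in> short_openers n M \<longleftrightarrow> i \<in> short_openers n M)"
    by (auto simp: short_openers_rotate[OF assms])
  also have "\<dots> \<longleftrightarrow> (\<forall>i. i \<in> short_openers n M \<longleftrightarrow> i + int d \<in> short_openers n M)"
    by (metis add_diff_cancel_right' diff_add_cancel)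
  finally show ?thesis by blast
qed

section \<open>Drift of periodic walks and the openers of an invariant matching\<close>

lemma drift_iterate:
  fixes h :: "int \<Rightarrow> int"
  assumes "\<And>t. h (t + e) = h t + c"
  shows "h (t + e * q) = h t + c * q"
proof (induction q rule: int_induct[where k = 0])
  case (step1 q)
  then show ?case using assms[of "t + e * q"] by (simp add: algebra_simps)
next
  case (step2 q)
  then show ?case using assms[of "t + e * (q - 1)"] by (simp add: algebra_simps)
qed simp

lemma drift_lower_bound:
  fixes h :: "int \<Rightarrow> int"
  assumes "\<And>t. h (t + e) = h t + c" "e > 0"
  obtains b where "\<And>t. h t \<ge> b + c * (t div e)"
proof
  fix t
  have "Min (h ` {0..<e}) \<le> h (t mod e)"
    using assms(2) by (intro Min_le) auto
  then show "h t \<ge> Min (h ` {0..<e}) + c * (t div e)"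
    using drift_iterate[of h e c, OF assms(1), of "t mod e" "t div e"] by simp
qed

text \<open>Positive drift gives a linear lower bound that tends to infinity, whereas
  \<open>low\<close> yields arbitrarily late times at height at most \<open>h 0\<close>.\<close>

lemma no_positive_drift:
  fixes h :: "int \<Rightarrow> int"
  assumes drift: "\<And>t. h (t + e) = h t + c" "e > 0" and low: "\<And>t. \<exists>t'>t. h t' \<le> h t"
  shows "c \<le> 0"
proof (rule ccontr)
  assume "\<not> c \<le> 0"
  obtain b where b: "\<And>t. h t \<ge> b + c * (t div e)" using drift_lower_bound[of h e c, OF drift] by blast
  have far: "\<exists>t\<ge>int q. h t \<le> h 0" for q
  proof (induction q)
    case (Suc q)
    then obtain t where "t \<ge> int q" "h t \<le> h 0" by blast
    moreover obtain t' where "t' > t" "h t' \<le> h t" using low by blast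
    ultimately show ?case by (intro exI[of _ t']) auto
  qed auto
  \<comment> \<open>Large enough that after \<open>r\<close> periods the lower bound exceeds
    \<open>h 0\<close>, even for the smallest positive drift 1.\<close>
  define r where "r = \<bar>h 0\<bar> + \<bar>b\<bar> + 1"
  obtain t where t: "t \<ge> e * r" "h t \<le> h 0"
    using far[of "nat (e * r)"] drift(2) by (auto simp: r_def)
  have "r \<le> t div e" using t drift(2) by (metis nonzero_mult_div_cancel_left zdiv_mono1 less_irrefl)
  also have "\<dots> \<le> c * (t div e)"
    using \<open>\<not> c \<le> 0\<close> calculation mult_right_mono[of 1 c "t div e"] by (simp add: r_def)
  finally have "h 0 < b + c * (t div e)" by (simp add: r_def)
  then show False using b[of t] t(2) by simp
qed

lemma periodic_walk_drift:
  assumes h: "walk h S" and per: "\<And>i. i + int e \<in> S \<longleftrightarrow> i \<in> S"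
  shows "h (t + int e) = h t + (2 * int (card (S \<inter> {0..<int e})) - int e)"
proof -
  have step: "h (t + 1 + int e) - h (t + 1) = h (t + int e) - h t" for t
    using walk_step[OF h, of t] walk_step[OF h, of "t + int e"] per[of t] by (simp add: algebra_simps)
  have "h (t + int e) - h t = h (0 + int e) - h 0"
  proof (induction t rule: int_induct[where k = 0])
    case (step2 t)
    then show ?case using step[of "t - 1"] by simp
  qed (use step in simp_all)
  then show ?thesis using walk_count[OF h, of 0 "int e"] by simp
qed

lemma proper_divisor_le_half:
  fixes e m :: nat
  assumes "e dvd m" "e < m"
  shows "2 * e \<le> m"
proof -
  obtain k where k: "m = e * k" using assms(1) by (elim dvdE)
  then have "k \<noteq> 0" "k \<noteq> 1" using assms(2) by auto
  then have "e * 2 \<le> e * k" by (intro mult_le_mono2) linarith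
  then show ?thesis using k by linarith
qed

text \<open>The number of openers per period is read off from the drift \<open>c\<close>. Every
  point has a later one at most as high, so \<open>c \<le> 0\<close>; without diameters the reversed
  walk gives \<open>c \<ge> 0\<close>. If there is a diameter, its image under the rotation must not
  cross it, so \<open>e = n\<close>; the points between its ends are closed under partners and its
  first end is a down step, so \<open>c = -1\<close>.\<close>

lemma card_short_openers_rotate_fixed:
  assumes "n > 0" "M \<in> handshake_patterns n" and fixed: "(rotate_matching n ^^ e) M = M"
    and e: "0 < e" "e < 2 * n" "e dvd 2 * n"
  shows "card (short_openers n M \<inter> {0..<int e}) = e div 2" "even e \<or> e = n"
proof -
  interpret handshake n M by unfold_locales (use assms in auto)
  let ?S = "short_openers n M"
  obtain h where h: "walk h ?S" using walk_exists by blast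
  interpret nested_arcs ?S h "short_arc n M" by (rule nested_arcs[OF h])
  have per: "i + int e \<in> ?S \<longleftrightarrow> i \<in> ?S" for i
    using fixed rotate_fixed_iff[OF assms(1,2)] by blast
  define c where "c = 2 * int (card (?S \<inter> {0..<int e})) - int e"
  have drift: "h (t + int e) = h t + c" for t
    using periodic_walk_drift[OF h per] by (simp add: c_def)
  have "\<exists>t'>t. h t' \<le> h t" for t
  proof (cases "t \<in> ?S")
    case True
    then obtain j where "short_arc n M t j" by (auto simp: short_openers_def)
    then show ?thesis using excursionD(1,2)[OF excursion, of t j] by (intro exI[of _ "j + 1"]) auto
  next
    case False
    then show ?thesis using walk_step[OF h, of t] by (intro exI[of _ "t + 1"]) auto
  qed
  then have "c \<le> 0" using no_positive_drift[of h "int e" c] drift e by simp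
  have "(c = 0 \<and> even e) \<or> (c = -1 \<and> odd e \<and> e = n)"
  proof (cases "\<exists>p. diameter n M p")
    case False
    \<comment> \<open>Time reversal: \<open>- t - 1\<close> is the step that arrives at time
      \<open>- t\<close>. An up step started lower, and a down step closes an excursion that started
      at the same height.\<close>
    have low: "\<exists>t'>t. h (- t') \<le> h (- t)" for t
    proof (cases "- t - 1 \<in> ?S")
      case True
      have eq: "- (t + 1) = - t - 1" by simp
      have "h (- (t + 1)) \<le> h (- t)" unfolding eq using walk_step[OF h, of "- t - 1"] True by simp
      then show ?thesis by (intro exI[of _ "t + 1"]) simp
    next
      case F: False
      then obtain i where "short_arc n M i (- t - 1)" using not_opener False by blast
      then have "i < - t - 1" "h (- t) = h i" using excursionD(1,2)[OF excursion, of i "- t - 1"] by auto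
      then show ?thesis by (intro exI[of _ "- i"]) auto
    qed
    have "h (- (t + int e)) = h (- t) + - c" for t
      using drift[of "- t - int e"] by (simp add: algebra_simps)
    then have "- c \<le> 0" using no_positive_drift[of "\<lambda>t. h (- t)" "int e" "- c"] low e by simp
    then have "c = 0" using \<open>c \<le> 0\<close> by simp
    moreover from this have "int e = 2 * int (card (?S \<inter> {0..<int e}))" by (simp add: c_def)
    then have "even e" by presburger
    ultimately show ?thesis by simp
  next
    case True
    then obtain p where p: "diameter n M p" by blast
    have pn: "{circ n p, circ n (p + int n)} \<in> M" using p by (simp add: diameter_def)
    have no_diam: "\<not> diameter n M i" if "p < i" "i < p + int n" for i
      using noncrossing[OF pn _ that, of "i + int n"] that by (auto simp: diameter_def)
    \<comment> \<open>Invariance carries the diameter at \<open>p\<close> to one at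
      \<open>p + e\<close>, which would cross the original if \<open>e < n\<close>.\<close>
    have "diameter n M (p + int e)"
      using pn rotate_handshake_funpow(2)[OF M n, of "p + int e" "p + int e + int n" e] fixed
      by (simp add: diameter_def algebra_simps)
    then have "\<not> e < n" using no_diam[of "p + int e"] e(1) by auto
    moreover have "e \<le> n" using proper_divisor_le_half[OF e(3,2)] by simp
    ultimately have en: "e = n" by simp
    have "h (p + int n) = h (p + 1) \<and> (\<forall>k. p + 1 \<le> k \<and> k \<le> p + int n \<longrightarrow> h (p + 1) \<le> h k)"
    proof (rule closed_interval)
      fix i assume i': "p + 1 \<le> i" "i < p + int n"
      then have i: "p < i" "i < p + int n" by auto
      show "\<exists>j\<ge>p + 1. j < p + int n \<and> (short_arc n M i j \<or> short_arc n M j i)"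
      proof (cases rule: arc_cases[of i])
        case (opener j)
        then have ij: "{circ n i, circ n j} \<in> M" "i < j" "j < i + int n" by (auto simp: short_arc_def)
        have "j \<noteq> p + int n" using diameter_not_short_arc(2)[OF diameter_shift[OF p]] opener by blast
        moreover have "\<not> p + int n < j"
        proof
          assume "p + int n < j"
          show False by (rule noncrossing[OF pn ij(1) i \<open>p + int n < j\<close>]) (use ij i in linarith)
        qed
        ultimately show ?thesis using opener i ij by (intro exI[of _ j]) auto
      next
        case (closer j)
        then have ij: "{circ n j, circ n i} \<in> M" "j < i" "i < j + int n" by (auto simp: short_arc_def)
        have "j \<noteq> p" using diameter_not_short_arc(1)[OF p] closer by blast
        moreover have "\<not> j < p"
        proof
          assume "j < p"
          show False by (rule noncrossing[OF ij(1) pn \<open>j < p\<close> i]) (use ij i in linarith)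
        qed
        ultimately show ?thesis using closer i ij by (intro exI[of _ j]) auto
      next
        case diameter
        then show ?thesis using no_diam[OF i] by blast
      qed
    qed (use n in simp)
    moreover have "p \<notin> ?S" using diameter_not_short_arc(1)[OF p] by (auto simp: short_openers_def)
    ultimately have "c = -1" using walk_step[OF h, of p] drift[of p] en by simp
    moreover from this have "int e = 2 * int (card (?S \<inter> {0..<int e})) + 1" by (simp add: c_def)
    then have "odd e" by presburger
    ultimately show ?thesis using en by simp
  qed
  then show "card (?S \<inter> {0..<int e}) = e div 2" "even e \<or> e = n"
    by (auto simp: c_def)
qed

section \<open>From a periodic set of openers to an invariant matching\<close>

lemma excursion_covers:
  assumes h: "walk h S" and ac: "excursion h a c" and b: "a < b" "b < c"
  shows "\<exists>k. excursion h b k \<or> excursion h k b"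
proof (cases "b \<in> S")
  case True
  then show ?thesis
    using excursion_right[OF h True, of "c + 1"] excursionD(2)[OF ac] excursionD(3)[OF ac, of b] b by auto
next
  case False
  then show ?thesis
    using excursion_left[OF h False, of a] excursionD(3)[OF ac, of "b + 1"] b by auto
qed

lemma excursion_shift:
  assumes "\<And>t. h (t + s) = h t + d"
  shows "excursion h (i + s) (j + s) \<longleftrightarrow> excursion h i j"
proof -
  have "(\<forall>k. i + s < k \<and> k \<le> j + s \<longrightarrow> h (i + s) < h k) \<longleftrightarrow> (\<forall>k. i < k \<and> k \<le> j \<longrightarrow> h i < h k)"
  proof safe
    fix k assume "\<forall>k. i + s < k \<and> k \<le> j + s \<longrightarrow> h (i + s) < h k" "i < k" "k \<le> j"
    then have "h (i + s) < h (k + s)" by simp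
    then show "h i < h k" using assms[of i] assms[of k] by simp
  next
    fix k assume "\<forall>k. i < k \<and> k \<le> j \<longrightarrow> h i < h k" "i + s < k" "k \<le> j + s"
    then show "h (i + s) < h k" using assms[of i] assms[of "k - s"] by auto
  qed
  moreover have "h (j + s + 1) = h (j + 1) + d" using assms[of "j + 1"] by (simp add: algebra_simps)
  ultimately show ?thesis using assms[of i] by (auto simp: excursion_def)
qed

text \<open>Setting of the converse: \<open>S\<close> is to be realised as the openers of a
  matching. The prescribed cardinality makes the drift 0 for even \<open>e\<close> and -1 for odd
  \<open>e = n\<close>.\<close>

locale periodic_walk =
  fixes n e :: nat and S :: "int set" and h :: "int \<Rightarrow> int"
  assumes n: "n > 0" and e: "0 < e" "e < 2 * n" "e dvd 2 * n" "even e \<or> e = n"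
    and per: "\<And>i. i + int e \<in> S \<longleftrightarrow> i \<in> S"
    and card: "card (S \<inter> {0..<int e}) = e div 2"
    and h: "walk h S"
begin

definition unmatched :: "int \<Rightarrow> bool"
  where "unmatched i \<longleftrightarrow> (\<forall>k. \<not> excursion h i k \<and> \<not> excursion h k i)"

text \<open>An unmatched step is joined to its antipode. On lifts this is not an involution, since
  applying it twice advances by a full turn; on the circle it is one.\<close>

definition mate :: "int \<Rightarrow> int"
  where "mate i = (if unmatched i then i + int n else THE j. excursion h i j \<or> excursion h j i)"

definition matching :: "nat set set"
  where "matching = (\<lambda>x. {x, circ n (mate (int x))}) ` {1..2 * n}"

lemma e_le: "e \<le> n"
  using proper_divisor_le_half[OF e(3,2)] n by simp

lemma drift: "h (t + int e) = h t - (if even e then 0 else 1)"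
proof -
  have "2 * int (e div 2) - int e = - (if even e then 0 else 1)" by (auto elim: oddE)
  then show ?thesis using periodic_walk_drift[OF h per, of t] card by simp
qed

text \<open>The drift is not positive, so the walk is back at or below its level after one period.
  As \<open>e \<le> n\<close>, the resulting arc is short.\<close>

lemma opener:
  assumes "i \<in> S"
  obtains j where "excursion h i j" "j < i + int e"
proof -
  have "h (i + int e) \<le> h i" using drift[of i] by (cases "even e") auto
  then show thesis using excursion_right[OF h assms, of "i + int e"] e that by auto
qed

text \<open>An opener always closes. A closer lacks a partner only if the walk was never as low
  before, which drift 0 excludes by looking one period back.\<close>

lemma unmatched_props:
  assumes "unmatched p"
  shows "p \<notin> S" "odd e" "e = n"
proof -
  show p: "p \<notin> S" using opener[of p] assms by (auto simp: unmatched_def)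
  show "odd e"
  proof
    assume "even e"
    then have "h (p + 1 - int e) \<le> h (p + 1)" using drift[of "p + 1 - int e"] by simp
    then have "\<exists>i. excursion h i p" using excursion_left[OF h p, of "p + 1 - int e"] e by auto
    then show False using assms by (simp add: unmatched_def)
  qed
  then show "e = n" using e by simp
qed

lemma shift_iterate: "h (t + int e * q) = h t + - (if even e then 0 else 1) * q"
  by (rule drift_iterate) (simp add: drift)

lemma excursion_period: "excursion h (i + int e * q) (j + int e * q) \<longleftrightarrow> excursion h i j"
  by (rule excursion_shift) (rule shift_iterate)

lemma unmatched_period: "unmatched (i + int e * q) \<longleftrightarrow> unmatched i"
proof -
  have "excursion h (i + int e * q) k \<longleftrightarrow> excursion h i (k - int e * q)"
    "excursion h k (i + int e * q) \<longleftrightarrow> excursion h (k - int e * q) i" for k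
    using excursion_period[of i q "k - int e * q"] excursion_period[of "k - int e * q" q i] by simp_all
  then show ?thesis unfolding unmatched_def by (metis add_diff_cancel)
qed

text \<open>The time after an unmatched step is a strict record low. Translating \<open>a\<close> by
  whole periods brings its record to the height of the record of \<open>b\<close>, and two strict
  records at one height coincide.\<close>

lemma unmatched_congruent:
  assumes "unmatched a" "unmatched b"
  shows "int n dvd b - a"
proof -
  have left_record: "h (p + 1) < h t" if "unmatched p" "t \<le> p" for p t
    using excursion_left[OF h unmatched_props(1)[OF that(1)] that(2)] that(1)
    by (force simp: unmatched_def)
  \<comment> \<open>Each period lowers the walk by one, so the height difference is the number of
    periods by which to move \<open>a\<close>.\<close>
  define k where "k = h (a + 1) - h (b + 1)"
  have n_e: "e = n" "odd e" using unmatched_props(2,3)[OF assms(1)] by auto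
  have a': "unmatched (a + int e * k)" using assms(1) by (simp add: unmatched_period)
  have eq: "h (a + int e * k + 1) = h (b + 1)"
    using shift_iterate[of "a + 1" k] n_e by (simp add: k_def algebra_simps)
  have "a + int e * k = b"
    using left_record[OF a', of "b + 1"] left_record[OF assms(2), of "a + int e * k + 1"] eq by linarith
  then show ?thesis using n_e by auto
qed

lemma mate_excursion:
  assumes "excursion h i j"
  shows "mate i = j" "mate j = i"
proof -
  have un: "\<not> unmatched i" "\<not> unmatched j" using assms unfolding unmatched_def by blast+
  have right: "k = j" if "excursion h i k \<or> excursion h k i" for k
    using that
  proof
    assume "excursion h i k"
    then show "k = j" using assms by (rule excursion_right_unique)
  next
    assume "excursion h k i"
    then show "k = j" using excursion_ends(2)[OF h] excursion_ends(1)[OF h assms] by blast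
  qed
  have left: "k = i" if "excursion h j k \<or> excursion h k j" for k
    using that
  proof
    assume "excursion h j k"
    then show "k = i" using excursion_ends(1)[OF h] excursion_ends(2)[OF h assms] by blast
  next
    assume "excursion h k j"
    then show "k = i" using assms by (rule excursion_left_unique)
  qed
  have "(THE j. excursion h i j \<or> excursion h j i) = j" by (rule the_equality) (use assms right in blast)+
  then show "mate i = j" using un(1) by (simp add: mate_def)
  have "(THE k. excursion h j k \<or> excursion h k j) = i" by (rule the_equality) (use assms left in blast)+
  then show "mate j = i" using un(2) by (simp add: mate_def)
qed

lemma mate_cases:
  obtains (right) j where "excursion h i j" "mate i = j" "j < i + int n"
    | (left) j where "excursion h j i" "mate i = j" "i < j + int n"
    | (unmatched) "unmatched i" "mate i = i + int n"
proof (cases "unmatched i")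
  case True
  then show thesis using unmatched by (simp add: mate_def)
next
  case False
  have short: "k < j + int n" if jk: "excursion h j k" for j k
  proof -
    obtain k' where "excursion h j k'" "k' < j + int e" using opener[OF excursion_ends(1)[OF h jk]] .
    then show ?thesis using excursion_right_unique[OF jk] e_le by auto
  qed
  from False obtain k where "excursion h i k \<or> excursion h k i" unfolding unmatched_def by blast
  then show thesis
  proof
    assume k: "excursion h i k"
    show thesis by (rule right[OF k mate_excursion(1)[OF k] short[OF k]])
  next
    assume k: "excursion h k i"
    show thesis by (rule left[OF k mate_excursion(2)[OF k] short[OF k]])
  qed
qed

lemma mate_bound: "mate i \<noteq> i" "\<bar>mate i - i\<bar> \<le> int n"
proof -
  have "mate i \<noteq> i \<and> \<bar>mate i - i\<bar> \<le> int n"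
  proof (cases rule: mate_cases[of i])
    case (right j)
    then show ?thesis using excursionD(1)[OF right(1)] by auto
  next
    case (left j)
    then show ?thesis using excursionD(1)[OF left(1)] by auto
  next
    case unmatched
    then show ?thesis using n by auto
  qed
  then show "mate i \<noteq> i" "\<bar>mate i - i\<bar> \<le> int n" by auto
qed

lemma mate_period: "mate (i + 2 * int n * q) = mate i + 2 * int n * q"
proof -
  obtain k where k: "2 * n = e * k" using e(3) by (elim dvdE)
  then have eq: "2 * int n * q = int e * (int k * q)" by (metis mult.assoc of_nat_mult of_nat_numeral)
  show ?thesis
  proof (cases rule: mate_cases[of i])
    case (right j)
    then have "excursion h (i + 2 * int n * q) (j + 2 * int n * q)" unfolding eq by (simp add: excursion_period)
    then show ?thesis using mate_excursion right by simp
  next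
    case (left j)
    then have "excursion h (j + 2 * int n * q) (i + 2 * int n * q)" unfolding eq by (simp add: excursion_period)
    then show ?thesis using mate_excursion left by simp
  next
    case unmatched
    then have "unmatched (i + 2 * int n * q)" unfolding eq by (simp add: unmatched_period)
    then show ?thesis using unmatched by (simp add: mate_def)
  qed
qed

lemma mate_cong:
  assumes "circ n i = circ n j"
  shows "circ n (mate i) = circ n (mate j)"
proof -
  obtain q where "i - j = 2 * int n * q" using assms n by (auto simp: circ_eq_iff)
  then have "mate i = mate j + 2 * int n * q" using mate_period[of j q] by (simp add: algebra_simps)
  then show ?thesis using n by (simp add: circ_eq_iff)
qed

lemma mate_mate: "circ n (mate (mate i)) = circ n i"
proof (cases rule: mate_cases[of i])
  case unmatched
  then have "unmatched (i + int n)" using unmatched_period[of i 1] unmatched_props(3)[of i] by simp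
  then have "mate (mate i) = i + 2 * int n" using unmatched by (simp add: mate_def)
  then show ?thesis using n by simp
qed (use mate_excursion in simp_all)

lemma matching_pair: "{circ n i, circ n j} \<in> matching \<longleftrightarrow> circ n j = circ n (mate i)"
  and matching_perfect: "perfect_matching_on {1..2 * n} matching"
proof -
  have f: "circ n (mate (int x)) \<in> {1..2 * n} \<and> circ n (mate (int x)) \<noteq> x \<and>
      circ n (mate (int (circ n (mate (int x))))) = x" if x: "x \<in> {1..2 * n}" for x
  proof (intro conjI)
    show "circ n (mate (int x)) \<in> {1..2 * n}" by (rule circ_range[OF n])
    have c: "circ n (int (circ n (mate (int x)))) = circ n (mate (int x))"
      by (rule circ_of_nat[OF circ_range[OF n]])
    show "circ n (mate (int (circ n (mate (int x))))) = x"
      using mate_cong[OF c] mate_mate[of "int x"] x by (simp add: circ_of_nat)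
    show "circ n (mate (int x)) \<noteq> x"
    proof
      assume "circ n (mate (int x)) = x"
      then have "circ n (mate (int x)) = circ n (int x)" using x by (simp add: circ_of_nat)
      then show False using circ_inj[OF n, of "mate (int x)" "int x"] mate_bound[of "int x"] n by linarith
    qed
  qed
  show "perfect_matching_on {1..2 * n} matching"
    unfolding matching_def by (rule perfect_matching_on_involution(1)[OF f])
  have "{circ n i, circ n j} \<in> matching \<longleftrightarrow> circ n j = circ n (mate (int (circ n i)))"
    unfolding matching_def by (rule perfect_matching_on_involution(2)[OF f circ_range[OF n]])
  moreover have "circ n (mate (int (circ n i))) = circ n (mate i)"
    by (rule mate_cong) (rule circ_of_nat[OF circ_range[OF n]])
  ultimately show "{circ n i, circ n j} \<in> matching \<longleftrightarrow> circ n j = circ n (mate i)" by simp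
qed

text \<open>\<open>mate\<close> moves a point by at most \<open>n\<close>, so the congruence modulo
  \<open>2 * n\<close> pins down the lift: the arc is an excursion inside the window, one running
  across the seam from \<open>c\<close> to \<open>a + 2 * n\<close>, or a diameter.\<close>

lemma matching_arc:
  assumes "{a, c} \<in> matching" "a < c"
  shows "excursion h (int a) (int c) \<or> excursion h (int c) (int a + 2 * int n) \<or>
    (unmatched (int a) \<and> int c = int a + int n)"
proof -
  have V: "a \<in> {1..2 * n}" "c \<in> {1..2 * n}"
    using perfect_matching_on_pair[OF matching_perfect assms(1)] by auto
  have C: "circ n (int c) = circ n (mate (int a))"
    using matching_pair[of "int a" "int c"] assms(1) V by (simp add: circ_of_nat)
  show ?thesis
  proof (cases rule: mate_cases[of "int a"])
    case (right j)
    have "int c = j" by (rule circ_inj[OF n]) (use C V right assms(2) excursionD(1)[OF right(1)] in auto)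
    then show ?thesis using right by simp
  next
    case (left j)
    have "circ n (int c) = circ n (j + 2 * int n)" using C left n by simp
    then have "int c = j + 2 * int n"
      by (rule circ_inj[OF n]) (use V left assms(2) excursionD(1)[OF left(1)] in auto)
    moreover have "excursion h (j + 2 * int n) (int a + 2 * int n)"
    proof -
      obtain k where "2 * n = e * k" using e(3) by (elim dvdE)
      then have "2 * int n = int e * int k" by (metis of_nat_mult of_nat_numeral)
      then show ?thesis using excursion_period[of j "int k" "int a"] left by simp
    qed
    ultimately show ?thesis by simp
  next
    case unmatched
    have "int c = int a + int n" by (rule circ_inj[OF n]) (use C V unmatched assms(2) in auto)
    then show ?thesis using unmatched by simp
  qed
qed

text \<open>Two excursions, one moved by a full turn where necessary, do not interleave; both ends
  of a diameter are unmatched and so do not lie under an excursion; and two diameters would have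
  ends that differ by a multiple of \<open>n\<close>.\<close>

lemma matching_handshake: "matching \<in> handshake_patterns n"
proof -
  have cover: "\<not> unmatched b" if "excursion h a c" "a < b" "b < c" for a b c
    using excursion_covers[OF h that] by (auto simp: unmatched_def)
  have un: "unmatched (a + int n)" "unmatched (a + 2 * int n)" if "unmatched a" for a
    using unmatched_period[of a 1] unmatched_period[of a 2] unmatched_props(3)[OF that] that
    by (simp_all add: mult.commute)
  have False if ac: "{a, c} \<in> matching" and bd: "{b, d} \<in> matching" and ord: "a < b" "b < c" "c < d" for a b c d
  proof -
    have V: "a \<in> {1..2 * n}" "d \<in> {1..2 * n}"
      using perfect_matching_on_pair[OF matching_perfect ac] perfect_matching_on_pair[OF matching_perfect bd] by auto
    let ?a = "int a" and ?b = "int b" and ?c = "int c" and ?d = "int d" and ?N = "2 * int n"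
    have o: "?a < ?b" "?b < ?c" "?c < ?d" "?d < ?a + ?N" using ord V by auto
    have "?a < ?c" "?b < ?d" using o by auto
    note arcs = matching_arc[OF ac] matching_arc[OF bd]
    consider (1) "excursion h ?a ?c" | (2) "excursion h ?c (?a + ?N)" | (3) "unmatched ?a" "?c = ?a + int n"
      using arcs(1) ord by auto
    then show False
    proof cases
      case 1
      consider "excursion h ?b ?d" | "excursion h ?d (?b + ?N)" | "unmatched ?b"
        using arcs(2) ord by auto
      then show False
      proof cases
        case 1
        then show False using excursion_noncrossing[OF \<open>excursion h ?a ?c\<close> 1] o by blast
      next
        case 2
        obtain k where "2 * n = e * k" using e(3) by (elim dvdE)
        then have "?N = int e * int k" by (metis of_nat_mult of_nat_numeral)
        then have "excursion h (?a + ?N) (?c + ?N)"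
          using excursion_period[of ?a "int k" ?c] \<open>excursion h ?a ?c\<close> by simp
        from excursion_noncrossing[OF 2 this] o show False by simp
      next
        case 3
        then show False using cover[OF \<open>excursion h ?a ?c\<close>] o by blast
      qed
    next
      case 2
      consider "excursion h ?b ?d" | "excursion h ?d (?b + ?N)" | "unmatched ?b" "?d = ?b + int n"
        using arcs(2) ord by auto
      then show False
      proof cases
        case 1
        then show False using excursion_noncrossing[OF 1 2] o by blast
      next
        case a: 2
        then show False using excursion_noncrossing[OF 2 a] o by simp
      next
        case 3
        then show False using cover[OF 2, of ?d] o un(1)[OF 3(1)] by simp
      qed
    next
      case 3
      consider "excursion h ?b ?d" | "excursion h ?d (?b + ?N)" | "unmatched ?b"
        using arcs(2) ord by auto
      then show False
      proof cases
        case 1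
        then show False using cover[OF 1, of ?c] o un(1)[OF 3(1)] 3(2) by simp
      next
        case 2
        then show False using cover[OF 2, of "?a + ?N"] o un(2)[OF 3(1)] by simp
      next
        case a: 3
        have "int n dvd ?b - ?a" by (rule unmatched_congruent[OF 3(1) a])
        then show False using zdvd_imp_le[of "int n" "?b - ?a"] o 3(2) by simp
      qed
    qed
  qed
  then show ?thesis using matching_perfect unfolding handshake_patterns_iff by blast
qed

lemma short_openers_matching: "short_openers n matching = S"
proof -
  have "i \<in> S" if "short_arc n matching i j" for i j
  proof -
    have ij: "i < j" "j < i + int n" "circ n j = circ n (mate i)"
      using that matching_pair by (auto simp: short_arc_def)
    have "j = mate i" by (rule circ_inj[OF n ij(3)]) (use ij mate_bound[of i] in linarith)
    then show "i \<in> S"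
      using ij excursionD(1) excursion_ends(1)[OF h] by (cases rule: mate_cases[of i]) force+
  qed
  moreover have "\<exists>j. short_arc n matching i j" if i: "i \<in> S" for i
  proof -
    obtain j where j: "excursion h i j" "j < i + int e" using opener[OF i] .
    then have "short_arc n matching i j"
      using mate_excursion[OF j(1)] matching_pair[of i j] excursionD(1)[OF j(1)] e_le by (simp add: short_arc_def)
    then show ?thesis ..
  qed
  ultimately show ?thesis by (auto simp: short_openers_def)
qed

end

text \<open>A periodic set is determined by its trace on one period, and the size of the trace is
  the only condition, since the walk runs over all integers and has no distinguished start.\<close>

lemma card_rotate_fixed:
  assumes "n > 0" "0 < e" "e < 2 * n" "e dvd 2 * n"
  shows "card {M \<in> handshake_patterns n. (rotate_matching n ^^ e) M = M} =
    (if even e \<or> e = n then e choose (e div 2) else 0)"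
proof (cases "even e \<or> e = n")
  case False
  then have "{M \<in> handshake_patterns n. (rotate_matching n ^^ e) M = M} = {}"
    using card_short_openers_rotate_fixed(2)[OF assms(1) _ _ assms(2-4)] by blast
  then show ?thesis by (simp only: False if_False card.empty)
next
  case True
  let ?F = "{M \<in> handshake_patterns n. (rotate_matching n ^^ e) M = M}"
  let ?U = "{U. U \<subseteq> {0..<int e} \<and> card U = e div 2}"
  let ?g = "\<lambda>M. short_openers n M \<inter> {0..<int e}"
  have per: "i \<in> short_openers n M \<longleftrightarrow> i mod int e \<in> ?g M" if "M \<in> ?F" for M i
  proof -
    have *: "i + int e \<in> short_openers n M \<longleftrightarrow> i \<in> short_openers n M" for i
      using that rotate_fixed_iff[OF assms(1)] by blast
    have "i + int e * q \<in> short_openers n M \<longleftrightarrow> i \<in> short_openers n M" for i q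
    proof (induction q rule: int_induct[where k = 0])
      case (step1 q)
      then show ?case using *[of "i + int e * q"] by (simp add: algebra_simps)
    next
      case (step2 q)
      then show ?case using *[of "i + int e * (q - 1)"] by (simp add: algebra_simps)
    qed simp
    from this[of "i mod int e" "i div int e"] show ?thesis using assms(2) by simp
  qed
  have "bij_betw ?g ?F ?U"
  proof (rule bij_betw_imageI)
    show "inj_on ?g ?F"
    proof
      fix M M' assume MM: "M \<in> ?F" "M' \<in> ?F" "?g M = ?g M'"
      then have "short_openers n M = short_openers n M'" using per by blast
      then show "M = M'" using short_openers_inject[OF assms(1)] MM by blast
    qed
    show "?g ` ?F = ?U"
    proof
      show "?g ` ?F \<subseteq> ?U"
        using card_short_openers_rotate_fixed(1)[OF assms(1) _ _ assms(2-4)] by auto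
      show "?U \<subseteq> ?g ` ?F"
      proof
        fix U assume U: "U \<in> ?U"
        define S where "S = {i. i mod int e \<in> U}"
        obtain h where h: "walk h S" using walk_exists by blast
        have SU: "S \<inter> {0..<int e} = U" using U by (auto simp: S_def)
        interpret periodic_walk n e S h
          using assms True U h SU by unfold_locales (auto simp: S_def)
        have "matching \<in> ?F"
          using rotate_fixed_iff[OF assms(1) matching_handshake, of e] matching_handshake
          by (simp add: short_openers_matching per)
        moreover have "?g matching = U" using SU by (simp add: short_openers_matching)
        ultimately show "U \<in> ?g ` ?F" by blast
      qed
    qed
  qed
  then have "card ?F = card ?U" by (rule bij_betw_same_card)
  also have "\<dots> = e choose (e div 2)" using n_subsets[of "{0..<int e}" "e div 2"] by simp
  finally show ?thesis using True by simp
qed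

section \<open>The number of noncrossing matchings\<close>

text \<open>Ballot sequences of length \<open>l\<close>, encoded by the positions of their
  \<open>t\<close> up steps: the height after \<open>k\<close> steps, twice the number of up steps
  minus \<open>k\<close>, is never negative.\<close>

definition ballot_sets :: "nat \<Rightarrow> nat \<Rightarrow> nat set set"
  where "ballot_sets l t = {U. U \<subseteq> {1..l} \<and> card U = t \<and> (\<forall>k\<le>l. k \<le> 2 * card (U \<inter> {1..k}))}"

text \<open>Split by the direction of the last step. The assumption is the ballot condition at the
  last position, which a final down step could violate.\<close>

lemma ballot_sets_Suc:
  assumes "Suc l \<le> 2 * Suc t"
  shows "ballot_sets (Suc l) (Suc t) = ballot_sets l (Suc t) \<union> insert (Suc l) ` ballot_sets l t"
proof
  show "ballot_sets (Suc l) (Suc t) \<subseteq> ballot_sets l (Suc t) \<union> insert (Suc l) ` ballot_sets l t"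
  proof
    fix U assume "U \<in> ballot_sets (Suc l) (Suc t)"
    then have U: "U \<subseteq> {1..Suc l}" "card U = Suc t" and k: "\<And>k. k \<le> Suc l \<Longrightarrow> k \<le> 2 * card (U \<inter> {1..k})"
      by (auto simp: ballot_sets_def)
    show "U \<in> ballot_sets l (Suc t) \<union> insert (Suc l) ` ballot_sets l t"
    proof (cases "Suc l \<in> U")
      case False
      then have "U \<subseteq> {1..l}" using U(1) by (auto simp: subset_eq le_Suc_eq)
      then show ?thesis using U(2) k by (simp add: ballot_sets_def)
    next
      case True
      define V where "V = U - {Suc l}"
      have "V \<subseteq> {1..l}" using U(1) by (auto simp: V_def subset_eq le_Suc_eq)
      moreover have "card V = t" using U(2) True by (simp add: V_def)
      moreover have "k \<le> 2 * card (V \<inter> {1..k})" if "k \<le> l" for k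
      proof -
        have "V \<inter> {1..k} = U \<inter> {1..k}" using that by (auto simp: V_def)
        then show ?thesis using k[of k] that by simp
      qed
      ultimately have "V \<in> ballot_sets l t" by (simp add: ballot_sets_def)
      moreover have "U = insert (Suc l) V" using True by (auto simp: V_def)
      ultimately show ?thesis by blast
    qed
  qed
next
  have *: "U \<in> ballot_sets (Suc l) (Suc t)"
    if U: "U \<subseteq> {1..Suc l}" "card U = Suc t" "\<And>k. k \<le> l \<Longrightarrow> k \<le> 2 * card (U \<inter> {1..k})" for U
  proof -
    have "U \<inter> {1..Suc l} = U" using U(1) by blast
    then have "k \<le> 2 * card (U \<inter> {1..k})" if "k \<le> Suc l" for k
      using U(2,3) that assms by (cases "k = Suc l") simp_all
    then show ?thesis using U by (simp add: ballot_sets_def)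
  qed
  have "U \<in> ballot_sets (Suc l) (Suc t)" if "U \<in> ballot_sets l (Suc t)" for U
    using that by (intro *) (auto simp: ballot_sets_def)
  moreover have "insert (Suc l) V \<in> ballot_sets (Suc l) (Suc t)" if V: "V \<in> ballot_sets l t" for V
  proof (rule *)
    have "V \<subseteq> {1..l}" "card V = t" using V by (auto simp: ballot_sets_def)
    moreover from this have "finite V" "Suc l \<notin> V" using finite_subset by fastforce+
    ultimately show "insert (Suc l) V \<subseteq> {1..Suc l}" "card (insert (Suc l) V) = Suc t" by auto
    fix k assume "k \<le> l"
    then have "insert (Suc l) V \<inter> {1..k} = V \<inter> {1..k}" by auto
    then show "k \<le> 2 * card (insert (Suc l) V \<inter> {1..k})" using V \<open>k \<le> l\<close> by (simp add: ballot_sets_def)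
  qed
  ultimately show "ballot_sets l (Suc t) \<union> insert (Suc l) ` ballot_sets l t \<subseteq> ballot_sets (Suc l) (Suc t)"
    by blast
qed

lemma finite_ballot_sets: "finite (ballot_sets l t)"
  by (rule finite_subset[of _ "Pow {1..l}"]) (auto simp: ballot_sets_def)

text \<open>The ballot numbers by Pascal's rule, in place of reflection. At the boundary
  \<open>l = 2 * t + 1\<close> there is no ballot sequence and the two binomials agree by symmetry;
  the induction gets there by removing a last up step from a walk that ends at height 0.\<close>

lemma card_ballot_sets:
  assumes "l \<le> 2 * t + 1"
  shows "card (ballot_sets l t) + (l choose (t + 1)) = l choose t"
  using assms
proof (induction l arbitrary: t)
  case 0
  have "ballot_sets 0 t = (if t = 0 then {{}} else {})" by (auto simp: ballot_sets_def)
  then show ?case by simp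
next
  case (Suc l)
  show ?case
  proof (cases "Suc l \<le> 2 * t")
    case True
    then obtain s where t: "t = Suc s" by (cases t) auto
    have "inj_on (insert (Suc l)) (ballot_sets l s)"
    proof
      fix U V assume UV: "U \<in> ballot_sets l s" "V \<in> ballot_sets l s" "insert (Suc l) U = insert (Suc l) V"
      then have "Suc l \<notin> U" "Suc l \<notin> V" by (auto simp: ballot_sets_def)
      then show "U = V" using UV(3) by (simp add: insert_ident)
    qed
    moreover have "ballot_sets l (Suc s) \<inter> insert (Suc l) ` ballot_sets l s = {}"
      by (auto simp: ballot_sets_def)
    ultimately have "card (ballot_sets (Suc l) t) = card (ballot_sets l (Suc s)) + card (ballot_sets l s)"
      using ballot_sets_Suc[of l s] True t
      by (simp add: card_Un_disjoint finite_ballot_sets card_image)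
    then show ?thesis using Suc.IH[of t] Suc.IH[of s] True t by simp
  next
    case False
    have "ballot_sets (Suc l) t = {}"
    proof (rule equals0I)
      fix U assume "U \<in> ballot_sets (Suc l) t"
      then have "U \<inter> {1..Suc l} = U" "card U = t" "Suc l \<le> 2 * card (U \<inter> {1..Suc l})"
        by (auto simp: ballot_sets_def)
      then show False using False by simp
    qed
    moreover have "l = 2 * t" using False Suc.prems by simp
    moreover have "Suc (2 * t) choose (t + 1) = Suc (2 * t) choose t"
      using binomial_symmetric[of t "Suc (2 * t)"] by (simp add: algebra_simps)
    ultimately show ?thesis by simp
  qed
qed

text \<open>When all matchings are counted no rotation has to be respected, so arcs can be oriented
  by their labels and the circle cut open at the seam.\<close>

definition openers :: "nat set set \<Rightarrow> nat set"
  where "openers M = {a. \<exists>c>a. {a, c} \<in> M}"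

lemma card_int_image_Int: "card (int ` U \<inter> {1..<int k + 1}) = card (U \<inter> {1..k})"
proof -
  have "int ` U \<inter> {1..<int k + 1} = int ` (U \<inter> {1..k})" by auto
  then show ?thesis by (simp add: card_image)
qed

lemma walk_int_image:
  assumes "walk h (int ` U)"
  shows "h (int k + 1) = h 1 + 2 * int (card (U \<inter> {1..k})) - int k"
  using walk_count[OF assms, of 1 "int k + 1"] card_int_image_Int[of U k] by simp

definition linear_arc :: "nat set set \<Rightarrow> int \<Rightarrow> int \<Rightarrow> bool"
  where "linear_arc M a c \<longleftrightarrow> (\<exists>x y. a = int x \<and> c = int y \<and> x < y \<and> {x, y} \<in> M)"

lemma linear_arc_int: "linear_arc M (int x) (int y) \<longleftrightarrow> x < y \<and> {x, y} \<in> M"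
  by (auto simp: linear_arc_def)

lemma linear_arc_either: "linear_arc M i j \<or> linear_arc M j i \<Longrightarrow> \<exists>x y. i = int x \<and> j = int y \<and> {x, y} \<in> M"
  by (auto simp: linear_arc_def insert_commute)

lemma nested_arcs_linear:
  assumes M: "M \<in> handshake_patterns n" and h: "walk h (int ` openers M)"
  shows "nested_arcs (int ` openers M) h (linear_arc M)"
proof
  have pm: "perfect_matching_on {1..2 * n} M" using M by (simp add: handshake_patterns_iff)
  have nc: "\<And>a b c d. {a, c} \<in> M \<Longrightarrow> {b, d} \<in> M \<Longrightarrow> a < b \<Longrightarrow> b < c \<Longrightarrow> c < d \<Longrightarrow> False"
    using M unfolding handshake_patterns_iff by blast
  note unique = perfect_matching_on_unique[OF pm]
  show "walk h (int ` openers M)" by (rule h)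
  show "j = k" if "linear_arc M i j \<or> linear_arc M j i" "linear_arc M i k \<or> linear_arc M k i" for i j k
    using linear_arc_either[OF that(1)] linear_arc_either[OF that(2)] unique by auto
  show "a < c \<and> a \<in> int ` openers M \<and> c \<notin> int ` openers M" if ac: "linear_arc M a c" for a c
  proof -
    obtain x y where xy: "a = int x" "c = int y" "x < y" "{x, y} \<in> M" using ac by (auto simp: linear_arc_def)
    have "y \<notin> openers M"
    proof
      assume "y \<in> openers M"
      then obtain z where "z > y" "{y, z} \<in> M" by (auto simp: openers_def)
      then show False using unique[of y z x] xy by (simp add: insert_commute)
    qed
    moreover have "x \<in> openers M" using xy by (auto simp: openers_def)
    ultimately show ?thesis using xy by auto
  qed
  show "\<exists>j. a < j \<and> j < c \<and> (linear_arc M i j \<or> linear_arc M j i)" if ac: "linear_arc M a c" "a < i" "i < c" for a c i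
  proof -
    obtain x y where xy: "a = int x" "c = int y" "x < y" "{x, y} \<in> M" using ac by (auto simp: linear_arc_def)
    define z where "z = nat i"
    have z: "i = int z" "x < z" "z < y" using ac xy by (auto simp: z_def)
    then have "z \<in> {1..2 * n}" using perfect_matching_on_pair[OF pm xy(4)] by auto
    then obtain w where w: "{z, w} \<in> M" using perfect_matching_on_ex[OF pm] by metis
    have w': "{w, z} \<in> M" using w by (simp add: insert_commute)
    have xy': "{y, x} \<in> M" using xy by (simp add: insert_commute)
    have "w \<noteq> z" using perfect_matching_on_pair(1)[OF pm w] by simp
    have "w \<noteq> x" using unique[of x y z] w' xy z by auto
    moreover have "w \<noteq> y" using unique[of y x z] w' xy' z by auto
    moreover have "\<not> w < x" using nc[OF w' xy(4)] z by blast
    moreover have "\<not> y < w" using nc[OF xy(4) w] z by blast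
    ultimately have "x < w" "w < y" by auto
    moreover have "linear_arc M i (int w) \<or> linear_arc M (int w) i"
      using w w' \<open>w \<noteq> z\<close> unfolding z(1) linear_arc_int by linarith
    ultimately show ?thesis using xy by (intro exI[of _ "int w"]) simp
  qed
qed

text \<open>The window of all labels is closed under partners: never falling below the start is the
  ballot condition, and ending at the starting height means that exactly half of the points
  open.\<close>

lemma openers_ballot:
  assumes M: "M \<in> handshake_patterns n"
  shows "openers M \<in> ballot_sets (2 * n) n"
proof -
  have pm: "perfect_matching_on {1..2 * n} M" using M by (simp add: handshake_patterns_iff)
  obtain h where h: "walk h (int ` openers M)" using walk_exists by blast
  interpret nested_arcs "int ` openers M" h "linear_arc M" by (rule nested_arcs_linear[OF M h])
  have H: "h (int (2 * n) + 1) = h 1 \<and> (\<forall>k. 1 \<le> k \<and> k \<le> int (2 * n) + 1 \<longrightarrow> h 1 \<le> h k)"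
  proof (rule closed_interval)
    fix i :: int assume "1 \<le> i" "i < int (2 * n) + 1"
    then obtain z where z: "i = int z" "z \<in> {1..2 * n}" by (cases i) auto
    then obtain w where w: "{z, w} \<in> M" using perfect_matching_on_ex[OF pm] by metis
    have w': "{w, z} \<in> M" using w by (simp add: insert_commute)
    have "linear_arc M i (int w) \<or> linear_arc M (int w) i"
      using w w' perfect_matching_on_pair(1)[OF pm w] unfolding z(1) linear_arc_int by linarith
    then show "\<exists>j\<ge>1. j < int (2 * n) + 1 \<and> (linear_arc M i j \<or> linear_arc M j i)"
      using perfect_matching_on_pair(3)[OF pm w] by (intro exI[of _ "int w"]) auto
  qed simp
  have sub: "openers M \<subseteq> {1..2 * n}"
    unfolding openers_def using perfect_matching_on_pair(2)[OF pm] by blast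
  then have "openers M \<inter> {1..2 * n} = openers M" by blast
  then have "card (openers M) = n" using walk_int_image[OF h, of "2 * n"] H by simp
  moreover have "k \<le> 2 * card (openers M \<inter> {1..k})" if "k \<le> 2 * n" for k
    using walk_int_image[OF h, of k] H[THEN conjunct2, rule_format, of "int k + 1"] that by simp
  ultimately show ?thesis using sub by (simp add: ballot_sets_def)
qed

lemma openers_inject:
  assumes M: "M \<in> handshake_patterns n" and M': "M' \<in> handshake_patterns n"
    and eq: "openers M = openers M'"
  shows "M = M'"
proof -
  have pm: "perfect_matching_on {1..2 * n} M" "perfect_matching_on {1..2 * n} M'"
    using assms by (simp_all add: handshake_patterns_iff)
  obtain h where h: "walk h (int ` openers M)" using walk_exists by blast
  interpret A: nested_arcs "int ` openers M" h "linear_arc M" by (rule nested_arcs_linear[OF M h])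
  interpret B: nested_arcs "int ` openers M'" h "linear_arc M'" by (rule nested_arcs_linear[OF M']) (use h eq in simp)
  have *: "{x, y} \<in> M'" if xy: "x < y" "{x, y} \<in> M" for x y
  proof -
    have "x \<in> openers M'" using xy eq by (auto simp: openers_def)
    then obtain z where z: "x < z" "{x, z} \<in> M'" by (auto simp: openers_def)
    have "int y = int z"
      using excursion_right_unique[of h "int x" "int y" "int z"] A.excursion[of "int x" "int y"] B.excursion[of "int x" "int z"] xy z
      by (simp add: linear_arc_int)
    then show ?thesis using z by simp
  qed
  show ?thesis
  proof (rule perfect_matching_on_eqI[OF pm])
    fix x y assume xy: "{x, y} \<in> M"
    then consider "x < y" | "y < x" using perfect_matching_on_pair(1)[OF pm(1)] by fastforce
    then show "{x, y} \<in> M'" using *[of x y] *[of y x] xy by cases (simp_all add: insert_commute)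
  qed
qed

text \<open>The walk starts and ends the window at its minimum over the window, which keeps the
  partner of every point inside; excursions then do not cross.\<close>

lemma openers_surject:
  assumes U: "U \<in> ballot_sets (2 * n) n"
  shows "\<exists>M\<in>handshake_patterns n. openers M = U"
proof -
  obtain h where h: "walk h (int ` U)" using walk_exists by blast
  have "U \<inter> {1..2 * n} = U" using U by (auto simp: ballot_sets_def)
  then have top: "h (int (2 * n) + 1) = h 1"
    using walk_int_image[OF h, of "2 * n"] U by (simp add: ballot_sets_def)
  have low: "h 1 \<le> h (int k + 1)" if "k \<le> 2 * n" for k
    using walk_int_image[OF h, of k] U that by (auto simp: ballot_sets_def)
  define f where "f x = (THE y. excursion h (int x) (int y) \<or> excursion h (int y) (int x))" for x
  have ex: "\<exists>y\<in>{1..2 * n}. excursion h (int x) (int y) \<or> excursion h (int y) (int x)" if x: "x \<in> {1..2 * n}" for x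
  proof (cases "x \<in> U")
    case True
    have "h (int (2 * n) + 1) \<le> h (int x)" using top low[of "x - 1"] x by (auto simp: of_nat_diff)
    then obtain j where j: "j < int (2 * n) + 1" "excursion h (int x) j"
      using excursion_right[OF h, of "int x" "int (2 * n) + 1"] x True by auto
    then have "int x < j" by (simp add: excursionD)
    then show ?thesis using j x by (intro bexI[of _ "nat j"]) auto
  next
    case False
    then have "int x \<notin> int ` U" by auto
    moreover have "h 1 \<le> h (int x + 1)" using low[of x] x by simp
    ultimately obtain i where i: "i \<ge> 1" "excursion h i (int x)"
      using excursion_left[OF h, of "int x" 1] x by auto
    then have "i < int x" by (simp add: excursionD)
    then show ?thesis using i x by (intro bexI[of _ "nat i"]) auto
  qed
  have unique: "f x = y" if "excursion h (int x) (int y) \<or> excursion h (int y) (int x)" for x y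
    unfolding f_def
  proof (rule the_equality)
    fix z assume z: "excursion h (int x) (int z) \<or> excursion h (int z) (int x)"
    have no: "\<not> (excursion h (int x) (int u) \<and> excursion h (int v) (int x))" for u v
      using excursion_ends[OF h] by blast
    show "z = y"
      using that z no excursion_right_unique[of h "int x" "int z" "int y"]
        excursion_left_unique[of h "int z" "int x" "int y"] by auto
  qed (rule that)
  have fx: "excursion h (int x) (int (f x)) \<or> excursion h (int (f x)) (int x)" "f x \<in> {1..2 * n}"
    if "x \<in> {1..2 * n}" for x
    using ex[OF that] unique by metis+
  have inv: "f x \<in> {1..2 * n} \<and> f x \<noteq> x \<and> f (f x) = x" if "x \<in> {1..2 * n}" for x
    using fx[OF that] unique[of "f x" x] by (auto dest: excursionD(1))
  define M where "M = (\<lambda>x. {x, f x}) ` {1..2 * n}"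
  have pm: "perfect_matching_on {1..2 * n} M"
    unfolding M_def by (rule perfect_matching_on_involution(1)[OF inv])
  have pair: "{x, y} \<in> M \<longleftrightarrow> y = f x" if "x \<in> {1..2 * n}" for x y
    unfolding M_def by (rule perfect_matching_on_involution(2)[OF inv that])
  have arc: "excursion h (int a) (int c)" if ac: "{a, c} \<in> M" "a < c" for a c
  proof -
    have a: "a \<in> {1..2 * n}" by (rule perfect_matching_on_pair(2)[OF pm ac(1)])
    have "c = f a" using pair[OF a] ac(1) by blast
    then show ?thesis using fx(1)[OF a] ac(2) by (auto dest: excursionD(1))
  qed
  have False if "{a, c} \<in> M" "{b, d} \<in> M" "a < b" "b < c" "c < d" for a b c d
    using excursion_noncrossing[OF arc[OF that(1)] arc[OF that(2)]] that(3-5) by auto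
  then have "M \<in> handshake_patterns n" using pm unfolding handshake_patterns_iff by blast
  moreover have "openers M = U"
  proof
    show "openers M \<subseteq> U"
      using arc excursion_ends(1)[OF h] by (fastforce simp: openers_def)
    show "U \<subseteq> openers M"
    proof
      fix x assume x: "x \<in> U"
      then have V: "x \<in> {1..2 * n}" using U by (auto simp: ballot_sets_def)
      have "excursion h (int x) (int (f x))" using fx(1)[OF V] excursion_ends(2)[OF h] x by blast
      then have "x < f x" by (auto dest: excursionD(1))
      moreover have "{x, f x} \<in> M" using pair[OF V] by blast
      ultimately show "x \<in> openers M" by (auto simp: openers_def)
    qed
  qed
  ultimately show ?thesis by blast
qed

text \<open>The ballot number is the difference of two binomials, the second being
  \<open>n / (n + 1)\<close> of the first. The product form matches
  \<open>q_catalan_mult_q_fact\<close>, so no division has to be evaluated.\<close>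

lemma card_handshake_patterns:
  "card (handshake_patterns n) * (fact n * fact (n + 1)) = (fact (2 * n) :: nat)"
proof -
  let ?C = "card (handshake_patterns n)" and ?B = "2 * n choose n" and ?B' = "2 * n choose (n + 1)"
  have "bij_betw openers (handshake_patterns n) (ballot_sets (2 * n) n)"
  proof (rule bij_betw_imageI)
    show "inj_on openers (handshake_patterns n)" using openers_inject by (rule inj_onI)
    show "openers ` handshake_patterns n = ballot_sets (2 * n) n"
      using openers_ballot openers_surject by (auto simp: image_iff) metis
  qed
  then have "?C + ?B' = ?B"
    using card_ballot_sets[of "2 * n" n] by (simp add: bij_betw_same_card)
  then have "(n + 1) * ?C + (n + 1) * ?B' = (n + 1) * ?B" by (metis distrib_left)
  moreover have "(n + 1) * ?B' = n * ?B"
  proof -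
    have "Suc n * (2 * n choose Suc n) = 2 * n * ((2 * n - 1) choose n)" by (rule binomial_absorption)
    moreover have "(2 * n - n) * ?B = 2 * n * ((2 * n - 1) choose n)" by (rule binomial_absorb_comp)
    moreover have "2 * n - n = n" by simp
    ultimately show ?thesis by (simp only: Suc_eq_plus1)
  qed
  moreover have "(n + 1) * ?B = n * ?B + ?B" by simp
  ultimately have C: "(n + 1) * ?C = ?B" by linarith
  have "?C * (fact n * fact (n + 1)) = (n + 1) * ?C * (fact n * fact n)"
    by (simp add: algebra_simps)
  also have "\<dots> = fact (2 * n)"
  proof -
    have "fact n * fact (2 * n - n) * ?B = fact (2 * n)" by (rule binomial_fact_lemma) simp
    moreover have "2 * n - n = n" by simp
    ultimately have "fact n * fact n * ?B = fact (2 * n)" by (simp only:)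
    then show ?thesis unfolding C by (simp only: mult.commute)
  qed
  finally show ?thesis .
qed

section \<open>The q-Catalan number at roots of unity\<close>

lemma poly_map_poly_of_rat_pCons:
  "poly (map_poly of_rat (pCons a P)) z = of_rat a + z * poly (map_poly of_rat P) (z :: 'a :: field_char_0)"
  by (cases "a = 0 \<and> P = 0") (auto simp: map_poly_pCons)

lemma poly_map_poly_of_rat_add:
  "poly (map_poly of_rat (P + Q)) z = poly (map_poly of_rat P) z + poly (map_poly of_rat Q) (z :: 'a :: field_char_0)"
  by (induction P Q rule: poly_induct2) (simp_all add: poly_map_poly_of_rat_pCons of_rat_add algebra_simps)

lemma poly_map_poly_of_rat_smult:
  "poly (map_poly of_rat (Polynomial.smult a P)) z = of_rat a * poly (map_poly of_rat P) (z :: 'a :: field_char_0)"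
  by (induction P) (simp_all add: poly_map_poly_of_rat_pCons of_rat_mult algebra_simps)

lemma poly_map_poly_of_rat_mult:
  "poly (map_poly of_rat (P * Q)) z = poly (map_poly of_rat P) z * poly (map_poly of_rat Q) (z :: 'a :: field_char_0)"
  by (induction P) (simp_all add: poly_map_poly_of_rat_pCons poly_map_poly_of_rat_add poly_map_poly_of_rat_smult algebra_simps)

lemma poly_map_poly_of_rat_power:
  "poly (map_poly of_rat (P ^ k)) z = poly (map_poly of_rat P) (z :: 'a :: field_char_0) ^ k"
  by (induction k) (simp_all add: poly_map_poly_of_rat_mult)

lemma poly_map_poly_of_rat_sum:
  "poly (map_poly of_rat (\<Sum>i\<in>A. P i)) z = (\<Sum>i\<in>A. poly (map_poly of_rat (P i)) (z :: 'a :: field_char_0))"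
  by (induction A rule: infinite_finite_induct) (simp_all add: poly_map_poly_of_rat_add)

lemma poly_map_poly_of_rat_monom:
  "poly (map_poly of_rat (Polynomial.monom 1 k)) z = (z :: 'a :: field_char_0) ^ k"
  by (simp add: map_poly_monom poly_monom)

lemmas poly_map_poly_of_rat = poly_map_poly_of_rat_add poly_map_poly_of_rat_mult
  poly_map_poly_of_rat_power poly_map_poly_of_rat_sum poly_map_poly_of_rat_monom

lemma q_catalan_mult_q_fact: "q_catalan n * (q_fact n * q_fact (n + 1)) = q_fact (2 * n)"
proof -
  have "q_catalan n * (q_fact n * q_fact (n + 1)) = (q_catalan n * q_int (n + 1)) * (q_fact n * q_fact n)"
    by (simp add: q_fact_Suc ac_simps)
  also have "\<dots> = q_fact (2 * n)"
    using q_binomial_exact[of n "2 * n"] unfolding q_catalan_exact by (simp add: mult_2)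
  finally show ?thesis .
qed

text \<open>The q-integer of \<open>l\<close> in the variable \<open>q ^ m\<close>; at a root of
  unity of order \<open>m\<close> its value is \<open>l\<close>.\<close>

definition q_int_power :: "nat \<Rightarrow> nat \<Rightarrow> rat poly"
  where "q_int_power m l = (\<Sum>j<l. Polynomial.monom 1 (m * j))"

lemma q_int_mult: "q_int (m * l) = q_int m * q_int_power m l"
proof (induction l)
  case (Suc l)
  have "q_int (m * Suc l) = q_int (m * l) + Polynomial.monom 1 (m * l) * q_int m"
    using q_int_add[of "m * l" m] by (simp add: add.commute)
  then show ?case using Suc by (simp add: q_int_power_def algebra_simps)
qed (simp add: q_int_def q_int_power_def)

text \<open>\<open>q_fact N\<close> with a factor \<open>q_int m\<close> removed for every multiple of \<open>m\<close> up to \<open>N\<close>; at a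
  primitive \<open>m\<close>-th root of unity this cofactor does not vanish.\<close>

fun q_fact_cofactor :: "nat \<Rightarrow> nat \<Rightarrow> rat poly"
  where "q_fact_cofactor m 0 = 1"
  | "q_fact_cofactor m (Suc N) =
      (if m dvd Suc N then q_int_power m (Suc N div m) else q_int (Suc N)) * q_fact_cofactor m N"

lemma q_fact_cofactor: "q_fact N = q_int m ^ (N div m) * q_fact_cofactor m N"
proof (induction N)
  case (Suc N)
  show ?case
  proof (cases "m dvd Suc N")
    case True
    then have "Suc N div m = Suc (N div m)" by (simp add: div_Suc dvd_eq_mod_eq_0)
    moreover have "q_int (Suc N) = q_int m * q_int_power m (Suc N div m)"
      using q_int_mult[of m "Suc N div m"] True by simp
    ultimately show ?thesis using Suc True by (simp add: q_fact_Suc algebra_simps)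
  next
    case False
    then have "Suc N div m = N div m" by (simp add: div_Suc dvd_eq_mod_eq_0)
    then show ?thesis using Suc False by (simp add: q_fact_Suc algebra_simps)
  qed
qed (simp add: q_fact_0)

text \<open>The powers of \<open>q_int m\<close> are cancelled as polynomials, before evaluation,
  because \<open>q_int m\<close> vanishes at the root of unity.\<close>

lemma q_catalan_cofactor:
  assumes "m > 0" "n div m + (n + 1) div m \<le> 2 * n div m"
  shows "q_catalan n * (q_fact_cofactor m n * q_fact_cofactor m (n + 1)) =
    q_int m ^ (2 * n div m - (n div m + (n + 1) div m)) * q_fact_cofactor m (2 * n)"
proof -
  let ?F = "q_int m" and ?k = "n div m + (n + 1) div m"
  have "?F ^ ?k * (q_catalan n * (q_fact_cofactor m n * q_fact_cofactor m (n + 1))) =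
      q_catalan n * (q_fact n * q_fact (n + 1))"
    unfolding q_fact_cofactor[of n m] q_fact_cofactor[of "n + 1" m] by (simp only: power_add ac_simps)
  also have "\<dots> = ?F ^ (2 * n div m) * q_fact_cofactor m (2 * n)"
    unfolding q_catalan_mult_q_fact by (rule q_fact_cofactor)
  also have "\<dots> = ?F ^ ?k * (?F ^ (2 * n div m - ?k) * q_fact_cofactor m (2 * n))"
    using assms(2) by (simp only: mult.assoc[symmetric] power_add[symmetric] le_add_diff_inverse)
  finally show ?thesis using q_int_nonzero[OF assms(1)] by simp
qed

lemma has_mult_order_power_eq_1_iff:
  assumes "has_mult_order z m"
  shows "z ^ k = 1 \<longleftrightarrow> m dvd k"
proof
  assume "z ^ k = 1"
  have z: "m > 0" "z ^ m = 1" "\<And>j. 0 < j \<Longrightarrow> j < m \<Longrightarrow> z ^ j \<noteq> 1" using assms by (auto simp: has_mult_order_def)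
  have "z ^ k = (z ^ m) ^ (k div m) * z ^ (k mod m)"
    by (simp only: power_mult[symmetric] power_add[symmetric] mult_div_mod_eq)
  then have "z ^ (k mod m) = 1" using z(2) \<open>z ^ k = 1\<close> by simp
  then have "k mod m = 0" using z(1,3) by (metis mod_less_divisor gr0I)
  then show "m dvd k" by (simp add: dvd_eq_mod_eq_0)
next
  assume "m dvd k"
  then show "z ^ k = 1" using assms by (auto simp: has_mult_order_def power_mult)
qed

locale primitive_root =
  fixes w :: complex and m :: nat
  assumes order: "has_mult_order w m" and m: "m \<ge> 2"
begin

text \<open>\<open>s i\<close> and \<open>v r\<close> are the values at \<open>w\<close> of
  \<open>q_int i\<close> and \<open>q_fact r\<close>.\<close>

definition s :: "nat \<Rightarrow> complex"
  where "s i = (\<Sum>k<i. w ^ k)"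

definition v :: "nat \<Rightarrow> complex"
  where "v r = (\<Prod>i=1..r. s i)"

lemma s_mult: "(w - 1) * s i = w ^ i - 1"
  using power_diff_1_eq[of w i] by (simp add: s_def)

lemma w_neq_1: "w \<noteq> 1"
  using has_mult_order_power_eq_1_iff[OF order, of 1] m by auto

lemma s_eq_0_iff: "s i = 0 \<longleftrightarrow> m dvd i"
proof -
  have "s i = 0 \<longleftrightarrow> w ^ i = 1" using s_mult[of i] w_neq_1 by auto
  then show ?thesis using has_mult_order_power_eq_1_iff[OF order] by simp
qed

lemma s_mod: "s (i mod m) = s i"
proof -
  have "w ^ i = (w ^ m) ^ (i div m) * w ^ (i mod m)"
    by (simp only: power_mult[symmetric] power_add[symmetric] mult_div_mod_eq)
  then have "w ^ i = w ^ (i mod m)" using order by (simp add: has_mult_order_def)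
  then have "(w - 1) * s (i mod m) = (w - 1) * s i" by (simp only: s_mult)
  then show ?thesis using w_neq_1 by simp
qed

lemma v_nonzero: "r < m \<Longrightarrow> v r \<noteq> 0"
  by (auto simp: v_def s_eq_0_iff dest: dvd_imp_le)

lemma poly_q_int: "poly (map_poly of_rat (q_int i)) w = s i"
  by (simp add: q_int_def s_def poly_map_poly_of_rat)

lemma poly_q_int_power: "poly (map_poly of_rat (q_int_power m l)) w = of_nat l"
  using order by (simp add: q_int_power_def poly_map_poly_of_rat power_mult has_mult_order_def)

text \<open>\<open>s i\<close> depends only on \<open>i mod m\<close>. Each full block of
  \<open>m\<close> factors contributes \<open>v (m - 1)\<close> from the non-multiples of
  \<open>m\<close> and, from the multiple \<open>m * l\<close>, the number \<open>l\<close>; these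
  numbers multiply to the factorial.\<close>

lemma poly_q_fact_cofactor:
  "poly (map_poly of_rat (q_fact_cofactor m N)) w = fact (N div m) * v (m - 1) ^ (N div m) * v (N mod m)"
proof (induction N)
  case 0
  then show ?case using poly_map_poly_of_rat_monom[of 0 w] by (simp add: v_def)
next
  case (Suc N)
  show ?case
  proof (cases "m dvd Suc N")
    case True
    then have "Suc N mod m = 0" by simp
    then have "N mod m = m - 1" "Suc N div m = Suc (N div m)"
      by (auto simp: mod_Suc div_Suc split: if_splits)
    then show ?thesis using Suc True
      by (simp add: poly_map_poly_of_rat poly_q_int_power v_def algebra_simps)
  next
    case False
    then have "Suc N mod m \<noteq> 0" by (simp add: dvd_eq_mod_eq_0)
    then have N: "Suc N mod m = Suc (N mod m)" "Suc N div m = N div m"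
      by (auto simp: mod_Suc div_Suc split: if_splits)
    have "v (Suc N mod m) = s (Suc N) * v (N mod m)"
      using s_mod[of "Suc N"] unfolding N(1) by (simp add: v_def)
    then show ?thesis using Suc False N(2)
      by (simp add: poly_map_poly_of_rat poly_q_int algebra_simps)
  qed
qed

text \<open>Everything depends on the exponent of \<open>s m = 0\<close>. For even \<open>e\<close>
  both quotients \<open>a\<close>, \<open>b\<close> equal \<open>e div 2\<close>. For odd
  \<open>e\<close> the remainder of \<open>n\<close> is \<open>m div 2\<close>, so
  \<open>a + b = e - 1\<close> and the value is 0, unless \<open>m = 2\<close>, when
  \<open>n + 1\<close> is a multiple of \<open>m\<close> and \<open>b = a + 1\<close>.\<close>

lemma poly_q_catalan:
  assumes "n > 0" and me: "m * e = 2 * n"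
  shows "poly (map_poly of_rat (q_catalan n)) w =
    (if even e \<or> e = n then of_nat (e choose (e div 2)) else 0)"
proof -
  let ?g = "\<lambda>N. poly (map_poly of_rat (q_fact_cofactor m N)) w"
  have top: "2 * n div m = e" "2 * n mod m = 0" using me m by (simp_all flip: me)
  define a b where "a = n div m" and "b = (n + 1) div m"
  define X where "X = poly (map_poly of_rat (q_catalan n)) w"
  have v01: "v 0 = 1" "v 1 = 1" by (simp_all add: v_def s_def)
  have u: "v (m - 1) \<noteq> 0" using v_nonzero m by simp
  have X: "X * (?g n * ?g (n + 1)) = s m ^ (e - (a + b)) * ?g (2 * n)" if "a + b \<le> e"
    using q_catalan_cofactor[of m n, THEN arg_cong[where f = "\<lambda>P. poly (map_poly of_rat P) w"]] that m top
    by (simp add: poly_map_poly_of_rat poly_q_int a_def b_def X_def)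
  have nz: "?g N \<noteq> 0" for N using u v_nonzero[of "N mod m"] m by (simp add: poly_q_fact_cofactor)
  \<comment> \<open>The case of exponent 0: the powers of \<open>v (m - 1)\<close> cancel, and only
    factorials are left, as the remaining factors are \<open>v 0\<close> or
    \<open>v 1\<close>.\<close>
  have eq: "X = of_nat (e choose (e div 2))"
    if ab: "a = e div 2" "a + b = e" and rem: "v (n mod m) = 1" "v ((n + 1) mod m) = 1"
  proof -
    have "X * (fact a * v (m - 1) ^ a * (fact b * v (m - 1) ^ b)) = fact e * v (m - 1) ^ e"
    proof -
      have "?g n = fact a * v (m - 1) ^ a" "?g (n + 1) = fact b * v (m - 1) ^ b" "?g (2 * n) = fact e * v (m - 1) ^ e"
        using poly_q_fact_cofactor[of n] poly_q_fact_cofactor[of "n + 1"] poly_q_fact_cofactor[of "2 * n"]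
        by (simp_all only: rem top v01 mult_1_right a_def b_def)
      then show ?thesis using X ab by simp
    qed
    then have "v (m - 1) ^ e * (X * (fact a * fact b)) = v (m - 1) ^ e * fact e"
      by (simp add: power_add algebra_simps flip: ab(2))
    then have "X * (fact a * fact b) = fact e" using u by simp
    moreover have "of_nat (e choose a) * (fact a * fact b) = (fact e :: complex)"
    proof -
      have "fact a * fact (e - a) * (e choose a) = fact e" by (rule binomial_fact_lemma) (use ab in simp)
      then have "fact a * fact b * (e choose a) = (fact e :: nat)" using ab by (metis add_diff_cancel_left')
      then have "of_nat (fact a * fact b * (e choose a)) = (of_nat (fact e) :: complex)" by (rule arg_cong)
      then show ?thesis by (simp add: algebra_simps)
    qed
    ultimately have "X * (fact a * fact b) = of_nat (e choose a) * (fact a * fact b)" by simp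
    then show ?thesis using ab(1) by simp
  qed
  show ?thesis
  proof (cases "even e")
    case True
    then obtain k where k: "e = 2 * k" by (elim evenE)
    then have n: "n = m * k" using me by simp
    have n1: "n + 1 = 1 + m * k" using n by simp
    have "b = k" "(n + 1) mod m = 1"
      unfolding b_def n1 using div_mult_self2[of m 1 k] mod_mult_self2[of 1 m k] m by simp_all
    moreover have "a = k" "n mod m = 0" using m by (simp_all add: n a_def)
    ultimately show ?thesis using eq k v01 True by (simp add: X_def)
  next
    case odd: False
    then obtain k where k: "e = 2 * k + 1" by (elim oddE)
    have "even m" using me odd by (metis even_mult_iff dvd_triv_left)
    then obtain p where p: "m = 2 * p" by (elim evenE)
    have n: "n = m * k + p" using me k p by simp
    have a: "a = k" "n mod m = p" using m p by (simp_all add: n a_def)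
    show ?thesis
    proof (cases "m = 2")
      case True
      then have "p = 1" "e = n" using p me by auto
      have "n + 1 = m * (k + 1)" using n p True by simp
      then have "b = k + 1" "(n + 1) mod m = 0" using m by (simp_all add: b_def del: mult_Suc_right)
      then show ?thesis using eq k a \<open>p = 1\<close> \<open>e = n\<close> v01 by (simp add: X_def)
    next
      case False
      then have "p \<ge> 2" "e \<noteq> n" using p m me assms(1) by auto
      have n1: "n + 1 = (p + 1) + m * k" using n by simp
      have "b = k" unfolding b_def n1 using div_mult_self2[of m "p + 1" k] \<open>p \<ge> 2\<close> p by simp
      then have "X * (?g n * ?g (n + 1)) = 0"
        using X a k s_eq_0_iff[of m] by simp
      then have "X = 0" using nz[of n] nz[of "n + 1"] by (simp del: q_fact_cofactor.simps)
      then show ?thesis using odd \<open>e \<noteq> n\<close> by (simp add: X_def)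
    qed
  qed
qed

end

lemma poly_q_fact_1: "poly (map_poly of_rat (q_fact N)) (1 :: complex) = fact N"
proof (induction N)
  case 0
  then show ?case using poly_map_poly_of_rat_monom[of 0 "1 :: complex"] by (simp add: q_fact_0)
next
  case (Suc N)
  then show ?case by (simp add: q_fact_Suc poly_map_poly_of_rat q_int_def)
qed

lemma poly_q_catalan_1: "poly (map_poly of_rat (q_catalan n)) (1 :: complex) * (fact n * fact (n + 1)) = fact (2 * n)"
  using q_catalan_mult_q_fact[of n, THEN arg_cong[where f = "\<lambda>P. poly (map_poly of_rat P) (1 :: complex)"]]
  by (simp add: poly_map_poly_of_rat poly_q_fact_1 del: fact_Suc)

section \<open>Regions of a matching and the Kreweras complement\<close>

text \<open>The vertex \<open>k\<close> of the circle \<open>1, 1', 2, 2', \<dots>\<close> lies between the matching points \<open>k\<close> and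
  \<open>k + 1\<close>, and the arc from \<open>x\<close> to \<open>y\<close> cuts off the vertices \<open>x, \<dots>, y - 1\<close>.\<close>

definition same_region :: "nat set set \<Rightarrow> nat \<Rightarrow> nat \<Rightarrow> bool"
  where "same_region M k l \<longleftrightarrow>
    (\<forall>x y. {x, y} \<in> M \<and> x < y \<longrightarrow> (x \<le> k \<and> k < y \<longleftrightarrow> x \<le> l \<and> l < y))"

lemma same_region_refl: "same_region M k k"
  and same_region_sym: "same_region M k l \<Longrightarrow> same_region M l k"
  and same_region_trans: "same_region M k l \<Longrightarrow> same_region M l p \<Longrightarrow> same_region M k p"
  by (simp_all add: same_region_def)

lemma same_regionD:
  "same_region M k l \<Longrightarrow> {x, y} \<in> M \<Longrightarrow> x < y \<Longrightarrow> x \<le> k \<and> k < y \<longleftrightarrow> x \<le> l \<and> l < y"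
  unfolding same_region_def by blast

text \<open>Each arc cuts off an interval of vertices. An interval containing \<open>k\<close> and
  \<open>p\<close> contains \<open>l\<close>, and one containing \<open>l\<close> and
  \<open>q\<close> contains \<open>p\<close>.\<close>

lemma same_region_noncrossing:
  assumes "same_region M k p" "same_region M l q" "k < l" "l < p" "p < q"
  shows "same_region M k l"
  unfolding same_region_def
proof (intro allI impI)
  fix x y assume xy: "{x, y} \<in> M \<and> x < y"
  then show "x \<le> k \<and> k < y \<longleftrightarrow> x \<le> l \<and> l < y"
    using same_regionD[OF assms(1), of x y] same_regionD[OF assms(2), of x y] assms(3-5) by linarith
qed

lemma handshake_arc_nested:
  assumes M: "M \<in> handshake_patterns n" and ab: "{a, b} \<in> M" "a < b" and xy: "{x, y} \<in> M" "x < y"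
    and ne: "x \<noteq> a"
  shows "x \<noteq> b" "y \<noteq> a" "y \<noteq> b" "a < x \<and> x < b \<longleftrightarrow> a < y \<and> y < b"
proof -
  have pm: "perfect_matching_on {1..2 * n} M" using M by (simp add: handshake_patterns_iff)
  note unique = perfect_matching_on_unique[OF pm]
  have nc: "\<And>a b c d. {a, c} \<in> M \<Longrightarrow> {b, d} \<in> M \<Longrightarrow> a < b \<Longrightarrow> b < c \<Longrightarrow> c < d \<Longrightarrow> False"
    using M unfolding handshake_patterns_iff by blast
  have ba: "{b, a} \<in> M" "{y, x} \<in> M" using ab xy by (simp_all add: insert_commute)
  show xb: "x \<noteq> b"
  proof
    assume "x = b"
    then show False using unique[OF ba(1), of y] xy ab by auto
  qed
  show ya: "y \<noteq> a"
  proof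
    assume "y = a"
    then show False using unique[OF ab(1), of x] ba(2) xy ab by auto
  qed
  show yb: "y \<noteq> b"
  proof
    assume "y = b"
    then show False using unique[OF ba(1), of x] ba(2) ne by auto
  qed
  show "a < x \<and> x < b \<longleftrightarrow> a < y \<and> y < b"
  proof -
    have "\<not> (a < x \<and> x < b \<and> b < y)" "\<not> (x < a \<and> a < y \<and> y < b)"
      using nc[OF ab(1) xy(1)] nc[OF xy(1) ab(1)] by blast+
    then show ?thesis using ab(2) xy(2) ne xb ya yb by linarith
  qed
qed

text \<open>The vertices next to the arc are \<open>a\<close>, \<open>b - 1\<close> on its inner
  side and \<open>a - 1\<close>, \<open>b\<close> on its outer side; no other arc separates either
  pair. Here \<open>a - 1\<close> may be 0, another name for the vertex
  \<open>2 * n\<close>.\<close>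

lemma same_region_arc:
  assumes M: "M \<in> handshake_patterns n" and ab: "{a, b} \<in> M" "a < b"
  shows "same_region M a (b - 1)" "same_region M (a - 1) b"
proof -
  have pm: "perfect_matching_on {1..2 * n} M" using M by (simp add: handshake_patterns_iff)
  have "a \<ge> 1" using perfect_matching_on_pair[OF pm ab(1)] by simp
  have "(x \<le> a \<and> a < y \<longleftrightarrow> x \<le> b - 1 \<and> b - 1 < y) \<and> (x \<le> a - 1 \<and> a - 1 < y \<longleftrightarrow> x \<le> b \<and> b < y)"
    if xy: "{x, y} \<in> M" "x < y" for x y
  proof (cases "x = a")
    case True
    then have "y = b" using perfect_matching_on_unique[OF pm] xy ab by blast
    then show ?thesis using True ab(2) \<open>a \<ge> 1\<close> by auto
  next
    case False
    show ?thesis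
      using handshake_arc_nested[OF M ab xy False] False ab(2) xy(2) \<open>a \<ge> 1\<close> by linarith
  qed
  then show "same_region M a (b - 1)" "same_region M (a - 1) b"
    unfolding same_region_def by blast+
qed

text \<open>The arc at \<open>a\<close> separates the vertices \<open>a - 1\<close> and
  \<open>a\<close>; the two assumptions leave only \<open>b\<close> for its other end. A matching is
  therefore determined by its regions.\<close>

lemma same_region_arcD:
  assumes M: "M \<in> handshake_patterns n" and a: "1 \<le> a" "a < b" "b \<le> 2 * n"
    and ab: "same_region M a (b - 1)" "same_region M (a - 1) b"
  shows "{a, b} \<in> M"
proof -
  have pm: "perfect_matching_on {1..2 * n} M" using M by (simp add: handshake_patterns_iff)
  have "a \<in> {1..2 * n}" using a by simp
  then obtain y where y: "{a, y} \<in> M" using perfect_matching_on_ex[OF pm] by metis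
  have "y = b"
  proof (cases "a < y")
    case True
    then show ?thesis using same_regionD[OF ab(1) y True] same_regionD[OF ab(2) y True] a by linarith
  next
    case False
    have ya: "{y, a} \<in> M" "y < a"
      using y False perfect_matching_on_pair(1)[OF pm y] by (auto simp: insert_commute)
    then show ?thesis using same_regionD[OF ab(2) ya] a by linarith
  qed
  then show ?thesis using y by simp
qed

lemma same_region_0:
  assumes M: "M \<in> handshake_patterns n"
  shows "same_region M 0 (2 * n)"
proof -
  have pm: "perfect_matching_on {1..2 * n} M" using M by (simp add: handshake_patterns_iff)
  show ?thesis unfolding same_region_def
    using perfect_matching_on_pair[OF pm] by fastforce
qed

text \<open>The points between two vertices of one region are matched among themselves, so their
  number is even.\<close>

lemma same_region_parity:
  assumes M: "M \<in> handshake_patterns n" and "k \<le> 2 * n" "l \<le> 2 * n" and kl: "same_region M k l"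
  shows "even k \<longleftrightarrow> even l"
proof -
  have pm: "perfect_matching_on {1..2 * n} M" using M by (simp add: handshake_patterns_iff)
  have *: "even k \<longleftrightarrow> even l" if "k \<le> l" "l \<le> 2 * n" "same_region M k l" for k l
  proof -
    let ?I = "{k<..l}"
    have closed: "y \<in> ?I" if xy: "{x, y} \<in> M" "x \<in> ?I" for x y
    proof (cases "x < y")
      case True
      then show ?thesis using same_regionD[OF \<open>same_region M k l\<close> xy(1) True] xy(2) \<open>k \<le> l\<close> by auto
    next
      case False
      then have "{y, x} \<in> M" "y < x"
        using xy(1) perfect_matching_on_pair(1)[OF pm xy(1)] by (auto simp: insert_commute)
      then show ?thesis using same_regionD[OF \<open>same_region M k l\<close>, of y x] xy(2) \<open>k \<le> l\<close> by auto
    qed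
    define N where "N = {A \<in> M. A \<subseteq> ?I}"
    have "\<Union>N = ?I"
    proof
      show "?I \<subseteq> \<Union>N"
      proof
        fix x assume x: "x \<in> ?I"
        then have "x \<in> {1..2 * n}" using \<open>l \<le> 2 * n\<close> by auto
        then obtain y where y: "{x, y} \<in> M" using perfect_matching_on_ex[OF pm] by metis
        then have "{x, y} \<in> N" using closed[OF y x] x by (simp add: N_def)
        then show "x \<in> \<Union>N" by blast
      qed
    qed (auto simp: N_def)
    moreover have "card (\<Union>N) = sum card N"
    proof (rule card_Union_disjoint)
      show "disjoint N"
        using pm pairwise_subset[of disjnt M N] by (auto simp: N_def perfect_matching_on_def partition_on_def)
    qed (auto simp: N_def intro: finite_subset)
    moreover have "sum card N = (\<Sum>A\<in>N. 2)"
      using pm by (intro sum.cong) (auto simp: N_def perfect_matching_on_def)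
    ultimately have "l - k = 2 * card N" by simp
    then show ?thesis using \<open>k \<le> l\<close> by presburger
  qed
  show ?thesis
  proof (cases "k \<le> l")
    case True
    then show ?thesis by (rule *[OF _ assms(3) kl])
  next
    case False
    then have "even l \<longleftrightarrow> even k" by (intro *[OF _ assms(2) same_region_sym[OF kl]]) simp
    then show ?thesis by blast
  qed
qed

lemma rotate_handshake_pair:
  assumes M: "M \<in> handshake_patterns n" and n: "n > 0" and x: "x \<in> {1..2 * n}" and y: "y \<in> {1..2 * n}"
  shows "{x mod (2 * n) + 1, y mod (2 * n) + 1} \<in> rotate_matching n M \<longleftrightarrow> {x, y} \<in> M"
proof -
  have eq: "z mod (2 * n) + 1 = circ n (int z + 1)" if "z \<in> {1..2 * n}" for z
    using circ_Suc[OF n, of "int z"] that by (simp add: circ_of_nat)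
  show ?thesis unfolding eq[OF x] eq[OF y]
    using rotate_handshake_iff[OF M n, of "int x + 1" "int y + 1"] x y by (simp add: circ_of_nat)
qed

text \<open>An arc ending at \<open>2 * n\<close> becomes one starting at 1. It then cuts off the
  complementary set of vertices, which separates the same pairs.\<close>

lemma same_region_rotate:
  assumes M: "M \<in> handshake_patterns n" and n: "n > 0" and "k < 2 * n" "l < 2 * n"
  shows "same_region (rotate_matching n M) (k + 1) (l + 1) \<longleftrightarrow> same_region M k l"
proof -
  let ?R = "rotate_matching n M"
  have pm: "perfect_matching_on {1..2 * n} M" using M by (simp add: handshake_patterns_iff)
  have pmR: "perfect_matching_on {1..2 * n} ?R"
    using rotate_handshake_closed[OF M n] by (simp add: handshake_patterns_iff)
  have last: "{1, x + 1} \<in> ?R \<longleftrightarrow> {x, 2 * n} \<in> M" if "x \<in> {1..<2 * n}" for x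
    using rotate_handshake_pair[OF M n, of x "2 * n"] that n by (simp add: insert_commute)
  have inner: "{x + 1, y + 1} \<in> ?R \<longleftrightarrow> {x, y} \<in> M" if "x \<in> {1..<2 * n}" "y \<in> {1..<2 * n}" for x y
    using rotate_handshake_pair[OF M n, of x y] that by simp
  show ?thesis
  proof
    assume R: "same_region ?R (k + 1) (l + 1)"
    show "same_region M k l"
      unfolding same_region_def
    proof (intro allI impI)
      fix x y assume xy: "{x, y} \<in> M \<and> x < y"
      then have V: "x \<in> {1..<2 * n}" "y \<in> {1..2 * n}"
        using perfect_matching_on_pair[OF pm, of x y] by auto
      show "x \<le> k \<and> k < y \<longleftrightarrow> x \<le> l \<and> l < y"
      proof (cases "y = 2 * n")
        case True
        then have "{1, x + 1} \<in> ?R" using last[OF V(1)] xy by simp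
        from same_regionD[OF R this] V assms(3,4) True show ?thesis by simp linarith
      next
        case False
        then have "{x + 1, y + 1} \<in> ?R" using inner[OF V(1), of y] V xy by simp
        from same_regionD[OF R this] xy show ?thesis by simp
      qed
    qed
  next
    assume R: "same_region M k l"
    show "same_region ?R (k + 1) (l + 1)"
      unfolding same_region_def
    proof (intro allI impI)
      fix x y assume xy: "{x, y} \<in> ?R \<and> x < y"
      then have V: "x \<in> {1..<2 * n}" "y \<in> {2..2 * n}"
        using perfect_matching_on_pair[OF pmR, of x y] by auto
      show "x \<le> k + 1 \<and> k + 1 < y \<longleftrightarrow> x \<le> l + 1 \<and> l + 1 < y"
      proof (cases "x = 1")
        case True
        have "y - 1 \<in> {1..<2 * n}" using V by auto
        moreover have "y - 1 + 1 = y" using V by auto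
        ultimately have "{y - 1, 2 * n} \<in> M" "y - 1 < 2 * n" using last[of "y - 1"] xy True by auto
        from same_regionD[OF R this] True assms(3,4) show ?thesis by simp linarith
      next
        case False
        then have V': "x - 1 \<in> {1..<2 * n}" "y - 1 \<in> {1..<2 * n}" "x - 1 + 1 = x" "y - 1 + 1 = y"
          using V xy by auto
        then have "{x - 1, y - 1} \<in> M" "x - 1 < y - 1" using inner[OF V'(1,2)] xy by auto
        from same_regionD[OF R this] V xy show ?thesis by linarith
      qed
    qed
  qed
qed

text \<open>\<open>f\<close> places the label \<open>i\<close> at a vertex: \<open>2 * i - 1\<close>
  for the point \<open>i\<close>, \<open>2 * i\<close> for the point \<open>i'\<close>.\<close>

definition region_partition :: "nat \<Rightarrow> nat set set \<Rightarrow> (nat \<Rightarrow> nat) \<Rightarrow> nat set set"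
  where "region_partition n M f =
    {1..n} // {(i, j). i \<in> {1..n} \<and> j \<in> {1..n} \<and> same_region M (f i) (f j)}"

definition odd_partition :: "nat \<Rightarrow> nat set set \<Rightarrow> nat set set"
  where "odd_partition n M = region_partition n M (\<lambda>i. 2 * i - 1)"

definition even_partition :: "nat \<Rightarrow> nat set set \<Rightarrow> nat set set"
  where "even_partition n M = region_partition n M (\<lambda>i. 2 * i)"

lemma equiv_region:
  "equiv {1..n} {(i, j). i \<in> {1..n} \<and> j \<in> {1..n} \<and> same_region M (f i) (f j)}"
  by (rule equivI)
    (auto simp: refl_on_def sym_def trans_def intro: same_region_refl same_region_sym same_region_trans)

lemma partition_on_region_partition: "partition_on {1..n} (region_partition n M f)"
  unfolding region_partition_def by (rule partition_on_quotient[OF equiv_region])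

lemma region_partitionD:
  assumes "B \<in> region_partition n M f" "i \<in> B"
  shows "i \<in> {1..n}" "j \<in> B \<longleftrightarrow> j \<in> {1..n} \<and> same_region M (f i) (f j)"
  using assms same_region_sym same_region_trans
  unfolding region_partition_def quotient_def by blast+

lemma region_partition_block:
  assumes "i \<in> {1..n}"
  shows "\<exists>B\<in>region_partition n M f. i \<in> B"
  using partition_onD1[OF partition_on_region_partition] assms by blast

lemma region_partition_noncrossing:
  assumes "strict_mono_on {1..n} f"
  shows "region_partition n M f \<in> noncrossing_partitions n"
  unfolding noncrossing_partitions_def
proof (intro CollectI conjI ballI allI impI)
  show "partition_on {1..n} (region_partition n M f)" by (rule partition_on_region_partition)
  fix A B a b c d
  assume A: "A \<in> region_partition n M f" and B: "B \<in> region_partition n M f"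
    and *: "a < b \<and> b < c \<and> c < d \<and> a \<in> A \<and> c \<in> A \<and> b \<in> B \<and> d \<in> B"
  have V: "a \<in> {1..n}" "b \<in> {1..n}" "c \<in> {1..n}" "d \<in> {1..n}"
    using * region_partitionD(1)[OF A] region_partitionD(1)[OF B] by auto
  have "same_region M (f a) (f b)"
  proof (rule same_region_noncrossing)
    show "same_region M (f a) (f c)" using region_partitionD(2)[OF A, of a c] * by blast
    show "same_region M (f b) (f d)" using region_partitionD(2)[OF B, of b d] * by blast
  qed (use strict_mono_onD[OF assms] V * in auto)
  then have "b \<in> A" using region_partitionD(2)[OF A, of a b] V * by blast
  then show "A = B"
    using disjointD[OF partition_onD2[OF partition_on_region_partition] A B] * by blast
qed

lemma odd_partition_noncrossing: "odd_partition n M \<in> noncrossing_partitions n"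
  unfolding odd_partition_def by (rule region_partition_noncrossing) (auto simp: strict_mono_on_def)

lemma even_partition_noncrossing: "even_partition n M \<in> noncrossing_partitions n"
  unfolding even_partition_def by (rule region_partition_noncrossing) (auto simp: strict_mono_on_def)

text \<open>A crossing would put an odd and an even vertex into the same region, against
  parity.\<close>

lemma even_partition_compatible:
  assumes M: "M \<in> handshake_patterns n"
  shows "even_partition n M \<in> kreweras_compatible n (odd_partition n M)"
proof -
  have "\<not> crosses ((\<lambda>i. 2 * i - 1) ` A) ((\<lambda>i. 2 * i) ` B)"
    if A: "A \<in> odd_partition n M" and B: "B \<in> even_partition n M" for A B
  proof
    assume "crosses ((\<lambda>i. 2 * i - 1) ` A) ((\<lambda>i. 2 * i) ` B)"
    then obtain a c b d where abcd: "a \<in> A" "c \<in> A" "b \<in> B" "d \<in> B"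
      and ord: "(2 * a - 1 < 2 * b \<and> 2 * b < 2 * c - 1 \<and> 2 * c - 1 < 2 * d) \<or>
        (2 * b < 2 * a - 1 \<and> 2 * a - 1 < 2 * d \<and> 2 * d < 2 * c - 1)"
      unfolding crosses_def by blast
    have V: "a \<in> {1..n}" "b \<in> {1..n}"
      using region_partitionD(1) A B abcd unfolding odd_partition_def even_partition_def by blast+
    have ac: "same_region M (2 * a - 1) (2 * c - 1)"
      using region_partitionD(2)[OF A[unfolded odd_partition_def] abcd(1)] abcd(2) by blast
    have bd: "same_region M (2 * b) (2 * d)"
      using region_partitionD(2)[OF B[unfolded even_partition_def] abcd(3)] abcd(4) by blast
    have "same_region M (2 * a - 1) (2 * b)"
      using ord same_region_noncrossing[OF ac bd] same_region_sym[OF same_region_noncrossing[OF bd ac]] by blast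
    moreover have "2 * a - 1 \<le> 2 * n" "2 * b \<le> 2 * n" "2 * a - 1 = 2 * (a - 1) + 1" using V by auto
    ultimately show False using same_region_parity[OF M, of "2 * a - 1" "2 * b"] by simp
  qed
  then show ?thesis by (simp add: kreweras_compatible_def even_partition_noncrossing)
qed

text \<open>Replaces an arc by a chord between two odd vertices of one region that separates the
  even vertices in the same way. The chord runs along the inner side of the arc if \<open>x\<close>
  is odd and along the outer side if \<open>x\<close> is even.\<close>

lemma same_region_odd_arc:
  assumes M: "M \<in> handshake_patterns n" and xy: "{x, y} \<in> M" "x < y"
  obtains p q where "same_region M (2 * p - 1) (2 * q - 1)" "p \<in> {1..n}" "q \<in> {1..n}"
    "\<And>i. x \<le> 2 * i \<and> 2 * i < y \<longleftrightarrow> 2 * p - 1 < 2 * i \<and> 2 * i < 2 * q - 1"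
proof -
  have pm: "perfect_matching_on {1..2 * n} M" using M by (simp add: handshake_patterns_iff)
  have V: "x \<in> {1..2 * n}" "y \<in> {1..2 * n}" using perfect_matching_on_pair[OF pm xy(1)] by auto
  have par: "even x \<longleftrightarrow> even (y - 1)"
  proof (rule same_region_parity[OF M _ _ same_region_arc(1)[OF M xy]])
    show "x \<le> 2 * n" using V by simp
    have "y \<le> 2 * n" using V by simp
    then show "y - 1 \<le> 2 * n" by linarith
  qed
  show thesis
  proof (cases "even x")
    case False
    then obtain p where p: "x = 2 * p + 1" by (elim oddE)
    have "odd (y - 1)" using par False by simp
    then obtain q where q: "y - 1 = 2 * q + 1" by (elim oddE)
    have r: "same_region M (2 * (p + 1) - 1) (2 * (q + 1) - 1)"
      using same_region_arc(1)[OF M xy, unfolded q] by (simp add: p)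
    have y: "y = 2 * q + 2" using q V by auto
    show thesis
    proof (rule that[OF r])
      show "p + 1 \<in> {1..n}" "q + 1 \<in> {1..n}" using p y V by auto
      show "x \<le> 2 * i \<and> 2 * i < y \<longleftrightarrow> 2 * (p + 1) - 1 < 2 * i \<and> 2 * i < 2 * (q + 1) - 1" for i
        unfolding p y by presburger
    qed
  next
    case True
    then obtain p where p: "x = 2 * p" by (elim evenE)
    have "even (y - 1)" using par True by simp
    then obtain q where q: "y - 1 = 2 * q" by (elim evenE)
    then have y: "y = 2 * q + 1" using V by auto
    have r: "same_region M (2 * p - 1) (2 * (q + 1) - 1)"
      using same_region_arc(2)[OF M xy] by (simp add: p y)
    have "p \<ge> 1" using p V by simp
    show thesis
    proof (rule that[OF r])
      show "p \<in> {1..n}" "q + 1 \<in> {1..n}" using p y V by auto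
      show "x \<le> 2 * i \<and> 2 * i < y \<longleftrightarrow> 2 * p - 1 < 2 * i \<and> 2 * i < 2 * (q + 1) - 1" for i
        unfolding p y using \<open>p \<ge> 1\<close> by presburger
    qed
  qed
qed

text \<open>A block with primed points on both sides of an arc would cross the chord parallel to
  that arc, which lies in a block of the odd partition. Hence each block stays within one
  region.\<close>

lemma kreweras_compatible_refines:
  assumes M: "M \<in> handshake_patterns n" and R: "R \<in> kreweras_compatible n (odd_partition n M)"
  shows "refines {1..n} R (even_partition n M)"
proof -
  have part: "partition_on {1..n} R" using R by (auto simp: kreweras_compatible_def noncrossing_partitions_def)
  have sep: False
    if B: "B \<in> R" "i \<in> B" "j \<in> B" and xy: "{x, y} \<in> M" "x < y"
      and i: "x \<le> 2 * i \<and> 2 * i < y" and j: "\<not> (x \<le> 2 * j \<and> 2 * j < y)" for B i j x y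
  proof -
    obtain p q where pq: "same_region M (2 * p - 1) (2 * q - 1)" "p \<in> {1..n}" "q \<in> {1..n}"
      and iff: "\<And>i. x \<le> 2 * i \<and> 2 * i < y \<longleftrightarrow> 2 * p - 1 < 2 * i \<and> 2 * i < 2 * q - 1"
      using same_region_odd_arc[OF M xy] by metis
    obtain A where A: "A \<in> odd_partition n M" "p \<in> A"
      using region_partition_block[OF pq(2)] unfolding odd_partition_def by blast
    then have "q \<in> A" using region_partitionD(2)[of A n M _ p q] pq by (simp add: odd_partition_def)
    have "2 * j \<noteq> 2 * p - 1" "2 * j \<noteq> 2 * q - 1" using pq by auto presburger+
    then have "2 * j < 2 * p - 1 \<or> 2 * q - 1 < 2 * j" using iff[of j] j by linarith
    then have "crosses ((\<lambda>i. 2 * i - 1) ` A) ((\<lambda>i. 2 * i) ` B)"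
    proof
      assume "2 * j < 2 * p - 1"
      then have "2 * j < 2 * p - 1 \<and> 2 * p - 1 < 2 * i \<and> 2 * i < 2 * q - 1" using iff[of i] i by simp
      then show ?thesis unfolding crosses_def using A(2) \<open>q \<in> A\<close> B by blast
    next
      assume "2 * q - 1 < 2 * j"
      then have "2 * p - 1 < 2 * i \<and> 2 * i < 2 * q - 1 \<and> 2 * q - 1 < 2 * j" using iff[of i] i by simp
      then show ?thesis unfolding crosses_def using A(2) \<open>q \<in> A\<close> B by blast
    qed
    then show False using R A(1) B(1) unfolding kreweras_compatible_def by blast
  qed
  have same: "same_region M (2 * i) (2 * j)" if B: "B \<in> R" "i \<in> B" "j \<in> B" for B i j
    unfolding same_region_def
  proof (intro allI impI)
    fix x y assume xy: "{x, y} \<in> M \<and> x < y"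
    show "x \<le> 2 * i \<and> 2 * i < y \<longleftrightarrow> x \<le> 2 * j \<and> 2 * j < y"
      using sep[OF B] sep[OF B(1,3,2)] xy by blast
  qed
  have "\<exists>Y\<in>even_partition n M. B \<subseteq> Y" if B: "B \<in> R" for B
  proof -
    obtain i where i: "i \<in> B" using partition_onD3[OF part] B by (metis all_not_in_conv)
    have sub: "B \<subseteq> {1..n}" using partition_onD1[OF part] B by blast
    then obtain Y where Y: "Y \<in> even_partition n M" "i \<in> Y"
      using region_partition_block[of i n] i unfolding even_partition_def by blast
    have "B \<subseteq> Y"
    proof
      fix j assume j: "j \<in> B"
      then show "j \<in> Y"
        using region_partitionD(2)[OF Y(1)[unfolded even_partition_def] Y(2), of j] same[OF B i j] sub by blast
    qed
    then show ?thesis using Y(1) by blast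
  qed
  then show ?thesis
    using part partition_on_region_partition unfolding refines_def even_partition_def by blast
qed

text \<open>The even partition is not only maximal but greatest among the compatible ones, so the
  description by \<open>THE\<close> has exactly one solution.\<close>

lemma kreweras_complement_odd_partition:
  assumes M: "M \<in> handshake_patterns n"
  shows "kreweras_complement n (odd_partition n M) = even_partition n M"
  unfolding kreweras_complement_def
proof (rule the_equality)
  let ?K = "kreweras_compatible n (odd_partition n M)"
  show "even_partition n M \<in> ?K \<and> (\<forall>R\<in>?K. refines {1..n} (even_partition n M) R \<longrightarrow> R = even_partition n M)"
    using even_partition_compatible[OF M] kreweras_compatible_refines[OF M] refines_asym by blast
  fix Q assume "Q \<in> ?K \<and> (\<forall>R\<in>?K. refines {1..n} Q R \<longrightarrow> R = Q)"
  then show "Q = even_partition n M"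
    using even_partition_compatible[OF M] kreweras_compatible_refines[OF M] by blast
qed

lemma even_partition_rotate:
  assumes "M \<in> handshake_patterns n" "n > 0"
  shows "even_partition n (rotate_matching n M) = odd_partition n M"
proof -
  have "same_region (rotate_matching n M) (2 * i) (2 * j) \<longleftrightarrow> same_region M (2 * i - 1) (2 * j - 1)"
    if "i \<in> {1..n}" "j \<in> {1..n}" for i j
    using same_region_rotate[OF assms, of "2 * i - 1" "2 * j - 1"] that by auto
  then have "{(i, j). i \<in> {1..n} \<and> j \<in> {1..n} \<and> same_region (rotate_matching n M) (2 * i) (2 * j)} =
      {(i, j). i \<in> {1..n} \<and> j \<in> {1..n} \<and> same_region M (2 * i - 1) (2 * j - 1)}" by blast
  then show ?thesis by (simp only: even_partition_def odd_partition_def region_partition_def)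
qed

lemma region_partition_eqD:
  assumes "region_partition n M f = region_partition n M' f" "i \<in> {1..n}" "j \<in> {1..n}"
  shows "same_region M (f i) (f j) \<longleftrightarrow> same_region M' (f i) (f j)"
proof -
  obtain B where B: "B \<in> region_partition n M f" "i \<in> B" using region_partition_block[OF assms(2)] by blast
  then have B': "B \<in> region_partition n M' f" using assms(1) by simp
  show ?thesis using region_partitionD(2)[OF B, of j] region_partitionD(2)[OF B' B(2), of j] assms(3) by blast
qed

text \<open>The odd partition determines the even one by complementation. With parity, both
  determine the regions at all vertices, and these determine the arcs.\<close>

lemma odd_partition_inject:
  assumes M: "M \<in> handshake_patterns n" and M': "M' \<in> handshake_patterns n"
    and eq: "odd_partition n M = odd_partition n M'"
  shows "M = M'"
proof -
  have eq': "even_partition n M = even_partition n M'"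
    using eq kreweras_complement_odd_partition[OF M] kreweras_complement_odd_partition[OF M'] by simp
  have pos: "same_region M k l \<longleftrightarrow> same_region M' k l" if "k \<in> {1..2 * n}" "l \<in> {1..2 * n}" for k l
  proof (cases "even k \<longleftrightarrow> even l")
    case False
    then show ?thesis using same_region_parity[OF M, of k l] same_region_parity[OF M', of k l] that by auto
  next
    case True
    show ?thesis
    proof (cases "even k")
      case True
      then obtain i j where "k = 2 * i" "l = 2 * j" using \<open>even k \<longleftrightarrow> even l\<close> by (auto elim!: evenE)
      then show ?thesis
        using region_partition_eqD[OF eq'[unfolded even_partition_def], of i j] that by auto
    next
      case False
      then obtain i j where "k = 2 * i + 1" "l = 2 * j + 1" using \<open>even k \<longleftrightarrow> even l\<close> by (auto elim!: oddE)
      then show ?thesis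
        using region_partition_eqD[OF eq[unfolded odd_partition_def], of "i + 1" "j + 1"] that by auto
    qed
  qed
  \<comment> \<open>The vertex 0 occurs as \<open>a - 1\<close> for \<open>a = 1\<close> and is
    replaced by \<open>2 * n\<close>.\<close>
  have same: "same_region M k l \<longleftrightarrow> same_region M' k l" if kl: "k \<le> 2 * n" "l \<in> {1..2 * n}" for k l
  proof (cases "k = 0")
    case True
    have "same_region N 0 l \<longleftrightarrow> same_region N (2 * n) l" if "N \<in> handshake_patterns n" for N
      using same_region_0[OF that] same_region_sym same_region_trans by blast
    then show ?thesis using pos[of "2 * n" l] kl M M' True by auto
  qed (use pos kl in auto)
  have pm: "perfect_matching_on {1..2 * n} M" "perfect_matching_on {1..2 * n} M'"
    using M M' by (simp_all add: handshake_patterns_iff)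
  have *: "{a, b} \<in> M'" if ab: "{a, b} \<in> M" "a < b" for a b
  proof -
    have V: "a \<in> {1..2 * n}" "b \<in> {1..2 * n}" using perfect_matching_on_pair[OF pm(1) ab(1)] by auto
    have "1 \<le> a" "b \<le> 2 * n" using V by simp_all
    then have le: "1 \<le> b - 1" "b - 1 \<le> 2 * n" "a \<le> 2 * n" "a - 1 \<le> 2 * n" using ab(2) by linarith+
    then have "b - 1 \<in> {1..2 * n}" by simp
    then have "same_region M' a (b - 1)" using same_region_arc(1)[OF M ab] same[of a "b - 1"] le(3) by blast
    moreover have "same_region M' (a - 1) b"
      using same_region_arc(2)[OF M ab] same[of "a - 1" b] le(4) V(2) by blast
    ultimately show ?thesis using same_region_arcD[OF M'] V ab(2) by auto
  qed
  show ?thesis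
  proof (rule perfect_matching_on_eqI[OF pm])
    fix x y assume xy: "{x, y} \<in> M"
    then consider "x < y" | "y < x" using perfect_matching_on_pair(1)[OF pm(1)] by fastforce
    then show "{x, y} \<in> M'" using *[of x y] *[of y x] xy by cases (simp_all add: insert_commute)
  qed
qed

section \<open>The matching of a noncrossing partition\<close>

locale noncrossing_partition =
  fixes n :: nat and P :: "nat set set"
  assumes P: "P \<in> noncrossing_partitions n"
begin

definition E :: "nat \<Rightarrow> nat \<Rightarrow> bool"
  where "E i j \<longleftrightarrow> (\<exists>B\<in>P. i \<in> B \<and> j \<in> B)"

text \<open>The second alternative is the step from the maximum of a block back to its minimum.\<close>

definition next_in_block :: "nat \<Rightarrow> nat \<Rightarrow> bool"
  where "next_in_block i j \<longleftrightarrow> E i j \<and>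
    (i < j \<and> (\<forall>k. E i k \<longrightarrow> k \<le> i \<or> j \<le> k) \<or> j \<le> i \<and> (\<forall>k. E i k \<longrightarrow> j \<le> k \<and> k \<le> i))"

lemma part: "partition_on {1..n} P"
  using P by (simp add: noncrossing_partitions_def)

lemma E_range: "E i j \<Longrightarrow> i \<in> {1..n} \<and> j \<in> {1..n}"
  using partition_onD1[OF part] unfolding E_def by blast

lemma E_refl: "i \<in> {1..n} \<Longrightarrow> E i i"
  using partition_onD1[OF part] unfolding E_def by blast

lemma E_sym: "E i j \<Longrightarrow> E j i"
  unfolding E_def by blast

lemma E_trans:
  assumes "E i j" "E j k"
  shows "E i k"
proof -
  obtain A B where "A \<in> P" "i \<in> A" "j \<in> A" "B \<in> P" "j \<in> B" "k \<in> B"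
    using assms unfolding E_def by blast
  moreover from this have "A = B" using disjointD[OF partition_onD2[OF part], of A B] by blast
  ultimately show ?thesis unfolding E_def by blast
qed

lemma E_noncrossing:
  assumes "E a c" "E b d" "a < b" "b < c" "c < d"
  shows "E a b" "E b c" "E a d"
proof -
  obtain A B where AB: "A \<in> P" "a \<in> A" "c \<in> A" "B \<in> P" "b \<in> B" "d \<in> B"
    using assms unfolding E_def by blast
  then have "A = B" using P assms(3-5) unfolding noncrossing_partitions_def by blast
  then show "E a b" "E b c" "E a d" using AB unfolding E_def by blast+
qed

lemma next_in_blockD:
  assumes "next_in_block i j"
  shows "E i j" "i < j \<Longrightarrow> E i k \<Longrightarrow> i < k \<Longrightarrow> k < j \<Longrightarrow> False"
    "j \<le> i \<Longrightarrow> E i k \<Longrightarrow> j \<le> k \<and> k \<le> i"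
  using assms unfolding next_in_block_def by (auto simp: not_le)

lemma next_ex:
  assumes "i \<in> {1..n}"
  shows "\<exists>j. next_in_block i j"
proof (cases "\<exists>k. E i k \<and> i < k")
  case True
  define j where "j = (LEAST k. E i k \<and> i < k)"
  have "E i j \<and> i < j" unfolding j_def by (rule LeastI_ex[OF True])
  moreover have "j \<le> k" if "E i k" "i < k" for k unfolding j_def by (rule Least_le) (use that in simp)
  ultimately show ?thesis unfolding next_in_block_def by (metis not_le)
next
  case False
  define j where "j = (LEAST k. E i k)"
  have "E i j" unfolding j_def by (rule LeastI[of _ i]) (rule E_refl[OF assms])
  moreover have "j \<le> k" if "E i k" for k unfolding j_def by (rule Least_le) (rule that)
  ultimately show ?thesis unfolding next_in_block_def using False by (metis not_le)
qed

lemma prev_ex: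
  assumes "j \<in> {1..n}"
  shows "\<exists>i. next_in_block i j"
proof (cases "\<exists>k. E j k \<and> k < j")
  case True
  define i where "i = (GREATEST k. E j k \<and> k < j)"
  have i: "E j i \<and> i < j" unfolding i_def by (rule GreatestI_ex_nat[OF True, of j]) simp
  have "k \<le> i" if "E j k" "k < j" for k
    unfolding i_def by (rule Greatest_le_nat[of _ k j]) (use that in auto)
  then show ?thesis using i E_sym E_trans unfolding next_in_block_def by (metis not_le)
next
  case False
  define i where "i = (GREATEST k. E j k)"
  have i: "E j i" unfolding i_def
    by (rule GreatestI_nat[of _ j n]) (use E_refl[OF assms] E_range in auto)
  have "k \<le> i" if "E j k" for k
    unfolding i_def by (rule Greatest_le_nat[of _ k n]) (use that E_range in auto)
  then show ?thesis using i False E_sym E_trans unfolding next_in_block_def by (metis not_le)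
qed

lemma next_unique:
  assumes "next_in_block i j" "next_in_block i j'"
  shows "j = j'"
  using next_in_blockD[OF assms(1)] next_in_blockD[OF assms(2)] by (metis linorder_neqE_nat not_le le_antisym order.strict_trans1)

lemma prev_unique:
  assumes ij: "next_in_block i j" and i'j: "next_in_block i' j"
  shows "i = i'"
proof -
  have E: "E i j" "E i' j" "E i i'" "E i' i"
    using next_in_blockD(1)[OF ij] next_in_blockD(1)[OF i'j] E_sym E_trans by blast+
  show ?thesis
    using next_in_blockD(2,3)[OF ij _ E(3)] next_in_blockD(2,3)[OF i'j _ E(4)]
    by (meson le_antisym le_less_linear less_le_trans linorder_neqE_nat)
qed

definition succ :: "nat \<Rightarrow> nat"
  where "succ i = (THE j. next_in_block i j)"

definition pred :: "nat \<Rightarrow> nat"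
  where "pred j = (THE i. next_in_block i j)"

lemma succ_eq: "next_in_block i j \<Longrightarrow> succ i = j"
  unfolding succ_def by (rule the_equality) (auto intro: next_unique)

lemma pred_eq: "next_in_block i j \<Longrightarrow> pred j = i"
  unfolding pred_def by (rule the_equality) (auto intro: prev_unique)

text \<open>The label \<open>i\<close> lies between the points \<open>2 * i - 1\<close> and
  \<open>2 * i\<close>. The boundary of its thickened block runs from the point just after
  \<open>i\<close> to the point just before the next label; \<open>x div 2 + 1\<close> is the label
  just after an odd point \<open>x\<close>.\<close>

definition mate :: "nat \<Rightarrow> nat"
  where "mate x = (if even x then 2 * succ (x div 2) - 1 else 2 * pred (x div 2 + 1))"

definition matching :: "nat set set"
  where "matching = (\<lambda>x. {x, mate x}) ` {1..2 * n}"

lemma mate_next: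
  assumes "next_in_block i j"
  shows "mate (2 * i) = 2 * j - 1" "mate (2 * j - 1) = 2 * i"
proof -
  show "mate (2 * i) = 2 * j - 1" by (simp add: mate_def succ_eq[OF assms])
  have "j \<ge> 1" using next_in_blockD(1)[OF assms] E_range by force
  then obtain l where "j = Suc l" by (cases j) auto
  then show "mate (2 * j - 1) = 2 * i" using pred_eq[OF assms] by (simp add: mate_def)
qed

lemma point_cases:
  assumes "x \<in> {1..2 * n}"
  obtains (even) i j where "next_in_block i j" "x = 2 * i" | (odd) i j where "next_in_block i j" "x = 2 * j - 1"
proof (cases "even x")
  case True
  then obtain i where i: "x = 2 * i" by (elim evenE)
  then show thesis using next_ex[of i] assms even by auto
next
  case False
  then obtain j where j: "x = 2 * j + 1" by (elim oddE)
  then have "Suc j \<in> {1..n}" using assms by auto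
  then show thesis using prev_ex[of "Suc j"] odd j by fastforce
qed

lemma mate_involution:
  assumes "x \<in> {1..2 * n}"
  shows "mate x \<in> {1..2 * n} \<and> mate x \<noteq> x \<and> mate (mate x) = x"
proof -
  have pair: "2 * i \<in> {1..2 * n} \<and> 2 * j - 1 \<in> {1..2 * n} \<and> 2 * i \<noteq> 2 * j - 1" if "next_in_block i j" for i j
  proof -
    have "i \<in> {1..n}" "j \<in> {1..n}" using E_range next_in_blockD(1)[OF that] by blast+
    then show ?thesis by auto presburger
  qed
  show ?thesis
  using assms
  proof (cases rule: point_cases)
    case (even i j)
    then show ?thesis using pair[OF even(1)] mate_next[OF even(1)] by simp
  next
    case (odd i j)
    then show ?thesis using pair[OF odd(1)] mate_next[OF odd(1)] by simp
  qed
qed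

lemma matching_perfect: "perfect_matching_on {1..2 * n} matching"
  unfolding matching_def by (rule perfect_matching_on_involution(1)[OF mate_involution])

lemma matching_cases:
  assumes "{x, y} \<in> matching" "x < y"
  obtains (up) i j where "next_in_block i j" "i < j" "x = 2 * i" "y = 2 * j - 1"
    | (down) i j where "next_in_block i j" "j \<le> i" "x = 2 * j - 1" "y = 2 * i"
proof -
  have x: "x \<in> {1..2 * n}" by (rule perfect_matching_on_pair(2)[OF matching_perfect assms(1)])
  have y: "y = mate x"
    using perfect_matching_on_involution(2)[OF mate_involution x] assms(1) unfolding matching_def by blast
  show thesis
  using x
  proof (cases rule: point_cases)
    case (even i j)
    then have "y = 2 * j - 1" using y mate_next[OF even(1)] by simp
    moreover from this have "i < j" using even assms(2) by simp
    ultimately show thesis using up even by blast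
  next
    case (odd i j)
    then have "y = 2 * i" using y mate_next[OF odd(1)] by simp
    moreover from this have "j \<le> i" using odd assms(2) by simp
    ultimately show thesis using down odd by blast
  qed
qed

lemma matching_arc:
  assumes "next_in_block i j"
  shows "{2 * i, 2 * j - 1} \<in> matching"
proof -
  have "2 * i \<in> {1..2 * n}" using E_range next_in_blockD(1)[OF assms] by fastforce
  then show ?thesis unfolding matching_def using mate_next(1)[OF assms] by force
qed

text \<open>A crossing would, as blocks do not cross, produce an element strictly between two
  consecutive elements of its block or one beyond the minimum or maximum of its block.\<close>

lemma matching_handshake: "matching \<in> handshake_patterns n"
proof -
  have False if ac: "{a, c} \<in> matching" and bd: "{b, d} \<in> matching" and ord: "a < b" "b < c" "c < d" for a b c d
  proof -
    have "a < c" "b < d" using ord by auto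
    show False
    using ac \<open>a < c\<close>
    proof (cases rule: matching_cases)
      case (up i j)
      note ij = next_in_blockD[OF up(1)]
      show False
      using bd \<open>b < d\<close>
      proof (cases rule: matching_cases)
        case a: (up i' j')
        have o: "i < i'" "i' < j" "j < j'" using ord up a by auto
        show False using ij(2)[OF up(2) E_noncrossing(1)[OF ij(1) next_in_blockD(1)[OF a(1)] o] o(1,2)] .
      next
        case a: (down i' j')
        have o: "i < j'" "j' < j" "j \<le> i'" using ord up a by auto
        have E': "E j' i'" by (rule E_sym[OF next_in_blockD(1)[OF a(1)]])
        have "E i j'"
        proof (cases "j = i'")
          case True
          then show ?thesis using ij(1) E' E_sym E_trans by blast
        next
          case False
          then show ?thesis using E_noncrossing(1)[OF ij(1) E' o(1,2)] o(3) by simp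
        qed
        then show False using ij(2)[OF up(2) _ o(1,2)] by blast
      qed
    next
      case (down i j)
      note ij = next_in_blockD[OF down(1)]
      have Eji: "E j i" by (rule E_sym[OF ij(1)])
      show False
      using bd \<open>b < d\<close>
      proof (cases rule: matching_cases)
        case a: (up i' j')
        have o: "j \<le> i'" "i' < i" "i < j'" using ord down a by auto
        have "E i j'"
        proof (cases "j = i'")
          case True
          then show ?thesis using ij(1) next_in_blockD(1)[OF a(1)] E_trans by blast
        next
          case False
          then have "E j j'" using E_noncrossing(3)[OF Eji next_in_blockD(1)[OF a(1)] _ o(2,3)] o(1) by simp
          then show ?thesis using ij(1) E_trans by blast
        qed
        then show False using ij(3)[OF down(2)] o(3) by (meson not_le)
      next
        case a: (down i' j')
        have o: "j < j'" "j' \<le> i" "i < i'" using ord down a by auto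
        have E': "E j' i'" by (rule E_sym[OF next_in_blockD(1)[OF a(1)]])
        have "E i i'"
        proof (cases "j' = i")
          case True
          then show ?thesis using E' by simp
        next
          case False
          then have "E j i'" using E_noncrossing(3)[OF Eji E' o(1) _ o(3)] o(2) by simp
          then show ?thesis using ij(1) E_trans by blast
        qed
        then show False using ij(3)[OF down(2)] o(3) by (meson not_le)
      qed
    qed
  qed
  then show ?thesis using matching_perfect unfolding handshake_patterns_iff by blast
qed

text \<open>The labels cut off by an arc, strictly between consecutive elements of a block or from
  its minimum to its maximum, form a union of blocks.\<close>

lemma E_same_side:
  assumes pq: "next_in_block p q" and ij: "E i j"
  shows "p < q \<Longrightarrow> p < i \<Longrightarrow> i < q \<Longrightarrow> p < j \<and> j < q"
    and "q \<le> p \<Longrightarrow> q \<le> i \<Longrightarrow> i \<le> p \<Longrightarrow> q \<le> j \<and> j \<le> p"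
proof -
  note D = next_in_blockD[OF pq]
  show "p < j \<and> j < q" if *: "p < q" "p < i" "i < q"
  proof (rule ccontr)
    assume "\<not> (p < j \<and> j < q)"
    then consider "j = p" | "j = q" | "j < p" | "q < j" by linarith
    then have "E p i"
    proof cases
      case 1 then show ?thesis using E_sym[OF ij] by simp
    next
      case 2 then show ?thesis using D(1) E_sym[OF ij] E_trans by blast
    next
      case 3 show ?thesis by (rule E_noncrossing(2)[OF E_sym[OF ij] D(1) 3 *(2,3)])
    next
      case 4 show ?thesis by (rule E_noncrossing(1)[OF D(1) ij *(2,3) 4])
    qed
    then show False using D(2)[OF *(1) _ *(2,3)] by blast
  qed
  show "q \<le> j \<and> j \<le> p" if *: "q \<le> p" "q \<le> i" "i \<le> p"
  proof (cases "q = i \<or> i = p")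
    case True
    then have "E p j" using D(1) ij E_trans by blast
    then show ?thesis by (rule D(3)[OF *(1)])
  next
    case False
    then have o: "q < i" "i < p" using * by auto
    show ?thesis
    proof (rule ccontr)
      assume "\<not> (q \<le> j \<and> j \<le> p)"
      then consider "j < q" | "p < j" by linarith
      then have "E p j"
      proof cases
        case 1
        have "E j q" using E_noncrossing(1)[OF E_sym[OF ij] E_sym[OF D(1)] 1 o] .
        then show ?thesis using D(1) E_sym E_trans by blast
      next
        case 2
        have "E q j" using E_noncrossing(3)[OF E_sym[OF D(1)] ij o 2] .
        then show ?thesis using D(1) E_trans by blast
      qed
      then show False using D(3)[OF *(1)] \<open>\<not> (q \<le> j \<and> j \<le> p)\<close> by blast
    qed
  qed
qed

lemma same_region_matching:
  assumes V: "i \<in> {1..n}" "j \<in> {1..n}"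
  shows "same_region matching (2 * i - 1) (2 * j - 1) \<longleftrightarrow> E i j"
proof
  assume ij: "E i j"
  show "same_region matching (2 * i - 1) (2 * j - 1)"
    unfolding same_region_def
  proof (intro allI impI, elim conjE)
    fix x y assume xy: "{x, y} \<in> matching" "x < y"
    show "x \<le> 2 * i - 1 \<and> 2 * i - 1 < y \<longleftrightarrow> x \<le> 2 * j - 1 \<and> 2 * j - 1 < y"
    using xy
    proof (cases rule: matching_cases)
      case (up p q)
      have "p < k \<and> k < q \<longleftrightarrow> x \<le> 2 * k - 1 \<and> 2 * k - 1 < y" if "k \<in> {1..n}" for k
        using up(2-4) that by auto
      then show ?thesis
        using E_same_side(1)[OF up(1) ij up(2)] E_same_side(1)[OF up(1) E_sym[OF ij] up(2)] V by blast
    next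
      case (down p q)
      have "q \<le> k \<and> k \<le> p \<longleftrightarrow> x \<le> 2 * k - 1 \<and> 2 * k - 1 < y" if "k \<in> {1..n}" for k
        using down(2-4) that by auto
      then show ?thesis
        using E_same_side(2)[OF down(1) ij down(2)] E_same_side(2)[OF down(1) E_sym[OF ij] down(2)] V by blast
    qed
  qed
next
  have *: "E i j" if r: "same_region matching (2 * i - 1) (2 * j - 1)" and V: "i \<in> {1..n}" "j \<in> {1..n}" and "i < j" for i j
  proof (rule ccontr)
    assume "\<not> E i j"
    \<comment> \<open>The last element up to \<open>j\<close> of the block of \<open>i\<close>: the
      arc from it to its successor in the block separates the vertices of \<open>i\<close> and
      \<open>j\<close>, also when it is the closing arc from maximum to minimum.\<close>
    define k where "k = (GREATEST k. E i k \<and> k \<le> j)"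
    have k: "E i k \<and> k \<le> j" unfolding k_def
      by (rule GreatestI_nat[of _ i j]) (use E_refl[OF V(1)] \<open>i < j\<close> in auto)
    have max: "l \<le> k" if "E i l" "l \<le> j" for l
      unfolding k_def by (rule Greatest_le_nat[of _ l j]) (use that in auto)
    have "i \<le> k" using max[OF E_refl[OF V(1)]] \<open>i < j\<close> by simp
    have "k < j" using k \<open>\<not> E i j\<close> by (metis order_le_imp_less_or_eq)
    obtain q where q: "next_in_block k q" using next_ex[of k] E_range k by blast
    have iq: "E i q" using k next_in_blockD(1)[OF q] E_trans by blast
    have arc: "{2 * k, 2 * q - 1} \<in> matching" by (rule matching_arc[OF q])
    show False
    proof (cases "k < q")
      case True
      have "\<not> q \<le> j" using max[OF iq] True by auto
      moreover have "2 * k < 2 * q - 1" using True by simp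
      ultimately show False
        using same_regionD[OF r arc] \<open>i \<le> k\<close> \<open>k < j\<close> V by auto
    next
      case False
      then have "q \<le> i \<and> i \<le> k" using next_in_blockD(3)[OF q, of i] E_sym k by auto
      moreover have "q \<in> {1..n}" using iq E_range by blast
      moreover have "{2 * q - 1, 2 * k} \<in> matching" using arc by (simp add: insert_commute)
      moreover have "2 * q - 1 < 2 * k" using calculation by auto
      ultimately show False
        using same_regionD[OF r, of "2 * q - 1" "2 * k"] \<open>k < j\<close> V by auto
    qed
  qed
  assume r: "same_region matching (2 * i - 1) (2 * j - 1)"
  consider "i < j" | "i = j" | "j < i" by linarith
  then show "E i j"
  proof cases
    case 1 then show ?thesis using *[OF r V] by simp
  next
    case 2 then show ?thesis using E_refl V by simp
  next
    case 3 then show ?thesis using *[OF same_region_sym[OF r] V(2,1)] E_sym by simp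
  qed
qed

lemma odd_partition_matching: "odd_partition n matching = P"
proof -
  have "{(i, j). i \<in> {1..n} \<and> j \<in> {1..n} \<and> same_region matching (2 * i - 1) (2 * j - 1)} =
      {(i, j). \<exists>p\<in>P. i \<in> p \<and> j \<in> p}"
    using same_region_matching E_range unfolding E_def by blast
  then show ?thesis
    unfolding odd_partition_def region_partition_def using partition_on_eq_quotient[OF part] by simp
qed

end

lemma bij_betw_odd_partition: "bij_betw (odd_partition n) (handshake_patterns n) (noncrossing_partitions n)"
proof (rule bij_betw_imageI)
  show "inj_on (odd_partition n) (handshake_patterns n)"
    using odd_partition_inject by (rule inj_onI)
  show "odd_partition n ` handshake_patterns n = noncrossing_partitions n"
  proof
    show "noncrossing_partitions n \<subseteq> odd_partition n ` handshake_patterns n"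
    proof
      fix P assume "P \<in> noncrossing_partitions n"
      then interpret noncrossing_partition n P by unfold_locales
      show "P \<in> odd_partition n ` handshake_patterns n"
        using odd_partition_matching matching_handshake by (metis imageI)
    qed
  qed (use odd_partition_noncrossing in blast)
qed

section \<open>Cyclic sieving\<close>

lemma has_mult_orderI:
  assumes "m > 0" "\<And>k. z ^ k = 1 \<longleftrightarrow> m dvd k"
  shows "has_mult_order z m"
  using assms by (auto simp: has_mult_order_def dest: dvd_imp_le)

lemma has_mult_order_power:
  assumes z: "has_mult_order z N"
  shows "has_mult_order (z ^ d) (N div gcd d N)"
proof (rule has_mult_orderI)
  have N: "N > 0" using z by (simp add: has_mult_order_def)
  then show "N div gcd d N > 0" by (simp add: div_greater_zero_iff dvd_imp_le)
  fix k
  have g: "gcd d N > 0" using N by simp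
  have "(z ^ d) ^ k = 1 \<longleftrightarrow> N dvd d * k"
    using has_mult_order_power_eq_1_iff[OF z, of "d * k"] by (simp add: power_mult)
  also have "\<dots> \<longleftrightarrow> gcd d N * (N div gcd d N) dvd gcd d N * ((d div gcd d N) * k)"
    by (simp add: mult.assoc[symmetric])
  also have "\<dots> \<longleftrightarrow> N div gcd d N dvd (d div gcd d N) * k"
    using g by (simp only: nat_mult_dvd_cancel1)
  also have "\<dots> \<longleftrightarrow> N div gcd d N dvd k"
  proof (rule coprime_dvd_mult_right_iff)
    show "coprime (N div gcd d N) (d div gcd d N)"
      using div_gcd_coprime[of d N] N by (simp add: coprime_commute)
  qed
  finally show "(z ^ d) ^ k = 1 \<longleftrightarrow> N div gcd d N dvd k" .
qed

lemma funpow_fixed: "(f ^^ e) x = x \<Longrightarrow> (f ^^ (e * k)) x = x"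
  by (induction k) (auto simp: funpow_add)

lemma funpow_fixed_gcd:
  assumes "(f ^^ N) x = x"
  shows "(f ^^ d) x = x \<longleftrightarrow> (f ^^ gcd d N) x = x"
proof
  assume "(f ^^ gcd d N) x = x"
  then have "(f ^^ (gcd d N * (d div gcd d N))) x = x" by (rule funpow_fixed)
  then show "(f ^^ d) x = x" by simp
next
  assume d: "(f ^^ d) x = x"
  show "(f ^^ gcd d N) x = x"
  proof (cases "d = 0")
    case False
    then obtain a b where "d * a = N * b + gcd d N" using bezout_nat by blast
    then have "(f ^^ (d * a)) x = (f ^^ gcd d N) ((f ^^ (N * b)) x)"
      by (simp add: add.commute[of "N * b"] funpow_add)
    then show ?thesis using funpow_fixed[OF d, of a] funpow_fixed[OF assms, of b] by simp
  qed (use assms in simp)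
qed

text \<open>Both sides depend on \<open>d\<close> only through \<open>e\<close>: the fixed points by
  Bezout, and the value of the polynomial through the order \<open>2 * n div e\<close> of
  \<open>z ^ d\<close>.\<close>

lemma card_rotate_fixed_eq_q_catalan:
  assumes n: "n > 0" and z: "has_mult_order z (2 * n)"
  shows "of_nat (card {M \<in> handshake_patterns n. (rotate_matching n ^^ d) M = M}) =
    poly (map_poly of_rat (q_catalan n)) (z ^ d)"
proof -
  define e where "e = gcd d (2 * n)"
  have e: "0 < e" "e dvd 2 * n" using n by (auto simp: e_def)
  have fixed: "{M \<in> handshake_patterns n. (rotate_matching n ^^ d) M = M} =
      {M \<in> handshake_patterns n. (rotate_matching n ^^ e) M = M}"
    using funpow_fixed_gcd[OF rotate_handshake_period[OF _ n]] unfolding e_def by blast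
  have order: "has_mult_order (z ^ d) (2 * n div e)"
    unfolding e_def by (rule has_mult_order_power[OF z])
  show ?thesis
  proof (cases "e = 2 * n")
    case True
    have "{M \<in> handshake_patterns n. (rotate_matching n ^^ e) M = M} = handshake_patterns n"
      using rotate_handshake_period[OF _ n] True by auto
    moreover have "z ^ d = 1" using order True n by (simp add: has_mult_order_def)
    moreover have "of_nat (card (handshake_patterns n)) * (fact n * fact (n + 1)) = (fact (2 * n) :: complex)"
      using card_handshake_patterns[of n, THEN arg_cong[where f = "of_nat :: nat \<Rightarrow> complex"]]
      by (simp only: of_nat_mult of_nat_fact)
    then have "of_nat (card (handshake_patterns n)) * (fact n * fact (n + 1)) =
        poly (map_poly of_rat (q_catalan n)) (1 :: complex) * (fact n * fact (n + 1))"
      by (simp only: poly_q_catalan_1)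
    then have "of_nat (card (handshake_patterns n)) = poly (map_poly of_rat (q_catalan n)) (1 :: complex)"
      by (simp del: fact_Suc)
    ultimately show ?thesis unfolding fixed by simp
  next
    case False
    then have "e < 2 * n" using e n by (meson dvd_imp_le le_neq_implies_less mult_pos_pos zero_less_numeral)
    then have "2 * n div e \<ge> 2" using proper_divisor_le_half[OF e(2)] e(1) by (simp add: less_eq_div_iff_mult_less_eq mult.commute)
    then interpret primitive_root "z ^ d" "2 * n div e" using order by unfold_locales
    show ?thesis
      unfolding fixed card_rotate_fixed[OF n e(1) \<open>e < 2 * n\<close> e(2)]
      using poly_q_catalan[OF n, of e] e(2) by simp
  qed
qed

text \<open>Complementation undoes rotation; keeping the rotation inside avoids naming its
  inverse.\<close>

lemma kreweras_complement_rotate: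
  assumes "M \<in> handshake_patterns n" "n > 0"
  shows "(kreweras_complement n ^^ d) (odd_partition n ((rotate_matching n ^^ d) M)) = odd_partition n M"
proof (induction d)
  case (Suc d)
  have H: "(rotate_matching n ^^ d) M \<in> handshake_patterns n" by (rule rotate_handshake_funpow(1)[OF assms])
  have "kreweras_complement n (odd_partition n (rotate_matching n ((rotate_matching n ^^ d) M))) =
      odd_partition n ((rotate_matching n ^^ d) M)"
    using kreweras_complement_odd_partition[OF rotate_handshake_closed[OF H assms(2)]]
      even_partition_rotate[OF H assms(2)] by simp
  then show ?case using Suc by (simp add: funpow_swap1)
qed simp

lemma odd_partition_fixed_iff:
  assumes M: "M \<in> handshake_patterns n" and n: "n > 0"
  shows "(kreweras_complement n ^^ d) (odd_partition n M) = odd_partition n M \<longleftrightarrow>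
    (rotate_matching n ^^ d) M = M"
proof -
  \<comment> \<open>Rotation backwards by \<open>d\<close>: the exponent completes \<open>d\<close>
    to a multiple of the period \<open>2 * n\<close>.\<close>
  define M' where "M' = (rotate_matching n ^^ (2 * n * d - d)) M"
  have M': "M' \<in> handshake_patterns n" unfolding M'_def by (rule rotate_handshake_funpow(1)[OF M n])
  have "d + (2 * n * d - d) = 2 * n * d" using n by simp
  then have "(rotate_matching n ^^ d) M' = (rotate_matching n ^^ (2 * n * d)) M"
    unfolding M'_def by (metis comp_apply funpow_add)
  then have M'_M: "(rotate_matching n ^^ d) M' = M"
    using funpow_fixed[OF rotate_handshake_period[OF M n]] by simp
  then have K: "(kreweras_complement n ^^ d) (odd_partition n M) = odd_partition n M'"
    using kreweras_complement_rotate[OF M' n, of d] by simp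
  show ?thesis
  proof
    assume "(kreweras_complement n ^^ d) (odd_partition n M) = odd_partition n M"
    then have "M' = M" using odd_partition_inject[OF M' M] K by simp
    then show "(rotate_matching n ^^ d) M = M" using M'_M by simp
  next
    assume "(rotate_matching n ^^ d) M = M"
    then show "(kreweras_complement n ^^ d) (odd_partition n M) = odd_partition n M"
      using kreweras_complement_rotate[OF M n, of d] by simp
  qed
qed

theorem theorem8p2:
  fixes n :: nat
  assumes "n > 0"
  shows "cyclic_sieving (integer_mod_group (2 * n)) 1 (handshake_patterns n)
           (residue_action (handshake_patterns n) (rotate_matching n)) (q_catalan n) \<and>
         cyclic_sieving (integer_mod_group (2 * n)) 1 (noncrossing_partitions n)
           (residue_action (noncrossing_partitions n) (kreweras_complement n)) (q_catalan n)"
proof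
  let ?H = "handshake_patterns n" and ?R = "rotate_matching n" and ?g = "odd_partition n"
    and ?NC = "noncrossing_partitions n" and ?K = "kreweras_complement n"
  show "cyclic_sieving (integer_mod_group (2 * n)) 1 ?H (residue_action ?H ?R) (q_catalan n)"
    using assms rotate_handshake_closed rotate_handshake_period
      card_rotate_fixed_eq_q_catalan finite_handshake_patterns
    by (intro cyclic_sieving_residue_action) auto
  note bij = bij_betw_odd_partition[of n]
  show "cyclic_sieving (integer_mod_group (2 * n)) 1 ?NC (residue_action ?NC ?K) (q_catalan n)"
  proof (rule cyclic_sieving_residue_action)
    show "finite ?NC" using bij_betw_finite[OF bij] finite_handshake_patterns by blast
    fix P assume "P \<in> ?NC"
    then obtain M where M: "M \<in> ?H" "P = ?g M" using bij by (auto simp: bij_betw_def)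
    then show "?K P \<in> ?NC"
      by (simp add: kreweras_complement_odd_partition even_partition_noncrossing)
    show "(?K ^^ (2 * n)) P = P"
      using odd_partition_fixed_iff[OF M(1) assms] rotate_handshake_period[OF M(1) assms] M(2) by blast
  next
    fix z d assume z: "has_mult_order z (2 * n)"
    \<comment> \<open>Although \<open>odd_partition\<close> turns rotation into the inverse of
      complementation, it restricts to a bijection of fixed points for each
      \<open>d\<close>.\<close>
    have "bij_betw ?g {M \<in> ?H. (?R ^^ d) M = M} {P \<in> ?NC. (?K ^^ d) P = P}"
    proof (rule bij_betw_imageI)
      show "inj_on ?g {M \<in> ?H. (?R ^^ d) M = M}"
        by (rule inj_on_subset[OF bij_betw_imp_inj_on[OF bij]]) blast
      show "?g ` {M \<in> ?H. (?R ^^ d) M = M} = {P \<in> ?NC. (?K ^^ d) P = P}"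
      proof (intro equalityI subsetI)
        fix P assume "P \<in> ?g ` {M \<in> ?H. (?R ^^ d) M = M}"
        then show "P \<in> {P \<in> ?NC. (?K ^^ d) P = P}"
          using odd_partition_fixed_iff[OF _ assms] odd_partition_noncrossing by auto
      next
        fix P assume P: "P \<in> {P \<in> ?NC. (?K ^^ d) P = P}"
        then have "P \<in> ?g ` ?H" using bij_betw_imp_surj_on[OF bij] by simp
        then obtain M where "M \<in> ?H" "P = ?g M" by (elim imageE)
        then show "P \<in> ?g ` {M \<in> ?H. (?R ^^ d) M = M}"
          using odd_partition_fixed_iff[OF _ assms] P by simp
      qed
    qed
    then show "of_nat (card {P \<in> ?NC. (?K ^^ d) P = P}) = poly (map_poly of_rat (q_catalan n)) (z ^ d)"
      using card_rotate_fixed_eq_q_catalan[OF assms z, of d] by (simp add: bij_betw_same_card)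
  qed (use assms in simp)
qed

end
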